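(* For $\nu\in\mathbb N$ let $K^{\mathscr H}_\nu$ denote the extended hard-edge kernel with all parameters $\nu_1=\nu_2=\cdots=\nu$. Fix $\tau,t>0$ and set $$\widehat K_\nu(\tau,x;t,y)=\frac{e^{[t\nu]\left(\log\nu-\frac1{2\nu}\right)-y}}{(\Gamma(\nu))^{[t\nu]-[\tau\nu]}}\;K^{\mathscr H}_\nu\left([\tau\nu],\,e^{[\tau\nu]\left(\log\nu-\frac1{2\nu}\right)-x};\ [t\nu],\,e^{[t\nu]\left(\log\nu-\frac1{2\nu}\right)-y}\right),$$ where $[\cdot]$ is the integer part. Then $$\widehat K_\nu(\tau,x;t,y)\xrightarrow[\nu\to\infty]{}K_{\mathfrak C}(\tau,x;t,y)$$ uniformly for $x$ and $y$ in compact subsets of $(0,\infty)$, where $K_{\mathfrak C}$ is the extended critical kernel.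
   Context: **Extended hard-edge kernel.** For $\nu_1,\nu_2,\ldots\in\mathbb N$, $q,r\in\mathbb N$, $x,y>0$, $$K^{\mathscr H}_{\vec\nu}(q,x;r,y)=-\frac{1_{r>q}}{x}G^{r-q,0}_{0,r-q}\!\left(\begin{matrix}-\\ \nu_{q+1}-1,\ldots,\nu_r-1\end{matrix}\Big|\frac yx\right)+\int_{S'_\sigma}\frac{d\sigma}{2\pi i}\int_{S_\zeta}\frac{d\zeta}{2\pi i}\frac{\prod_{j=1}^r\Gamma(\sigma+\nu_j)}{\prod_{j=1}^q\Gamma(\zeta+\nu_j)}\frac{\Gamma(-\zeta)}{\Gamma(-\sigma)}\frac{x^\zeta y^{-\sigma-1}}{\sigma-\zeta},$$ where $G^{p,0}_{0,p}\!\left(\begin{matrix}-\\ b_1,\ldots,b_p\end{matrix}\Big|z\right)=\frac1{2\pi i}\int_\gamma\prod_{j=1}^p\Gamma(b_j+\eta)z^{-\eta}d\eta$ ($z>0$, $\gamma$ an upward vertical line to the right of all poles). **Extended critical kernel.** For $\tau,t>0$, $x,y\in\mathbb R$, $$K_{\mathfrak C}(\tau,x;t,y)=-\frac{1_{t>\tau}}{\sqrt{2\pi(t-\tau)}}e^{-\frac{(x-y)^2}{2(t-\tau)}}+\int_{S_\sigma}\frac{d\sigma}{2\pi i}\int_{S_\zeta}\frac{d\zeta}{2\pi i}\frac{e^{t\sigma^2/2}\,\Gamma(-\zeta)}{e^{\tau\zeta^2/2}\,\Gamma(-\sigma)}\frac{e^{-x\zeta+y\sigma}}{\sigma-\zeta}.$$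 **Contours.** $S_\zeta$ comes from $+\infty+i\delta$ horizontally to $-c'+i\delta$, goes down to $-c'-i\delta$, then horizontally to $+\infty-i\delta$, encircling $0,1,2,\ldots$ counterclockwise. $S_\sigma$ is the upward vertical line $\operatorname{Re}\sigma=-c$. $S'_\sigma$ comes from $-\infty-i\delta$ horizontally to $-c-i\delta$, goes up to $-c+i\delta$, and returns horizontally to $-\infty+i\delta$, encircling $-1,-2,\ldots$ counterclockwise. Here $\delta>0$ and $0<c'<c<1$, so that neither $\sigma$-contour intersects $S_\zeta$. *)

theory Defs
  imports "HOL-Complex_Analysis.Complex_Analysis"
begin

text \<open>
  Integrals along the unbounded contours. The rays and lines are integrated in the Lebesgue sense
  and the bounded segments with the library's contour integral. The contours depend on the
  parameters \<open>\<delta>\<close>, \<open>c'\<close> and \<open>c\<close>, which are kept as arguments throughout; they are meant to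
  satisfy \<open>\<delta> > 0\<close> and \<open>0 < c' < c < 1\<close>.
\<close>

text \<open>The line \<open>Re z = a\<close>, oriented upwards.\<close>

definition vline_integral :: "real \<Rightarrow> (complex \<Rightarrow> complex) \<Rightarrow> complex" where
  "vline_integral a f = \<i> * (LINT s|lborel. f (Complex a s))"

text \<open>
  From \<open>+\<infinity> + i\<delta>\<close> to \<open>-c' + i\<delta>\<close>, down to \<open>-c' - i\<delta>\<close>, and back to \<open>+\<infinity> - i\<delta>\<close>
  (counterclockwise around \<open>0, 1, 2, \<dots>\<close>).
\<close>

definition S_zeta_integral :: "real \<Rightarrow> real \<Rightarrow> (complex \<Rightarrow> complex) \<Rightarrow> complex" where
  "S_zeta_integral \<delta> c' f =
     - (LINT u:{- c'..}|lborel. f (Complex u \<delta>))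
     + contour_integral (linepath (Complex (- c') \<delta>) (Complex (- c') (- \<delta>))) f
     + (LINT u:{- c'..}|lborel. f (Complex u (- \<delta>)))"

text \<open>
  From \<open>-\<infinity> - i\<delta>\<close> to \<open>-c - i\<delta>\<close>, up to \<open>-c + i\<delta>\<close>, and back to \<open>-\<infinity> + i\<delta>\<close>
  (counterclockwise around \<open>-1, -2, \<dots>\<close>).
\<close>

definition S'_sigma_integral :: "real \<Rightarrow> real \<Rightarrow> (complex \<Rightarrow> complex) \<Rightarrow> complex" where
  "S'_sigma_integral \<delta> c f =
     (LINT u:{..- c}|lborel. f (Complex u (- \<delta>)))
     + contour_integral (linepath (Complex (- c) (- \<delta>)) (Complex (- c) \<delta>)) f
     - (LINT u:{..- c}|lborel. f (Complex u \<delta>))"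

definition S_sigma_integral :: "real \<Rightarrow> (complex \<Rightarrow> complex) \<Rightarrow> complex" where
  "S_sigma_integral c f = vline_integral (- c) f"

text \<open>
  The Meijer G-function \<open>G\<^sup>p\<^sup>,\<^sup>0\<^sub>0\<^sub>,\<^sub>p(- | b\<^sub>1, \<dots>, b\<^sub>p | z)\<close> for \<open>z > 0\<close>. The integration line is
  \<open>Re \<eta> = a\<close>; it lies to the right of all poles of the integrand iff \<open>a > -b\<close> for every
  parameter \<open>b\<close>.
\<close>

definition meijer_G_p0 :: "real \<Rightarrow> real list \<Rightarrow> real \<Rightarrow> complex" where
  "meijer_G_p0 a bs z =
     1 / (2 * of_real pi * \<i>) *
     vline_integral a (\<lambda>\<eta>. (\<Prod>b\<leftarrow>bs. Gamma (of_real b + \<eta>)) * of_real z powr (- \<eta>))"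

text \<open>
  The extended hard-edge kernel, with parameters \<open>\<nu> 1, \<nu> 2, \<dots>\<close> (the value \<open>\<nu> 0\<close> is not used)
  and the line \<open>Re \<eta> = a\<close> for the Meijer G-function.
\<close>

definition hard_edge_kernel ::
  "real \<Rightarrow> real \<Rightarrow> real \<Rightarrow> real \<Rightarrow> (nat \<Rightarrow> nat) \<Rightarrow> nat \<Rightarrow> real \<Rightarrow> nat \<Rightarrow> real \<Rightarrow> complex" where
  "hard_edge_kernel \<delta> c' c a \<nu> q x r y =
     - (if r > q
        then 1 / of_real x * meijer_G_p0 a (map (\<lambda>j. real (\<nu> j) - 1) [q+1..<r+1]) (y / x)
        else 0)
     + S'_sigma_integral \<delta> c (\<lambda>\<sigma>. 1 / (2 * of_real pi * \<i>) *
         S_zeta_integral \<delta> c' (\<lambda>\<zeta>. 1 / (2 * of_real pi * \<i>) *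
           ((\<Prod>j=1..r. Gamma (\<sigma> + of_nat (\<nu> j))) / (\<Prod>j=1..q. Gamma (\<zeta> + of_nat (\<nu> j)))
            * (Gamma (- \<zeta>) / Gamma (- \<sigma>))
            * (of_real x powr \<zeta> * of_real y powr (- \<sigma> - 1) / (\<sigma> - \<zeta>)))))"

definition critical_kernel ::
  "real \<Rightarrow> real \<Rightarrow> real \<Rightarrow> real \<Rightarrow> real \<Rightarrow> real \<Rightarrow> real \<Rightarrow> complex" where
  "critical_kernel \<delta> c' c \<tau> x t y =
     - (if t > \<tau>
        then of_real (1 / sqrt (2 * pi * (t - \<tau>)) * exp (- ((x - y)\<^sup>2 / (2 * (t - \<tau>)))))
        else 0)
     + S_sigma_integral c (\<lambda>\<sigma>. 1 / (2 * of_real pi * \<i>) *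
         S_zeta_integral \<delta> c' (\<lambda>\<zeta>. 1 / (2 * of_real pi * \<i>) *
           (exp (of_real t * \<sigma>\<^sup>2 / 2) * Gamma (- \<zeta>)
             / (exp (of_real \<tau> * \<zeta>\<^sup>2 / 2) * Gamma (- \<sigma>))
            * (exp (- of_real x * \<zeta> + of_real y * \<sigma>) / (\<sigma> - \<zeta>)))))"

definition hard_edge_scaling :: "nat \<Rightarrow> real \<Rightarrow> real \<Rightarrow> real" where
  "hard_edge_scaling n t x = exp (of_int \<lfloor>t * real n\<rfloor> * (ln (real n) - 1 / (2 * real n)) - x)"

text \<open>
  The exponent of \<open>\<Gamma>(\<nu>)\<close> is an integer of either sign, hence \<open>powi\<close>. The time indices
  \<open>[\<tau>\<nu>]\<close> and \<open>[t\<nu>]\<close> are nonnegative for \<open>\<tau>, t > 0\<close>, so \<open>nat\<close> does not truncate.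
\<close>

definition rescaled_hard_edge_kernel ::
  "real \<Rightarrow> real \<Rightarrow> real \<Rightarrow> real \<Rightarrow> nat \<Rightarrow> real \<Rightarrow> real \<Rightarrow> real \<Rightarrow> real \<Rightarrow> complex" where
  "rescaled_hard_edge_kernel \<delta> c' c a n \<tau> x t y =
     of_real (hard_edge_scaling n t y / Gamma (real n) powi (\<lfloor>t * real n\<rfloor> - \<lfloor>\<tau> * real n\<rfloor>)) *
     hard_edge_kernel \<delta> c' c a (\<lambda>_. n)
       (nat \<lfloor>\<tau> * real n\<rfloor>) (hard_edge_scaling n \<tau> x)
       (nat \<lfloor>t * real n\<rfloor>) (hard_edge_scaling n t y)"

end

theory Submission
  imports Defs "HOL-Probability.Characteristic_Functions" "HOL-Probability.Sinc_Integral"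
begin

text \<open>
  Put \<open>\<kappa>\<^sub>n = ln n - 1/(2n)\<close> and \<open>F\<^sub>n(z) = \<Gamma>(z + n) / \<Gamma>(n) * exp (- z \<kappa>\<^sub>n)\<close> (the constant
  \<open>normalized_Gamma\<close> below). The scaling of the variables and the prefactor are chosen so that they are
  exactly absorbed into powers of \<open>F\<^sub>n\<close>: with \<open>q = [\<tau>n]\<close> and \<open>r = [tn]\<close>, the integrand of the double integral becomes

  \<open>F\<^sub>n(\<sigma>)\<^sup>r / F\<^sub>n(\<zeta>)\<^sup>q * \<Gamma>(-\<zeta>) / \<Gamma>(-\<sigma>) * exp (- x \<zeta> + y \<sigma>) / (\<sigma> - \<zeta>)\<close>,

  and the Meijer term, once its line is moved to \<open>Re \<eta> = 1\<close>, becomes \<open>1/(2\<pi>)\<close> times the integral of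
  \<open>F\<^sub>n(iv)\<close> to the power \<open>r - q\<close> times \<open>exp (i v (y - x))\<close>. A Taylor expansion of \<open>ln \<Gamma>\<close> at \<open>n\<close> gives
  \<open>ln F\<^sub>n(z) = z\<^sup>2/(2n) + o(1/n)\<close>; the subtraction of \<open>1/(2n)\<close> in \<open>\<kappa>\<^sub>n\<close> is what removes the linear term. Hence
  \<open>F\<^sub>n(\<sigma>)\<^sup>r\<close> tends to \<open>exp (t \<sigma>\<^sup>2/2)\<close> and \<open>F\<^sub>n(\<zeta>)\<^sup>q\<close> to \<open>exp (\<tau> \<zeta>\<^sup>2/2)\<close>
  (\<open>tendsto_normalized_Gamma_power\<close>), which are the factors of the critical kernel. For \<open>t > \<tau>\<close> the Meijer
  term tends to the Fourier transform of a Gaussian; for \<open>t \<le> \<tau>\<close> one has \<open>r \<le> q\<close>, and neither kernel has this term.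

  Two points need an argument. First, the two kernels use different \<open>\<sigma>\<close>-contours. For \<open>n\<close> large the loop around
  the negative axis can be opened into the line \<open>Re \<sigma> = -c\<close>, because away from the axis the integrand
  decays in both directions (\<open>S'_sigma_integral_eq_S_sigma_integral\<close>, \<open>Gamma_power_quotient_bound\<close>).

  Second, the limit has to be taken under the integral, uniformly in \<open>x\<close> and \<open>y\<close>. On the contours
  \<open>exp (- x \<zeta>)\<close> and \<open>exp (y \<sigma>)\<close> are bounded for bounded nonnegative \<open>x\<close>, \<open>y\<close>, and
  \<open>\<bar>\<sigma> - \<zeta>\<bar> \<ge> c - c'\<close>. Therefore the difference of two such double integrals is controlled
  by \<open>L\<^sup>1\<close> distances of the factors in \<open>\<sigma>\<close> and of the factors in \<open>\<zeta>\<close> separately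
  (\<open>double_contour_integral_diff_le\<close>), and dominated convergence on each contour suffices. The dominating functions
  come from two facts: a power of \<open>F\<^sub>n\<close> decays on vertical lines faster than \<open>1/\<Gamma>(-\<sigma>)\<close> grows
  (\<open>normalized_Gamma_power_decay\<close>), and on the \<open>\<zeta>\<close>-contour the log-convexity of \<open>\<Gamma>\<close> bounds
  \<open>1/F\<^sub>n(\<zeta>)\<^sup>q\<close> by a fixed exponential in \<open>Re \<zeta>\<close>
  (\<open>inverse_normalized_Gamma_power_bound\<close>), which the decay of \<open>\<Gamma>(-\<zeta>)\<close> beats.
\<close>

section \<open>Estimates for the Gamma function\<close>

text \<open>
  Comparisons of \<open>\<bar>\<Gamma>(x + iv)\<bar>\<close> for different \<open>x\<close> and \<open>v\<close> are read off factor by factor from Euler's limit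
  formula, whose modulus is a quotient with all factors explicit.
\<close>

lemma norm_Gamma_series_Complex:
  "norm (Gamma_series (Complex x v) n) =
     fact n * exp (x * ln (real n)) / (\<Prod>k<Suc n. norm (Complex (x + real k) v))"
proof -
  have "pochhammer (Complex x v) (Suc n) = (\<Prod>k<Suc n. Complex (x + real k) v)"
    unfolding pochhammer_prod
    by (intro prod.cong) (auto simp: complex_eq_iff)
  hence "norm (pochhammer (Complex x v) (Suc n)) = (\<Prod>k<Suc n. norm (Complex (x + real k) v))"
    by (simp add: prod_norm)
  thus ?thesis
    by (simp add: Gamma_series_def norm_divide norm_mult norm_fact)
qed

lemma tendsto_norm_Gamma_series:
  "(\<lambda>n. norm (Gamma_series (Complex x v) n)) \<longlonglongrightarrow> norm (Gamma (Complex x v))"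
  by (intro tendsto_norm Gamma_series_LIMSEQ)

lemma norm_Gamma_antimono_Im:
  assumes "x > 0" "\<bar>v\<bar> \<le> \<bar>w\<bar>"
  shows "norm (Gamma (Complex x w)) \<le> norm (Gamma (Complex x v))"
proof (rule LIMSEQ_le[OF tendsto_norm_Gamma_series tendsto_norm_Gamma_series], intro exI allI impI)
  fix n :: nat
  have "v\<^sup>2 \<le> w\<^sup>2" using assms(2) by (simp add: abs_le_square_iff)
  hence le: "(\<Prod>k<Suc n. norm (Complex (x + real k) v)) \<le> (\<Prod>k<Suc n. norm (Complex (x + real k) w))"
    by (intro prod_mono conjI) (auto simp: cmod_def)
  have pos: "0 < (\<Prod>k<Suc n. norm (Complex (x + real k) v))"
    using assms(1) by (intro prod_pos) (auto simp: complex_eq_iff)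
  show "norm (Gamma_series (Complex x w) n) \<le> norm (Gamma_series (Complex x v) n)"
    unfolding norm_Gamma_series_Complex
    by (intro divide_left_mono mult_pos_pos) (use le pos in auto)
qed

lemma Gamma_Complex_0: "Gamma (Complex x 0) = of_real (Gamma x)"
  by (simp add: Gamma_complex_of_real complex_of_real_def[symmetric])

lemma norm_Gamma_le_Gamma_Re:
  assumes "x > 0"
  shows "norm (Gamma (Complex x v)) \<le> Gamma x"
  using norm_Gamma_antimono_Im[OF assms, of 0 v] assms by (simp add: Gamma_Complex_0)

text \<open>
  The quotient \<open>\<Gamma>(x) / \<bar>\<Gamma>(x + iv)\<bar>\<close> decreases in \<open>x\<close>, since each factor \<open>\<bar>x + k + iv\<bar> / (x + k)\<close> does. This
  carries lower bounds for \<open>\<bar>\<Gamma>\<bar>\<close> from one vertical line to all lines on its right.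
\<close>

lemma Gamma_quotient_antimono:
  assumes "0 < x" "x \<le> y"
  shows "Gamma y * norm (Gamma (Complex x v)) \<le> Gamma x * norm (Gamma (Complex y v))"
proof -
  let ?G = "\<lambda>x v n. norm (Gamma_series (Complex x v) n)"
  let ?P = "\<lambda>x v n. \<Prod>k<Suc n. norm (Complex (x + real k) v)"
  have "?G y 0 n * ?G x v n \<le> ?G x 0 n * ?G y v n" for n
  proof -
    have fac: "norm (Complex (x + real k) 0) * norm (Complex (y + real k) v)
            \<le> norm (Complex (y + real k) 0) * norm (Complex (x + real k) v)" for k
    proof -
      have "(x + real k)\<^sup>2 \<le> (y + real k)\<^sup>2"
        using assms by (intro power_mono) auto
      hence "(x + real k)\<^sup>2 * ((y + real k)\<^sup>2 + v\<^sup>2) \<le> (y + real k)\<^sup>2 * ((x + real k)\<^sup>2 + v\<^sup>2)"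
        by (simp add: ring_distribs mult.commute mult_left_mono)
      thus ?thesis
        unfolding cmod_def real_sqrt_mult[symmetric] by simp
    qed
    have le: "?P x 0 n * ?P y v n \<le> ?P y 0 n * ?P x v n"
      unfolding prod.distrib[symmetric] by (intro prod_mono conjI fac) auto
    have pos: "0 < ?P u w n" if "u > 0" for u w
      using that by (intro prod_pos) (auto simp: complex_eq_iff)
    have "?G y 0 n * ?G x v n = fact n ^ 2 * exp ((x + y) * ln (real n)) / (?P y 0 n * ?P x v n)"
      unfolding norm_Gamma_series_Complex
      by (simp add: power2_eq_square ring_distribs exp_add del: prod.lessThan_Suc)
    also have "\<dots> \<le> fact n ^ 2 * exp ((x + y) * ln (real n)) / (?P x 0 n * ?P y v n)"
      using assms by (intro divide_left_mono le mult_pos_pos pos) auto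
    also have "\<dots> = ?G x 0 n * ?G y v n"
      unfolding norm_Gamma_series_Complex
      by (simp add: power2_eq_square ring_distribs exp_add del: prod.lessThan_Suc)
    finally show ?thesis .
  qed
  hence "norm (Gamma (Complex y 0)) * norm (Gamma (Complex x v))
       \<le> norm (Gamma (Complex x 0)) * norm (Gamma (Complex y v))"
    by (intro LIMSEQ_le[OF tendsto_mult[OF tendsto_norm_Gamma_series tendsto_norm_Gamma_series]
          tendsto_mult[OF tendsto_norm_Gamma_series tendsto_norm_Gamma_series]]) blast
  thus ?thesis using assms by (simp add: Gamma_Complex_0)
qed

text \<open>
  Pulling \<open>m\<close> factors out of \<open>\<Gamma>\<close> by the functional equation gives
  \<open>\<bar>\<Gamma>(x + iv)\<bar> / \<Gamma>(x) \<le> \<Prod>k<m. (x + k) / \<bar>x + k + iv\<bar>\<close>. With \<open>m\<close> about \<open>x + \<bar>v\<bar>\<close> this single bound is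
  Gaussian for \<open>\<bar>v\<bar> \<le> x\<close> and exponential for \<open>\<bar>v\<bar> \<ge> x\<close>, with constants good enough to survive
  powers that grow with \<open>x\<close>.
\<close>

lemma norm_Gamma_vertical_decay:
  assumes x: "x > 0"
  shows "norm (Gamma (Complex x v)) \<le> Gamma x * exp (- (v\<^sup>2 / (8 * (2 * x + 2 + \<bar>v\<bar>))))"
proof -
  define D where "D = 2 * x + 2 + \<bar>v\<bar>"
  define m where "m = nat \<lceil>x + \<bar>v\<bar> + 1\<rceil>"
  have m: "x + \<bar>v\<bar> + 1 \<le> real m" "real m \<le> x + \<bar>v\<bar> + 2"
    using x unfolding m_def by linarith+
  have D: "D > 0" "D / 2 \<le> real m" "x + real m \<le> D"
    using x m unfolding D_def by auto
  let ?z = "Complex x v"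
  have z: "?z \<notin> \<int>\<^sub>\<le>\<^sub>0"
    using x by (auto elim!: nonpos_Ints_cases simp: complex_eq_iff)
  have x': "x \<notin> \<int>\<^sub>\<le>\<^sub>0" using x by (auto elim!: nonpos_Ints_cases)
  have zm: "?z + of_nat m = Complex (x + real m) v" by (simp add: complex_eq_iff)
  have P: "pochhammer ?z m * Gamma ?z = Gamma (Complex (x + real m) v)"
    using pochhammer_Gamma[OF z, of m] Gamma_nonzero[OF z] zm by simp
  have Px: "pochhammer x m * Gamma x = Gamma (x + real m)"
    using pochhammer_Gamma[OF x', of m] Gamma_nonzero[OF x'] by simp
  have nP: "norm (pochhammer ?z m) = (\<Prod>k<m. norm (Complex (x + real k) v))"
  proof -
    have "pochhammer ?z m = (\<Prod>k<m. Complex (x + real k) v)"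
      unfolding pochhammer_prod by (intro prod.cong) (auto simp: complex_eq_iff)
    thus ?thesis by (simp add: prod_norm)
  qed
  have Pxe: "pochhammer x m = (\<Prod>k<m. x + real k)"
    unfolding pochhammer_prod by (intro prod.cong) auto
  define e where "e = exp (- (v\<^sup>2 / (4 * D\<^sup>2)))"
  have fac: "x + real k \<le> norm (Complex (x + real k) v) * e" if "k < m" for k
  proof -
    define b where "b = x + real k"
    have b: "b > 0" "b \<le> D" using that D(3) x by (auto simp: b_def)
    have vD: "v\<^sup>2 \<le> D\<^sup>2"
      using x unfolding D_def by (subst abs_le_square_iff[symmetric]) auto
    have bD: "b\<^sup>2 \<le> D\<^sup>2" using b by (intro power_mono) auto
    \<comment> \<open>\<open>exp (-w) \<ge> 1 - w\<close> turns the bound for one factor into \<open>b\<^sup>2 + v\<^sup>2 \<le> 2 D\<^sup>2\<close>.\<close>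
    have "b\<^sup>2 \<le> (b\<^sup>2 + v\<^sup>2) * (1 + - (v\<^sup>2 / (2 * D\<^sup>2)))"
    proof -
      have "(b\<^sup>2 + v\<^sup>2) * v\<^sup>2 \<le> (2 * D\<^sup>2) * v\<^sup>2"
        using vD bD by (intro mult_right_mono) auto
      thus ?thesis using D(1) by (simp add: field_simps)
    qed
    also have "\<dots> \<le> (b\<^sup>2 + v\<^sup>2) * exp (- (v\<^sup>2 / (2 * D\<^sup>2)))"
      by (intro mult_left_mono exp_ge_add_one_self) auto
    also have "exp (- (v\<^sup>2 / (2 * D\<^sup>2))) = e\<^sup>2"
      by (simp add: e_def power2_eq_square flip: exp_add)
    also have "(b\<^sup>2 + v\<^sup>2) * e\<^sup>2 = (norm (Complex b v) * e)\<^sup>2"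
      by (simp add: power_mult_distrib cmod_power2)
    finally have "b \<le> norm (Complex b v) * e"
      by (rule power2_le_imp_le) (auto simp: e_def)
    thus ?thesis by (simp add: b_def)
  qed
  have "pochhammer x m \<le> (\<Prod>k<m. norm (Complex (x + real k) v) * e)"
    unfolding Pxe using x by (intro prod_mono conjI fac) auto
  also have "\<dots> = norm (pochhammer ?z m) * e ^ m"
    by (simp add: prod.distrib nP)
  finally have le: "pochhammer x m \<le> norm (pochhammer ?z m) * e ^ m" .
  have "norm (pochhammer ?z m) * norm (Gamma ?z) \<le> Gamma (x + real m)"
    unfolding norm_mult[symmetric] P using x by (intro norm_Gamma_le_Gamma_Re) auto
  also have "\<dots> = pochhammer x m * Gamma x" by (simp add: Px)
  also have "\<dots> \<le> norm (pochhammer ?z m) * e ^ m * Gamma x"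
    using x by (intro mult_right_mono le) auto
  finally have "norm (pochhammer ?z m) * norm (Gamma ?z) \<le> norm (pochhammer ?z m) * (e ^ m * Gamma x)"
    by (simp add: mult_ac)
  moreover have "norm (pochhammer ?z m) > 0"
    using z by (auto simp: pochhammer_eq_0_iff dest: pochhammer_eq_0_imp_nonpos_Int)
  ultimately have "norm (Gamma ?z) \<le> e ^ m * Gamma x"
    by simp
  also have "e ^ m = exp (- (real m * (v\<^sup>2 / (4 * D\<^sup>2))))"
    by (simp add: e_def flip: exp_of_nat_mult)
  also have "\<dots> \<le> exp (- (v\<^sup>2 / (8 * D)))"
  proof -
    have "v\<^sup>2 / (8 * D) = D / 2 * (v\<^sup>2 / (4 * D\<^sup>2))"
      using D(1) by (simp add: power2_eq_square)
    also have "\<dots> \<le> real m * (v\<^sup>2 / (4 * D\<^sup>2))"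
      using D by (intro mult_right_mono) auto
    finally show ?thesis by simp
  qed
  finally show ?thesis using x by (simp add: D_def mult_ac)
qed

lemma square_over_shifted_ge:
  fixes D v :: real
  assumes "D > 0"
  shows "\<bar>v\<bar> - D \<le> v\<^sup>2 / (D + \<bar>v\<bar>)"
proof -
  have "(\<bar>v\<bar> - D) * (D + \<bar>v\<bar>) \<le> v\<^sup>2"
    by (simp add: algebra_simps power2_eq_square)
  thus ?thesis using assms by (simp add: pos_le_divide_eq)
qed

lemma norm_Gamma_vertical_decay':
  assumes x: "x > 0"
  shows "norm (Gamma (Complex x v)) \<le> Gamma x * exp ((2 * x + 2) / 8) * exp (- \<bar>v\<bar> / 8)"
proof -
  have "\<bar>v\<bar> - (2 * x + 2) \<le> v\<^sup>2 / (2 * x + 2 + \<bar>v\<bar>)"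
    using x by (intro square_over_shifted_ge) auto
  moreover have "v\<^sup>2 / (8 * (2 * x + 2 + \<bar>v\<bar>)) = v\<^sup>2 / (2 * x + 2 + \<bar>v\<bar>) / 8"
    by simp
  moreover have "- (w / 8) \<le> (2 * x + 2) / 8 + - \<bar>v\<bar> / 8" if "\<bar>v\<bar> - (2 * x + 2) \<le> w" for w
    using that by (simp add: field_simps)
  ultimately have "- (v\<^sup>2 / (8 * (2 * x + 2 + \<bar>v\<bar>))) \<le> (2 * x + 2) / 8 + - \<bar>v\<bar> / 8"
    by metis
  hence "Gamma x * exp (- (v\<^sup>2 / (8 * (2 * x + 2 + \<bar>v\<bar>)))) \<le> Gamma x * exp ((2 * x + 2) / 8 + - \<bar>v\<bar> / 8)"
    using x by (intro mult_left_mono) auto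
  with norm_Gamma_vertical_decay[OF x, of v] show ?thesis
    by (simp only: exp_add mult_ac)
qed

lemma norm_sin_le_exp: "norm (sin z) \<le> exp \<bar>Im z\<bar>"
proof -
  have "norm (exp (\<i> * z)) \<le> exp \<bar>Im z\<bar>" "norm (exp (- (\<i> * z))) \<le> exp \<bar>Im z\<bar>"
    by auto
  hence "norm (exp (\<i> * z) - exp (- (\<i> * z))) \<le> 2 * exp \<bar>Im z\<bar>"
    using norm_triangle_ineq4[of "exp (\<i> * z)" "exp (- (\<i> * z))"] by linarith
  thus ?thesis by (simp add: sin_exp_eq norm_divide norm_mult)
qed

lemma norm_sin_ge_sinh: "sinh \<bar>Im z\<bar> \<le> norm (sin z)"
proof -
  have "sinh (Im z) ^ 2 \<le> norm (sin z) ^ 2"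
  proof -
    have "exp (2 * Im z) = exp (Im z) ^ 2" by (rule exp_double)
    moreover have "sinh (Im z) ^ 2 = (exp (Im z) ^ 2 + inverse (exp (Im z) ^ 2) - 2) / 4"
      by (simp add: sinh_def power2_eq_square exp_minus field_simps)
    ultimately show ?thesis
      unfolding norm_sin_squared using cos_le_one[of "2 * Re z"] by simp
  qed
  hence "\<bar>sinh (Im z)\<bar> \<le> norm (sin z)"
    by (metis abs_le_square_iff abs_norm_cancel)
  thus ?thesis by (metis sinh_real_abs)
qed

text \<open>
  Reflection trades \<open>1/\<Gamma>(z)\<close> for \<open>sin (\<pi>z) \<Gamma>(1 - z)\<close>, and \<open>\<bar>\<Gamma>(1 - z)\<bar> \<le> \<Gamma>(1 - c)\<close> on the line.
\<close>

lemma inverse_Gamma_vertical_bound: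
  assumes "0 < c" "c < 1"
  shows "1 / norm (Gamma (Complex c v)) \<le> Gamma (1 - c) / pi * exp (pi * \<bar>v\<bar>)"
proof -
  let ?z = "Complex c v"
  have z: "?z \<notin> \<int>\<^sub>\<le>\<^sub>0"
    using assms by (auto elim!: nonpos_Ints_cases simp: complex_eq_iff)
  have z2: "1 - ?z \<notin> \<int>\<^sub>\<le>\<^sub>0"
    using assms by (auto elim!: nonpos_Ints_cases simp: complex_eq_iff)
  have "Gamma ?z * Gamma (1 - ?z) \<noteq> 0"
    using Gamma_nonzero[OF z] Gamma_nonzero[OF z2] by simp
  moreover have eq: "Gamma ?z * Gamma (1 - ?z) = of_real pi / sin (of_real pi * ?z)"
    by (rule Gamma_reflection_complex)
  ultimately have s: "sin (of_real pi * ?z) \<noteq> 0" by auto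
  have "1 / Gamma ?z = sin (of_real pi * ?z) * Gamma (1 - ?z) / of_real pi"
    using eq s Gamma_nonzero[OF z] by (simp add: field_simps)
  hence "1 / norm (Gamma ?z) = norm (sin (of_real pi * ?z)) * norm (Gamma (1 - ?z)) / pi"
    by (metis norm_divide norm_mult norm_of_real norm_one abs_of_pos pi_gt_zero)
  also have "\<dots> \<le> exp (pi * \<bar>v\<bar>) * Gamma (1 - c) / pi"
  proof (intro divide_right_mono mult_mono)
    show "norm (sin (of_real pi * ?z)) \<le> exp (pi * \<bar>v\<bar>)"
      using norm_sin_le_exp[of "of_real pi * ?z"] by (simp add: abs_mult)
    have "1 - ?z = Complex (1 - c) (- v)" by (simp add: complex_eq_iff)
    thus "norm (Gamma (1 - ?z)) \<le> Gamma (1 - c)"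
      using norm_Gamma_le_Gamma_Re[of "1 - c" "-v"] assms by simp
  qed auto
  finally show ?thesis by (simp add: mult_ac)
qed

lemma ln_Gamma_above_tangent:
  fixes x y :: real
  assumes "x > 0" "y > 0"
  shows "ln (Gamma x) + Digamma x * (y - x) \<le> ln (Gamma y)"
proof -
  have D: "((ln \<circ> Gamma) has_real_derivative Digamma x) (at x within {0<..})"
  proof -
    have "Gamma x > 0" using assms by simp
    hence nz: "Gamma x \<noteq> 0" by simp
    have "((\<lambda>x. ln (Gamma x)) has_real_derivative Digamma x) (at x within {0<..})"
    proof -
      have "Gamma x > 0" using assms by simp
      thus ?thesis using assms nz
        by (auto intro!: derivative_eq_intros elim!: nonpos_Ints_cases simp del: Gamma_eq_zero_iff)
    qed
    thus ?thesis by (simp add: o_def)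
  qed
  have "(ln \<circ> Gamma) y - (ln \<circ> Gamma) x \<ge> Digamma x * (y - x)"
    by (rule convex_on_imp_above_tangent[OF log_convex_Gamma_real])
       (use assms D in \<open>auto simp: interior_open\<close>)
  thus ?thesis by simp
qed

lemma Gamma_above_tangent:
  fixes x y :: real
  assumes "x > 0" "y > 0"
  shows "Gamma x * exp (Digamma x * (y - x)) \<le> Gamma y"
proof -
  have "exp (ln (Gamma x) + Digamma x * (y - x)) \<le> exp (ln (Gamma y))"
    using ln_Gamma_above_tangent[OF assms] by simp
  thus ?thesis using assms by (simp add: exp_add)
qed

text \<open>
  \<open>\<psi>(n)\<close> is a harmonic number minus Euler's constant, so these are the classical bounds for that constant. The
  upper bound is exactly the exponent of the critical scaling.
\<close>

lemma Digamma_of_nat_bounds: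
  assumes "n \<ge> 2"
  shows "ln (real n) - 1 / (2 * (real n - 1)) \<le> Digamma (real n)"
    and "Digamma (real n) \<le> ln (real n) - 1 / (2 * real n)"
proof -
  obtain m where n: "n = m + 2" using assms by (metis add.commute le_Suc_ex)
  have D: "Digamma (real n) = harm (Suc m) - euler_mascheroni"
    using Digamma_of_nat[of "Suc m", where ?'a = real] by (simp add: n add_ac)
  show "ln (real n) - 1 / (2 * (real n - 1)) \<le> Digamma (real n)"
    using euler_mascheroni_upper[of m] unfolding D by (simp add: n algebra_simps)
  show "Digamma (real n) \<le> ln (real n) - 1 / (2 * real n)"
    using euler_mascheroni_lower[of m] unfolding D by (simp add: n algebra_simps)
qed

text \<open>
  The tangent to \<open>ln \<Gamma>\<close> at an integer \<open>n\<close> has slope at least \<open>ln K\<close> as soon as \<open>n\<close> is large compared with \<open>K\<close>.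
\<close>

lemma powr_le_Gamma:
  fixes K :: real
  assumes "K > 0"
  obtains C where "C > 0" "\<And>u. u > 0 \<Longrightarrow> K powr u \<le> C * Gamma u"
proof -
  obtain n :: nat where n: "K + exp 1 * K + 2 \<le> real n"
    using real_arch_simple by blast
  have "exp 1 * K > 0" using assms by simp
  hence "real n \<ge> 2" using n assms by linarith
  hence n2: "n \<ge> 2" by simp
  have "ln K + 1 = ln (exp 1 * K)" using assms by (simp add: ln_mult)
  also have "\<dots> \<le> ln (real n)"
    using n assms \<open>exp 1 * K > 0\<close> \<open>real n \<ge> 2\<close> by (subst ln_le_cancel_iff) linarith+
  finally have "ln K + 1 \<le> ln (real n)" .
  moreover have "1 / (2 * (real n - 1)) \<le> 1" using n2 by (simp add: field_simps)
  ultimately have dig: "ln K \<le> Digamma (real n)"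
    using Digamma_of_nat_bounds(1)[OF n2] by linarith

  define C where "C = exp (real n * Digamma (real n)) / Gamma (real n)"
  show ?thesis
  proof
    show "C > 0" using n2 by (auto simp: C_def)
    fix u :: real assume u: "u > 0"
    have "K powr u = exp (u * ln K)" using assms by (simp add: powr_def)
    also have "\<dots> \<le> exp (u * Digamma (real n))" using u dig by simp
    also have "\<dots> = C * (Gamma (real n) * exp (Digamma (real n) * (u - real n)))"
    proof -
      have "Gamma (real n) > 0" using n2 by (intro Gamma_real_pos) simp
      hence "Gamma (real n) \<noteq> 0" by linarith
      hence "C * (Gamma (real n) * exp (Digamma (real n) * (u - real n))) =
             exp (real n * Digamma (real n)) * exp (Digamma (real n) * (u - real n))"
        by (simp add: C_def)
      also have "\<dots> = exp (u * Digamma (real n))"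
        unfolding exp_add[symmetric] by (rule arg_cong[of _ _ exp]) algebra
      finally show ?thesis ..
    qed
    also have "\<dots> \<le> C * Gamma u"
      using n2 u \<open>C > 0\<close> by (intro mult_left_mono Gamma_above_tangent) auto
    finally show "K powr u \<le> C * Gamma u" .
  qed
qed

section \<open>Asymptotics of the normalized Gamma function\<close>

lemma sums_inverse_square_bounds:
  fixes x S :: real
  assumes x: "x > 1" and S: "(\<lambda>k. inverse ((x + real k)\<^sup>2)) sums S"
  shows "1 / x \<le> S" and "S \<le> 1 / (x - 1)"
proof -
  have tel: "(\<lambda>k. inverse (y + real k) - inverse (y + real (Suc k))) sums (inverse (y + real 0) - 0)"
    for y :: real
    by (intro telescope_sums') real_asymp
  have "inverse (x + real k) - inverse (x + real (Suc k)) \<le> inverse ((x + real k)\<^sup>2)" for k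
  proof -
    define y where "y = x + real k"
    have "y > 1" using x by (simp add: y_def)
    moreover from this have "y + y * y > 0" by (intro add_pos_pos mult_pos_pos) auto
    ultimately have "inverse y - inverse (y + 1) \<le> inverse (y\<^sup>2)"
      by (simp add: divide_simps power2_eq_square algebra_simps)
    thus ?thesis by (simp add: y_def add_ac)
  qed
  from sums_le[OF this tel S] show "1 / x \<le> S" by (simp add: inverse_eq_divide)
  have "inverse ((x + real k)\<^sup>2) \<le> inverse (x - 1 + real k) - inverse (x - 1 + real (Suc k))" for k
  proof -
    define y where "y = x + real k"
    have "y > 1" using x by (simp add: y_def)
    hence "inverse (y\<^sup>2) \<le> inverse (y - 1) - inverse y"
      by (simp add: divide_simps power2_eq_square algebra_simps)
    thus ?thesis by (simp add: y_def algebra_simps)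
  qed
  from sums_le[OF this S tel] show "S \<le> 1 / (x - 1)" by (simp add: inverse_eq_divide)
qed

lemma trigamma_bounds:
  fixes x :: real
  assumes "x > 1"
  shows "1 / x \<le> Polygamma 1 x" "Polygamma 1 x \<le> 1 / (x - 1)"
proof -
  have "(\<lambda>k. inverse ((x + real k)\<^sup>2)) sums Polygamma 1 x"
    using Polygamma_LIMSEQ[of x 1] assms by (simp add: numeral_2_eq_2)
  from sums_inverse_square_bounds[OF assms this]
  show "1 / x \<le> Polygamma 1 x" "Polygamma 1 x \<le> 1 / (x - 1)" .
qed

lemma norm_tetragamma_le:
  fixes z :: complex
  assumes N: "N > 1" and z: "Re z \<ge> N"
  shows "norm (Polygamma 2 z) \<le> 2 / (N * (N - 1))"
proof -
  have z0: "z \<noteq> 0" using N z by auto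
  have s: "(\<lambda>k. inverse ((z + of_nat k) ^ 3)) sums (- Polygamma 2 z / 2)"
    using Polygamma_LIMSEQ[OF z0, of 2] by (simp add: eval_nat_numeral)
  have s2: "summable (\<lambda>k. inverse ((N + real k)\<^sup>2))"
    using N by (intro Polygamma_converges') auto
  define S where "S = (\<Sum>k. inverse ((N + real k)\<^sup>2))"
  have S: "(\<lambda>k. inverse ((N + real k)\<^sup>2)) sums S"
    using s2 by (simp add: S_def summable_sums)
  have le: "norm (inverse ((z + of_nat k) ^ 3)) \<le> inverse N * inverse ((N + real k)\<^sup>2)" for k
  proof -
    have "N + real k \<le> Re (z + of_nat k)" using z by simp
    also have "\<dots> \<le> norm (z + of_nat k)" by (rule complex_Re_le_cmod)
    finally have k: "N + real k \<le> norm (z + of_nat k)" .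
    have "N * (N + real k)\<^sup>2 \<le> norm (z + of_nat k) * norm (z + of_nat k) ^ 2"
      using N k by (intro mult_mono power_mono) auto
    also have "\<dots> = norm ((z + of_nat k) ^ 3)"
      by (simp add: norm_power power3_eq_cube power2_eq_square norm_mult)
    finally have "inverse (norm ((z + of_nat k) ^ 3)) \<le> inverse (N * (N + real k)\<^sup>2)"
      using N by (intro le_imp_inverse_le) auto
    thus ?thesis by (simp add: norm_inverse)
  qed
  have sum: "summable (\<lambda>k. inverse N * inverse ((N + real k)\<^sup>2))"
    using s2 by (rule summable_mult)
  have "norm (- Polygamma 2 z / 2) \<le> (\<Sum>k. inverse N * inverse ((N + real k)\<^sup>2))"
    using norm_suminf_le[OF le sum] s by (simp add: sums_iff)
  also have "\<dots> = inverse N * S" using s2 by (simp add: S_def suminf_mult)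
  also have "\<dots> \<le> inverse N * (1 / (N - 1))"
    using sums_inverse_square_bounds(2)[OF N S] N by (intro mult_left_mono) auto
  finally show ?thesis using N by (simp add: field_simps norm_divide)
qed

definition critical_exponent :: "nat \<Rightarrow> real" where
  "critical_exponent n = ln (real n) - 1 / (2 * real n)"

definition normalized_Gamma :: "nat \<Rightarrow> complex \<Rightarrow> complex" where
  "normalized_Gamma n z =
     Gamma (z + of_nat n) / of_real (Gamma (real n)) * exp (- z * of_real (critical_exponent n))"

text \<open>
  Second-order Taylor expansion of \<open>ln \<Gamma>\<close> at \<open>n\<close>. The linear coefficient \<open>\<psi>(n) - \<kappa>\<^sub>n\<close> is \<open>o(1/n)\<close>,
  the quadratic one is \<open>\<psi>'(n) \<sim> 1/n\<close>, and the remainder is governed by \<open>\<psi>''\<close>, which is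
  \<open>O(1/n\<^sup>2)\<close> on the half-plane \<open>Re w \<ge> n - \<bar>z\<bar>\<close>.
\<close>

lemma tendsto_ln_normalized_Gamma:
  fixes z :: complex
  shows "(\<lambda>n. of_nat n * (ln_Gamma (z + of_nat n) - ln_Gamma (of_nat n)
            - z * of_real (critical_exponent n))) \<longlonglongrightarrow> z\<^sup>2 / 2"
proof -
  define D where "D = (\<lambda>n. real n * (Digamma (real n) - critical_exponent n))"
  define T where "T = (\<lambda>n. real n * Polygamma 1 (real n))"
  define R where "R = (\<lambda>n. ln_Gamma (z + of_nat n) - ln_Gamma (of_nat n)
         - of_real (Digamma (real n)) * z - of_real (Polygamma 1 (real n)) * z\<^sup>2 / 2)"
  have D: "D \<longlonglongrightarrow> 0"
  proof (rule tendsto_sandwich[OF _ _ _ tendsto_const])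
    show "\<forall>\<^sub>F n in sequentially. real n * (1 / (2 * real n) - 1 / (2 * (real n - 1))) \<le> D n"
      using eventually_ge_at_top[of 2]
    proof eventually_elim
      case (elim n)
      thus ?case unfolding D_def critical_exponent_def
        using Digamma_of_nat_bounds(1)[OF elim] by (intro mult_left_mono) auto
    qed
    show "\<forall>\<^sub>F n in sequentially. D n \<le> 0"
      using eventually_ge_at_top[of 2]
    proof eventually_elim
      case (elim n)
      thus ?case unfolding D_def critical_exponent_def
        using Digamma_of_nat_bounds(2)[OF elim] by (intro mult_nonneg_nonpos) auto
    qed
    show "(\<lambda>n. real n * (1 / (2 * real n) - 1 / (2 * (real n - 1)))) \<longlonglongrightarrow> 0"
      by real_asymp
  qed
  have T: "T \<longlonglongrightarrow> 1"
  proof (rule tendsto_sandwich[OF _ _ tendsto_const])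
    show "\<forall>\<^sub>F n in sequentially. 1 \<le> T n"
      using eventually_ge_at_top[of 2]
    proof eventually_elim
      case (elim n)
      thus ?case unfolding T_def
        using trigamma_bounds(1)[of "real n"] by (simp add: field_simps)
    qed
    show "\<forall>\<^sub>F n in sequentially. T n \<le> real n / (real n - 1)"
      using eventually_ge_at_top[of 2]
    proof eventually_elim
      case (elim n)
      thus ?case unfolding T_def
        using mult_left_mono[OF trigamma_bounds(2)[of "real n"], of "real n"] by simp
    qed
    show "(\<lambda>n. real n / (real n - 1)) \<longlonglongrightarrow> 1" by real_asymp
  qed
  define a where "a = norm z"
  have R: "(\<lambda>n. of_nat n * R n) \<longlonglongrightarrow> 0"
  proof (rule Lim_null_comparison)
    show "\<forall>\<^sub>F n in sequentially. norm (of_nat n * R n) \<le>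
        real n * (2 / ((real n - a) * (real n - a - 1)) * a ^ 3 / 2)"
      using eventually_gt_at_top[of "nat \<lceil>a + 1\<rceil>"]
    proof eventually_elim
      case (elim n)
      have n: "real n > a + 1" using elim by linarith
      have a0: "a \<ge> 0" by (simp add: a_def)
      define f where "f = (\<lambda>i. if i = 0 then ln_Gamma else Polygamma (i - 1) :: complex \<Rightarrow> complex)"
      define H where "H = {w. real n - a \<le> Re w}"
      have "norm (f 0 (z + of_nat n) - (\<Sum>i\<le>2. f i (of_nat n) * (z + of_nat n - of_nat n) ^ i / fact i))
         \<le> 2 / ((real n - a) * (real n - a - 1)) * norm (z + of_nat n - of_nat n) ^ Suc 2 / fact 2"
      proof (rule complex_Taylor)
        show "convex H" unfolding H_def by (rule convex_halfspace_Re_ge)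
        show "of_nat n \<in> H" using a0 by (simp add: H_def)
        show "z + of_nat n \<in> H"
          using abs_Re_le_cmod[of z] by (simp add: H_def a_def)
        show "norm (f (Suc 2) w) \<le> 2 / ((real n - a) * (real n - a - 1))" if "w \<in> H" for w
          using that n norm_tetragamma_le[of "real n - a" w] by (simp add: f_def H_def)
        show "(f i has_field_derivative f (Suc i) w) (at w within H)" if "w \<in> H" "i \<le> 2" for i w
        proof -
          have w: "Re w > 0" using that n by (simp add: H_def)
          hence nr: "w \<notin> \<real>\<^sub>\<le>\<^sub>0" by (auto simp: complex_nonpos_Reals_iff)
          have ni: "w \<notin> \<int>\<^sub>\<le>\<^sub>0" using w by (auto elim!: nonpos_Ints_cases)
          show ?thesis
          proof (cases i)
            case 0
            thus ?thesis using has_field_derivative_ln_Gamma_complex[OF nr]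
              by (auto simp: f_def intro: has_field_derivative_at_within)
          next
            case (Suc j)
            thus ?thesis using has_field_derivative_Polygamma[OF ni, of j H] by (simp add: f_def)
          qed
        qed
      qed
      also have "f 0 (z + of_nat n) - (\<Sum>i\<le>2. f i (of_nat n) * (z + of_nat n - of_nat n) ^ i / fact i) = R n"
      proof -
        have "Polygamma k (of_nat n :: complex) = of_real (Polygamma k (real n))" for k
          using Polygamma_of_real[of "real n" k, where ?'a = complex] n a0 by simp
        thus ?thesis
          by (simp add: f_def R_def numeral_2_eq_2 algebra_simps)
      qed
      finally have "norm (R n) \<le> 2 / ((real n - a) * (real n - a - 1)) * a ^ 3 / 2"
        by (simp add: a_def numeral_3_eq_3)
      thus ?case unfolding norm_mult norm_of_nat by (intro mult_left_mono) auto
    qed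
    show "(\<lambda>n. real n * (2 / ((real n - a) * (real n - a - 1)) * a ^ 3 / 2)) \<longlonglongrightarrow> 0"
      by real_asymp
  qed
  have "(\<lambda>n. of_nat n * R n + of_real (D n) * z + of_real (T n) * z\<^sup>2 / 2)
          \<longlonglongrightarrow> 0 + of_real 0 * z + of_real 1 * z\<^sup>2 / 2"
    by (intro tendsto_intros R D T) auto
  also have "(\<lambda>n. of_nat n * R n + of_real (D n) * z + of_real (T n) * z\<^sup>2 / 2) =
    (\<lambda>n. of_nat n * (ln_Gamma (z + of_nat n) - ln_Gamma (of_nat n) - z * of_real (critical_exponent n)))"
    by (simp add: R_def D_def T_def algebra_simps)
  finally show ?thesis by simp
qed

lemma tendsto_normalized_Gamma_power:
  fixes z :: complex
  assumes k: "(\<lambda>n. real (k n) / real n) \<longlonglongrightarrow> T"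
  shows "(\<lambda>n. normalized_Gamma n z ^ k n) \<longlonglongrightarrow> exp (of_real T * z\<^sup>2 / 2)"
proof -
  let ?L = "\<lambda>n. ln_Gamma (z + of_nat n) - ln_Gamma (of_nat n) - z * of_real (critical_exponent n)"
  have "(\<lambda>n. exp (of_real (real (k n) / real n) * (of_nat n * ?L n))) \<longlonglongrightarrow> exp (of_real T * (z\<^sup>2 / 2))"
    by (intro tendsto_intros k tendsto_ln_normalized_Gamma)
  moreover have "\<forall>\<^sub>F n in sequentially.
      exp (of_real (real (k n) / real n) * (of_nat n * ?L n)) = normalized_Gamma n z ^ k n"
    using eventually_gt_at_top[of "nat \<lceil>norm z\<rceil>"]
  proof eventually_elim
    case (elim n)
    hence n: "real n > norm z" by linarith
    hence n0: "n > 0" using norm_ge_zero[of z] by (cases n) auto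
    have nz: "z + of_nat n \<notin> \<int>\<^sub>\<le>\<^sub>0" 
      using n abs_Re_le_cmod[of z] by (auto elim!: nonpos_Ints_cases simp: complex_eq_iff)
    have nn: "of_nat n \<notin> (\<int>\<^sub>\<le>\<^sub>0 :: complex set)"
      using n0 by (auto elim!: nonpos_Ints_cases simp: complex_eq_iff)
    have G: "of_real (Gamma (real n)) = exp (ln_Gamma (of_nat n :: complex))"
      using Gamma_complex_altdef[of "of_nat n"] nn Gamma_complex_of_real[of "real n"] by simp
    have "exp (?L n) = normalized_Gamma n z"
      using nz by (simp add: normalized_Gamma_def G Gamma_complex_altdef exp_diff exp_minus exp_add
          field_simps)
    moreover have "of_real (real (k n) / real n) * (of_nat n * ?L n) = of_nat (k n) * ?L n"
      using n0 by simp
    ultimately show ?case by (simp only: exp_of_nat_mult)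
  qed
  ultimately show ?thesis
    by (auto elim: Lim_transform_eventually simp: mult_ac)
qed

lemma norm_normalized_Gamma:
  assumes "n > 0"
  shows "norm (normalized_Gamma n (Complex u v)) =
     norm (Gamma (Complex (u + real n) v)) / Gamma (real n) * exp (- u * critical_exponent n)"
proof -
  have "Gamma (real n) > 0" using assms by simp
  moreover have "Complex u v + of_nat n = Complex (u + real n) v" by (simp add: complex_eq_iff)
  ultimately show ?thesis by (simp add: normalized_Gamma_def norm_mult norm_divide)
qed

lemma eventually_norm_le:
  assumes "(f \<longlongrightarrow> (l :: 'a :: real_normed_vector)) F"
  shows "eventually (\<lambda>x. norm (f x) \<le> norm l + 1) F"
proof -
  have "((\<lambda>x. norm (f x)) \<longlongrightarrow> norm l) F" using assms by (rule tendsto_norm)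
  hence "eventually (\<lambda>x. norm (f x) < norm l + 1) F" by (rule order_tendstoD) simp
  thus ?thesis by eventually_elim simp
qed

text \<open>
  Compare with the value at \<open>v = 0\<close>, whose power converges and so is bounded. The vertical decay contributes
  \<open>exp (- k v\<^sup>2 / (8 (4n + \<bar>v\<bar>)))\<close> with \<open>k \<ge> Tn/2\<close>, and \<open>n / (4n + \<bar>v\<bar>)\<close> increases with \<open>n\<close>: the bound
  for one index \<open>n\<^sub>0\<close> dominates all later ones. The rate \<open>5\<close> exceeds \<open>\<pi> + 1\<close>, which leaves room for
  the growth of \<open>1/\<Gamma>(-\<sigma>)\<close>.
\<close>

lemma normalized_Gamma_power_decay:
  assumes k: "(\<lambda>n. real (k n) / real n) \<longlonglongrightarrow> T" and T: "T > 0"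
  obtains C where "\<forall>\<^sub>F n in sequentially. \<forall>v. norm (normalized_Gamma n (Complex u v) ^ k n) \<le> C * exp (- 5 * \<bar>v\<bar>)"
proof -
  define M where "M = norm (exp (of_real T * (of_real u)\<^sup>2 / 2) :: complex) + 1"
  have ev1: "\<forall>\<^sub>F n in sequentially. norm (normalized_Gamma n (of_real u) ^ k n) \<le> M"
    unfolding M_def by (intro eventually_norm_le tendsto_normalized_Gamma_power k)
  have ev2: "\<forall>\<^sub>F n in sequentially. real (k n) / real n > T / 2"
    using k by (rule order_tendstoD) (use T in auto)
  \<comment> \<open>\<open>80 / T \<le> n\<^sub>0\<close> makes the exponential rate \<open>T n\<^sub>0 / 16\<close> at least \<open>5\<close>.\<close>
  obtain n0 :: nat where n0: "\<bar>u\<bar> + 1 + 80 / T \<le> real n0" using real_arch_simple by blast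
  have n0': "\<bar>u\<bar> + 1 < real n0" "80 / T \<le> real n0"
    using n0 T divide_pos_pos[of 80 T] by linarith+
  hence Tn0: "80 \<le> T * real n0" using T by (simp add: field_simps)
  have "\<forall>\<^sub>F n in sequentially. \<forall>v. norm (normalized_Gamma n (Complex u v) ^ k n)
          \<le> M * exp (20 * real n0) * exp (- 5 * \<bar>v\<bar>)"
    using ev1 ev2 eventually_ge_at_top[of n0]
  proof eventually_elim
    case (elim n)
    have n: "real n \<ge> real n0" "n > 0" "real n > 0" using elim n0' by auto
    show ?case
    proof
      fix v :: real
      have x: "u + real n > 0" using n n0' by linarith
      have "norm (normalized_Gamma n (Complex u v)) \<le>
          norm (normalized_Gamma n (of_real u)) * exp (- (v\<^sup>2 / (8 * (2 * (u + real n) + 2 + \<bar>v\<bar>))))"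
      proof -
        have "norm (Gamma (Complex (u + real n) v)) / Gamma (real n) * exp (- u * critical_exponent n)
           \<le> Gamma (u + real n) * exp (- (v\<^sup>2 / (8 * (2 * (u + real n) + 2 + \<bar>v\<bar>)))) / Gamma (real n)
                * exp (- u * critical_exponent n)"
          using n by (intro mult_right_mono divide_right_mono norm_Gamma_vertical_decay x) auto
        moreover have "norm (normalized_Gamma n (of_real u)) =
            Gamma (u + real n) / Gamma (real n) * exp (- u * critical_exponent n)"
        proof -
          have "norm (Gamma (Complex (u + real n) 0)) = Gamma (u + real n)"
            unfolding Gamma_Complex_0 using x by simp
          thus ?thesis unfolding complex_of_real_def using norm_normalized_Gamma[OF n(2), of u 0] by simp
        qed
        ultimately show ?thesis
          using n by (simp add: norm_normalized_Gamma mult_ac)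
      qed
      hence "norm (normalized_Gamma n (Complex u v)) ^ k n \<le>
          (norm (normalized_Gamma n (of_real u)) * exp (- (v\<^sup>2 / (8 * (2 * (u + real n) + 2 + \<bar>v\<bar>))))) ^ k n"
        by (intro power_mono) auto
      also have "\<dots> = norm (normalized_Gamma n (of_real u) ^ k n) *
          exp (- (real (k n) * (v\<^sup>2 / (8 * (2 * (u + real n) + 2 + \<bar>v\<bar>)))))"
        by (simp add: power_mult_distrib norm_power flip: exp_of_nat_mult)
      also have "\<dots> \<le> M * exp (20 * real n0 + - 5 * \<bar>v\<bar>)"
      proof (intro mult_mono)
        show "norm (normalized_Gamma n (complex_of_real u) ^ k n) \<le> M" by (rule elim)
        have "5 * (\<bar>v\<bar> - 4 * real n0) \<le> 5 * (v\<^sup>2 / (4 * real n0 + \<bar>v\<bar>))"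
          using n0' by (intro mult_left_mono square_over_shifted_ge) auto
        also have "\<dots> \<le> (T * real n0 / 16) * (v\<^sup>2 / (4 * real n0 + \<bar>v\<bar>))"
          using Tn0 by (intro mult_right_mono) auto
        also have "\<dots> = T / 16 * v\<^sup>2 * (real n0 / (4 * real n0 + \<bar>v\<bar>))" by simp
        also have "\<dots> \<le> T / 16 * v\<^sup>2 * (real n / (4 * real n + \<bar>v\<bar>))"
        proof (intro mult_left_mono)
          have "real n0 * \<bar>v\<bar> \<le> real n * \<bar>v\<bar>" using n by (intro mult_right_mono) auto
          moreover have "4 * real n0 + \<bar>v\<bar> > 0" "4 * real n + \<bar>v\<bar> > 0" using n n0' by linarith+
          ultimately show "real n0 / (4 * real n0 + \<bar>v\<bar>) \<le> real n / (4 * real n + \<bar>v\<bar>)"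
            by (simp add: divide_simps algebra_simps)
        qed (use T in auto)
        also have "\<dots> = (T / 2 * real n) * (v\<^sup>2 / (8 * (4 * real n + \<bar>v\<bar>)))" by simp
        also have "\<dots> \<le> real (k n) * (v\<^sup>2 / (8 * (2 * (u + real n) + 2 + \<bar>v\<bar>)))"
        proof (intro mult_mono divide_left_mono)
          show "T / 2 * real n \<le> real (k n)" using elim(2) n by (simp add: field_simps)
        qed (use n n0' x in auto)
        finally show "exp (- (real (k n) * (v\<^sup>2 / (8 * (2 * (u + real n) + 2 + \<bar>v\<bar>)))))
             \<le> exp (20 * real n0 + - 5 * \<bar>v\<bar>)" by simp
      qed (auto simp: M_def)
      finally show "norm (normalized_Gamma n (Complex u v) ^ k n) \<le> M * exp (20 * real n0) * exp (- 5 * \<bar>v\<bar>)"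
        by (simp only: norm_power exp_add mult.assoc)
    qed
  qed
  thus ?thesis by (rule that)
qed

text \<open>
  Monotonicity in both coordinates moves the comparison of \<open>\<bar>\<Gamma>(n + u + iv)\<bar>\<close> with \<open>\<Gamma>(n + u)\<close> to the corner
  \<open>- c + i\<delta>\<close> of the region, where the powers converge. On the real axis the tangent to
  \<open>ln \<Gamma>\<close> at \<open>n\<close> gives \<open>1/F\<^sub>n(u) \<le> exp (u (\<kappa>\<^sub>n - \<psi>(n)))\<close>, and \<open>k (\<kappa>\<^sub>n - \<psi>(n))\<close> tends to \<open>0\<close>.
\<close>

lemma inverse_normalized_Gamma_power_bound:
  assumes k: "(\<lambda>n. real (k n) / real n) \<longlonglongrightarrow> T" and c: "0 < c" "c < 1"
  obtains C where "\<forall>\<^sub>F n in sequentially. \<forall>u v. - c \<le> u \<and> \<bar>v\<bar> \<le> \<delta> \<longrightarrow>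
     norm (1 / normalized_Gamma n (Complex u v) ^ k n) \<le> C * exp \<bar>u\<bar>"
proof -
  define l where "l = exp (of_real T * (Complex (- c) 0)\<^sup>2 / 2) / exp (of_real T * (Complex (- c) \<delta>)\<^sup>2 / 2)"
  define M where "M = norm l + 1"
  have "(\<lambda>n. normalized_Gamma n (Complex (- c) 0) ^ k n / normalized_Gamma n (Complex (- c) \<delta>) ^ k n) \<longlonglongrightarrow> l"
    unfolding l_def by (intro tendsto_intros tendsto_normalized_Gamma_power k) simp
  from eventually_norm_le[OF this]
  have ev1: "\<forall>\<^sub>F n in sequentially. 
      norm (normalized_Gamma n (Complex (- c) 0) ^ k n / normalized_Gamma n (Complex (- c) \<delta>) ^ k n) \<le> M"
    by (simp add: M_def)
  have "(\<lambda>n. (real (k n) / real n) * (real n * (1 / (2 * (real n - 1)) - 1 / (2 * real n)))) \<longlonglongrightarrow> T * 0"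
    by (intro tendsto_mult k) real_asymp
  hence ev2: "\<forall>\<^sub>F n in sequentially.
      (real (k n) / real n) * (real n * (1 / (2 * (real n - 1)) - 1 / (2 * real n))) < 1"
    by (rule order_tendstoD) simp
  have "\<forall>\<^sub>F n in sequentially. \<forall>u v. - c \<le> u \<and> \<bar>v\<bar> \<le> \<delta> \<longrightarrow>
     norm (1 / normalized_Gamma n (Complex u v) ^ k n) \<le> M * exp \<bar>u\<bar>"
    using ev1 ev2 eventually_ge_at_top[of 2]
  proof eventually_elim
    case (elim n)
    have n: "n \<ge> 2" "n > 0" "real n \<ge> 2" using elim by auto
    have Gn: "Gamma (real n) > 0" using n by simp
    define \<epsilon> where "\<epsilon> = critical_exponent n - Digamma (real n)"
    have eps: "0 \<le> \<epsilon>" "real (k n) * \<epsilon> \<le> 1"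
    proof -
      show "0 \<le> \<epsilon>"
        using Digamma_of_nat_bounds(2)[OF n(1)] by (simp add: \<epsilon>_def critical_exponent_def)
      have "real (k n) * \<epsilon> \<le> real (k n) * (1 / (2 * (real n - 1)) - 1 / (2 * real n))"
        using Digamma_of_nat_bounds(1)[OF n(1)]
        by (intro mult_left_mono) (auto simp: \<epsilon>_def critical_exponent_def)
      also have "\<dots> = (real (k n) / real n) * (real n * (1 / (2 * (real n - 1)) - 1 / (2 * real n)))"
        using n by simp
      also have "\<dots> \<le> 1" using elim(2) by linarith
      finally show "real (k n) * \<epsilon> \<le> 1" .
    qed
    show ?case
    proof (intro allI impI)
      fix u v :: real assume uv: "- c \<le> u \<and> \<bar>v\<bar> \<le> \<delta>"
      let ?N = "\<lambda>u v. norm (Gamma (Complex (u + real n) v))"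
      have pos: "?N u v > 0" if "u \<ge> -c" for u v
      proof -
        have "Complex (u + real n) v \<notin> \<int>\<^sub>\<le>\<^sub>0"
          using that n c by (auto elim!: nonpos_Ints_cases simp: complex_eq_iff)
        thus ?thesis by (simp add: Gamma_eq_zero_iff)
      qed
      have "Gamma (real n) * exp (Digamma (real n) * (u + real n - real n)) \<le> Gamma (u + real n)"
        using n c uv by (intro Gamma_above_tangent) auto
      hence t: "Gamma (real n) * exp (Digamma (real n) * u) \<le> Gamma (u + real n)" by simp
      have "Gamma (u + real n) * ?N (-c) \<delta> \<le> Gamma (u + real n) * ?N (-c) v"
        using n c uv by (intro mult_left_mono norm_Gamma_antimono_Im) auto
      also have "\<dots> \<le> Gamma (-c + real n) * ?N u v"
        using n c uv by (intro Gamma_quotient_antimono) auto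
      finally have "Gamma (u + real n) * ?N (-c) \<delta> \<le> Gamma (-c + real n) * ?N u v" .
      moreover have "Gamma (real n) * exp (Digamma (real n) * u) * ?N (-c) \<delta> \<le> Gamma (u + real n) * ?N (-c) \<delta>"
        by (intro mult_right_mono t) auto
      ultimately have "Gamma (real n) * exp (Digamma (real n) * u) * ?N (-c) \<delta> \<le> Gamma (-c + real n) * ?N u v"
        by linarith
      hence "Gamma (real n) / ?N u v \<le> Gamma (-c + real n) / ?N (-c) \<delta> * exp (- (Digamma (real n) * u))"
        using pos[of u v] pos[of "-c" \<delta>] uv by (simp add: field_simps exp_minus)
      hence "Gamma (real n) / ?N u v * exp (u * critical_exponent n) \<le>
             Gamma (-c + real n) / ?N (-c) \<delta> * exp (- (Digamma (real n) * u)) * exp (u * critical_exponent n)"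
        by (intro mult_right_mono) auto
      also have "\<dots> = Gamma (-c + real n) / ?N (-c) \<delta> * exp (u * \<epsilon>)"
        by (simp add: \<epsilon>_def algebra_simps flip: exp_add)
      also have "Gamma (-c + real n) / ?N (-c) \<delta> = 
          norm (normalized_Gamma n (Complex (- c) 0) / normalized_Gamma n (Complex (- c) \<delta>))"
      proof -
        have "Gamma (- c + real n) > 0" using n c by (intro Gamma_real_pos) auto
        thus ?thesis
          unfolding norm_divide norm_normalized_Gamma[OF n(2)] Gamma_Complex_0
          using Gn by simp
      qed
      also have "Gamma (real n) / ?N u v * exp (u * critical_exponent n) =
           norm (1 / normalized_Gamma n (Complex u v))"
        using Gn by (simp add: norm_divide norm_normalized_Gamma[OF n(2)] exp_minus field_simps)
      finally have "norm (1 / normalized_Gamma n (Complex u v)) ^ k n \<le>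
         (norm (normalized_Gamma n (Complex (- c) 0) / normalized_Gamma n (Complex (- c) \<delta>)) * exp (u * \<epsilon>)) ^ k n"
        by (intro power_mono) auto
      also have "\<dots> = norm (normalized_Gamma n (Complex (- c) 0) ^ k n / normalized_Gamma n (Complex (- c) \<delta>) ^ k n)
           * exp (u * (real (k n) * \<epsilon>))"
        by (simp add: power_mult_distrib norm_divide norm_power power_divide mult_ac flip: exp_of_nat_mult)
      also have "\<dots> \<le> M * exp \<bar>u\<bar>"
      proof (intro mult_mono elim)
        have "u * (real (k n) * \<epsilon>) \<le> \<bar>u\<bar> * (real (k n) * \<epsilon>)"
          using eps by (intro mult_right_mono) auto
        also have "\<dots> \<le> \<bar>u\<bar> * 1" using eps by (intro mult_left_mono) auto
        finally show "exp (u * (real (k n) * \<epsilon>)) \<le> exp \<bar>u\<bar>" by simp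
      qed (auto simp: M_def)
      finally show "norm (1 / normalized_Gamma n (Complex u v) ^ k n) \<le> M * exp \<bar>u\<bar>"
        by (simp add: norm_divide norm_power power_divide)
    qed
  qed
  thus ?thesis by (rule that)
qed

section \<open>Integrals along the contours\<close>

lemma integrable_exp_neg_abs: "integrable lborel (\<lambda>x::real. exp (- \<bar>x\<bar>))"
proof -
  let ?g = "\<lambda>x::real. exp (- x) * indicator {0<..} x"
  have g: "integrable lborel ?g"
    using has_bochner_integral_I0i_power_exp_m[of 0] by (auto simp: has_bochner_integral_iff)
  have "integrable lborel (\<lambda>x. ?g (0 + (-1) * x))"
    using g by (intro lborel_integrable_real_affine) auto
  hence "integrable lborel (\<lambda>x. ?g x + ?g (0 + (-1) * x))" using g by (rule Bochner_Integration.integrable_add[rotated])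
  thus ?thesis
  proof (rule Bochner_Integration.integrable_bound)
    show "AE x in lborel. norm (exp (- \<bar>x\<bar>)) \<le> norm (?g x + ?g (0 + (-1) * x))"
      using AE_lborel_singleton[of 0] by eventually_elim (auto simp: indicator_def)
  qed simp
qed

lemma integrable_if_exp_bounded:
  fixes f :: "real \<Rightarrow> 'a :: {banach, second_countable_topology}"
  assumes "f \<in> borel_measurable borel" "\<And>x. norm (f x) \<le> C * exp (- \<bar>x\<bar>)"
  shows "integrable lborel f"
proof -
  have "integrable lborel (\<lambda>x. C * exp (- \<bar>x\<bar>))"
    using integrable_exp_neg_abs by simp
  thus ?thesis
    by (rule Bochner_Integration.integrable_bound)
       (use assms in \<open>auto intro!: AE_I2 order_trans[OF _ abs_ge_self]\<close>)
qed

text \<open>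
  One continuous parametrization of the whole \<open>\<zeta>\<close>-contour over the real line, so that an integral along it is
  a single Lebesgue integral. It runs from the lower ray to the upper one, against the orientation of
  the contour, which keeps the imaginary part equal to the parameter on the segment.
\<close>

definition zeta_path :: "real \<Rightarrow> real \<Rightarrow> real \<Rightarrow> complex" where
  "zeta_path \<delta> c' s = Complex (max (\<bar>s\<bar> - \<delta>) 0 - c') (max (- \<delta>) (min s \<delta>))"

text \<open>
  The derivative of the parametrization with the sign that restores the orientation of the contour.
\<close>

definition zeta_weight :: "real \<Rightarrow> real \<Rightarrow> complex" where
  "zeta_weight \<delta> s = (if s < - \<delta> then 1 else if s \<le> \<delta> then - \<i> else - 1)"

lemma continuous_on_zeta_path: "continuous_on A (zeta_path \<delta> c')"
  unfolding zeta_path_def Complex_eq by (intro continuous_intros)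

lemma zeta_path_measurable [measurable]: "zeta_path \<delta> c' \<in> borel_measurable borel"
  by (intro borel_measurable_continuous_onI continuous_on_zeta_path)

lemma zeta_weight_measurable [measurable]: "zeta_weight \<delta> \<in> borel_measurable borel"
  unfolding zeta_weight_def by measurable

lemma norm_zeta_weight [simp]: "norm (zeta_weight \<delta> s) = 1"
  by (simp add: zeta_weight_def)

lemma Re_zeta_path: "Re (zeta_path \<delta> c' s) = max (\<bar>s\<bar> - \<delta>) 0 - c'"
  and Im_zeta_path: "Im (zeta_path \<delta> c' s) = max (- \<delta>) (min s \<delta>)"
  by (simp_all add: zeta_path_def)

lemma contour_integral_vertical_segment:
  assumes "a \<noteq> b" and f: "set_integrable lborel (closed_segment a b) (\<lambda>s. f (Complex x s))"
  shows "contour_integral (linepath (Complex x a) (Complex x b)) f =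
           \<i> * of_real (sgn (b - a)) * (LINT s:closed_segment a b|lborel. f (Complex x s))"
proof -
  define h where "h = (\<lambda>s. indicator (closed_segment a b) s *\<^sub>R f (Complex x s))"
  have h: "integrable lborel h" using f by (simp add: h_def set_integrable_def)
  have ba: "b - a \<noteq> 0" using assms(1) by simp
  have lp: "linepath (Complex x a) (Complex x b) t = Complex x (a + (b - a) * t)" for t
    by (simp add: linepath_def complex_eq_iff algebra_simps)
  have ind: "h (a + (b - a) * t) = indicator {0..1} t *\<^sub>R f (Complex x (a + (b - a) * t))" for t
  proof -
    have "a + (b - a) * t \<in> closed_segment a b \<longleftrightarrow> t \<in> {0..1}"
    proof -
      have "a + (b - a) * t \<in> closed_segment a b \<longleftrightarrow> (\<exists>u\<in>{0..1}. a + (b - a) * t = a + (b - a) * u)"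
        unfolding closed_segment_def by (auto simp: algebra_simps) 
      also have "\<dots> \<longleftrightarrow> t \<in> {0..1}" using assms(1) by auto
      finally show ?thesis .
    qed
    thus ?thesis by (simp add: h_def indicator_def)
  qed
  have int1: "integrable lborel (\<lambda>t. h (a + (b - a) * t))"
    using ba h by (rule lborel_integrable_real_affine[rotated])
  have si: "set_integrable lborel {0..1} (\<lambda>t. f (Complex x (a + (b - a) * t)))"
    using int1 by (simp add: ind set_integrable_def)
  have "contour_integral (linepath (Complex x a) (Complex x b)) f =
          integral {0..1} (\<lambda>t. f (Complex x (a + (b - a) * t)) * (Complex x b - Complex x a))"
    unfolding contour_integral_integral by (simp add: lp)
  also have "\<dots> = integral {0..1} (\<lambda>t. f (Complex x (a + (b - a) * t))) * (Complex x b - Complex x a)"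
    by simp
  also have "integral {0..1} (\<lambda>t. f (Complex x (a + (b - a) * t))) = (LINT t|lborel. h (a + (b - a) * t))"
    using set_borel_integral_eq_integral(2)[OF si] by (simp add: ind set_lebesgue_integral_def)
  also have "Complex x b - Complex x a = \<i> * of_real (b - a)"
    by (simp add: complex_eq_iff)
  also have "of_real (b - a) = of_real (sgn (b - a)) * (of_real \<bar>b - a\<bar> :: complex)"
    by (metis of_real_mult sgn_mult_abs)
  also have "(LINT t|lborel. h (a + (b - a) * t)) * (\<i> * (of_real (sgn (b - a)) * of_real \<bar>b - a\<bar>)) =
     \<i> * of_real (sgn (b - a)) * (\<bar>b - a\<bar> *\<^sub>R (LINT t|lborel. h (a + (b - a) * t)))"
    by (simp add: scaleR_conv_of_real mult_ac)
  also have "\<bar>b - a\<bar> *\<^sub>R (LINT t|lborel. h (a + (b - a) * t)) = (LINT s|lborel. h s)"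
    by (rule lborel_integral_real_affine[symmetric]) (rule ba)
  finally show ?thesis by (simp add: h_def set_lebesgue_integral_def)
qed

lemma S_zeta_integral_eq_LINT:
  assumes \<delta>: "\<delta> > 0" and f: "integrable lborel (\<lambda>s. f (zeta_path \<delta> c' s))"
  shows "S_zeta_integral \<delta> c' f = (LINT s|lborel. zeta_weight \<delta> s * f (zeta_path \<delta> c' s))"
proof -
  define F where "F = (\<lambda>s. f (zeta_path \<delta> c' s))"
  define A B D where "A = (\<lambda>s. indicator {..-\<delta>} s *\<^sub>R F s)" and "B = (\<lambda>s. indicator {-\<delta>..\<delta>} s *\<^sub>R F s)"
    and "D = (\<lambda>s. indicator {\<delta>..} s *\<^sub>R F s)"
  have int: "integrable lborel A" "integrable lborel B" "integrable lborel D"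
    unfolding A_def B_def D_def by (intro integrable_mult_indicator; use f in \<open>simp add: F_def\<close>)+
  have mid: "(\<lambda>s. indicator (closed_segment \<delta> (-\<delta>)) s *\<^sub>R f (Complex (- c') s)) = B"
    using \<delta> by (auto simp: fun_eq_iff B_def F_def zeta_path_def closed_segment_eq_real_ivl indicator_def)
  have "contour_integral (linepath (Complex (- c') \<delta>) (Complex (- c') (- \<delta>))) f =
          \<i> * of_real (sgn (- \<delta> - \<delta>)) * (LINT s:closed_segment \<delta> (-\<delta>)|lborel. f (Complex (- c') s))"
    by (rule contour_integral_vertical_segment)
       (use \<delta> int(2) in \<open>auto simp: set_integrable_def mid\<close>)
  also have "\<dots> = - \<i> * (LINT s|lborel. B s)"
    using \<delta> by (simp add: set_lebesgue_integral_def mid)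
  finally have 2: "contour_integral (linepath (Complex (- c') \<delta>) (Complex (- c') (- \<delta>))) f = - \<i> * (LINT s|lborel. B s)" .
  have "(LINT u:{- c'..}|lborel. f (Complex u \<delta>)) =
          (LINT s|lborel. indicator {-c'..} ((- c' - \<delta>) + 1 * s) *\<^sub>R f (Complex ((- c' - \<delta>) + 1 * s) \<delta>))"
    unfolding set_lebesgue_integral_def
    by (subst lborel_integral_real_affine[where c = 1 and t = "- c' - \<delta>"]) simp_all
  also have "\<dots> = (LINT s|lborel. D s)"
    using \<delta> by (intro Bochner_Integration.integral_cong)
      (auto simp: D_def F_def zeta_path_def indicator_def algebra_simps)
  finally have 1: "(LINT u:{- c'..}|lborel. f (Complex u \<delta>)) = (LINT s|lborel. D s)" .
  have "(LINT u:{- c'..}|lborel. f (Complex u (-\<delta>))) =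
          (LINT s|lborel. indicator {-c'..} ((- c' - \<delta>) + (-1) * s) *\<^sub>R f (Complex ((- c' - \<delta>) + (-1) * s) (-\<delta>)))"
    unfolding set_lebesgue_integral_def
    by (subst lborel_integral_real_affine[where c = "-1" and t = "- c' - \<delta>"]) simp_all
  also have "\<dots> = (LINT s|lborel. A s)"
    using \<delta> by (intro Bochner_Integration.integral_cong)
      (auto simp: A_def F_def zeta_path_def indicator_def algebra_simps)
  finally have 3: "(LINT u:{- c'..}|lborel. f (Complex u (-\<delta>))) = (LINT s|lborel. A s)" .
  have "(LINT s|lborel. zeta_weight \<delta> s * F s) = (LINT s|lborel. - D s + - \<i> * B s + A s)"
  proof (rule integral_cong_AE)
    show "AE s in lborel. zeta_weight \<delta> s * F s = - D s + - \<i> * B s + A s"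
      using AE_lborel_singleton[of \<delta>] AE_lborel_singleton[of "-\<delta>"]
      by eventually_elim (use \<delta> in \<open>auto simp: A_def B_def D_def zeta_weight_def indicator_def\<close>)
    have [measurable]: "F \<in> borel_measurable borel"
      using borel_measurable_integrable[OF f] by (simp add: F_def)
    show "(\<lambda>s. zeta_weight \<delta> s * F s) \<in> borel_measurable lborel" by measurable
    show "(\<lambda>s. - D s + - \<i> * B s + A s) \<in> borel_measurable lborel"
      unfolding A_def B_def D_def by measurable
  qed
  also have "\<dots> = - (LINT s|lborel. D s) + - \<i> * (LINT s|lborel. B s) + (LINT s|lborel. A s)"
    using int by simp
  finally show ?thesis
    unfolding S_zeta_integral_def 1 2 3 by (simp add: F_def)
qed

text \<open>
  Here the derivative is a direct estimate: by the resolvent identity the difference quotient differs from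
  \<open>- \<integral> g/(\<sigma> - Z)\<^sup>2\<close> by \<open>(\<tau> - \<sigma>) \<integral> g / ((\<tau> - Z) (\<sigma> - Z)\<^sup>2)\<close>.
\<close>

lemma Cauchy_transform_holomorphic:
  fixes Z g :: "real \<Rightarrow> complex"
  assumes g: "integrable lborel g" and Z [measurable]: "Z \<in> borel_measurable borel"
    and Re: "\<And>s. Re (Z s) \<ge> b"
  shows "(\<lambda>\<sigma>. LINT s|lborel. g s / (\<sigma> - Z s)) holomorphic_on {\<sigma>. Re \<sigma> < b}"
proof (rule holomorphic_onI)
  fix \<sigma> assume "\<sigma> \<in> {\<sigma>. Re \<sigma> < b}"
  define d where "d = (b - Re \<sigma>) / 2"
  have d: "d > 0" using \<open>\<sigma> \<in> _\<close> by (simp add: d_def)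
  have [measurable]: "g \<in> borel_measurable borel" using borel_measurable_integrable[OF g] by simp
  have dist: "norm (\<tau> - Z s) \<ge> d" if "norm (\<tau> - \<sigma>) < d" for \<tau> s
  proof -
    have "Re \<tau> - Re \<sigma> < d" using that abs_Re_le_cmod[of "\<tau> - \<sigma>"] by simp
    moreover have "norm (\<tau> - Z s) \<ge> Re (Z s) - Re \<tau>"
      using abs_Re_le_cmod[of "\<tau> - Z s"] by simp
    ultimately show ?thesis using Re[of s] by (simp add: d_def field_simps)
  qed
  have int1: "integrable lborel (\<lambda>s. g s / (\<tau> - Z s))" if "norm (\<tau> - \<sigma>) < d" for \<tau>
  proof (rule Bochner_Integration.integrable_bound)
    show "integrable lborel (\<lambda>s. g s / of_real d)" using g by simp
    show "AE s in lborel. norm (g s / (\<tau> - Z s)) \<le> norm (g s / of_real d)"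
      using dist[OF that] d by (intro AE_I2) (auto simp: norm_divide intro!: divide_left_mono mult_pos_pos elim: less_le_trans)
  qed simp
  have int2: "integrable lborel (\<lambda>s. g s / (\<sigma> - Z s)\<^sup>2)"
  proof (rule Bochner_Integration.integrable_bound)
    show "integrable lborel (\<lambda>s. g s / of_real (d\<^sup>2))" using g by simp
    have *: "0 < norm (\<sigma> - Z s)" for s using dist[of \<sigma> s] d by auto
    show "AE s in lborel. norm (g s / (\<sigma> - Z s)\<^sup>2) \<le> norm (g s / of_real (d\<^sup>2))"
      using dist[of \<sigma>] d * 
      by (intro AE_I2) (auto simp: norm_divide norm_power intro!: divide_left_mono mult_pos_pos power_mono)
  qed simp
  let ?h = "\<lambda>\<sigma>. LINT s|lborel. g s / (\<sigma> - Z s)"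
  let ?D = "- (LINT s|lborel. g s / (\<sigma> - Z s)\<^sup>2)"
  have "((\<lambda>\<tau>. (?h \<tau> - ?h \<sigma>) / (\<tau> - \<sigma>) - ?D) \<longlongrightarrow> 0) (at \<sigma>)"
  proof (rule Lim_null_comparison)
    have "\<forall>\<^sub>F \<tau> in at \<sigma>. dist \<tau> \<sigma> < d" using d by (auto simp: eventually_at)
    moreover have "\<forall>\<^sub>F \<tau> in at \<sigma>. \<tau> \<noteq> \<sigma>" by (auto simp: eventually_at_filter)
    ultimately show "\<forall>\<^sub>F \<tau> in at \<sigma>. norm ((?h \<tau> - ?h \<sigma>) / (\<tau> - \<sigma>) - ?D) \<le> 
        norm (\<tau> - \<sigma>) * ((LINT s|lborel. norm (g s)) / d ^ 3)"
    proof eventually_elim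
      case (elim \<tau>)
      have t: "norm (\<tau> - \<sigma>) < d" "norm (\<sigma> - \<sigma>) < d" using elim d by (auto simp: dist_norm)
      have nz: "\<tau> - Z s \<noteq> 0" "\<sigma> - Z s \<noteq> 0" for s using dist[OF t(1), of s] dist[OF t(2), of s] d by auto
      have alg: "(x / p - x / q) / (p - q) + x / q\<^sup>2 = (p - q) * (x / (p * q\<^sup>2))"
        if "p \<noteq> 0" "q \<noteq> 0" "p \<noteq> q" for x p q :: complex
        using that by (simp add: divide_simps power2_eq_square) (simp add: algebra_simps)
      have "(?h \<tau> - ?h \<sigma>) / (\<tau> - \<sigma>) - ?D =
          (LINT s|lborel. (g s / (\<tau> - Z s) - g s / (\<sigma> - Z s)) / (\<tau> - \<sigma>) + g s / (\<sigma> - Z s)\<^sup>2)"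
        using int1[OF t(1)] int1[OF t(2)] int2 by simp
      also have "\<dots> = (LINT s|lborel. (\<tau> - \<sigma>) * (g s / ((\<tau> - Z s) * (\<sigma> - Z s)\<^sup>2)))"
      proof (intro Bochner_Integration.integral_cong refl)
        fix s
        show "(g s / (\<tau> - Z s) - g s / (\<sigma> - Z s)) / (\<tau> - \<sigma>) + g s / (\<sigma> - Z s)\<^sup>2 =
              (\<tau> - \<sigma>) * (g s / ((\<tau> - Z s) * (\<sigma> - Z s)\<^sup>2))"
          using alg[of "\<tau> - Z s" "\<sigma> - Z s" "g s"] nz[of s] elim by simp
      qed
      also have "norm \<dots> \<le> (LINT s|lborel. norm (\<tau> - \<sigma>) * (norm (g s) / d ^ 3))"
      proof (rule Bochner_Integration.integral_norm_bound_integral[OF _ _ ])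
        have le: "norm ((\<tau> - \<sigma>) * (g s / ((\<tau> - Z s) * (\<sigma> - Z s)\<^sup>2))) \<le> norm (\<tau> - \<sigma>) * (norm (g s) / d ^ 3)" for s
        proof -
          have "d ^ 3 = d * d\<^sup>2" by (simp add: power3_eq_cube power2_eq_square)
          also have "\<dots> \<le> norm (\<tau> - Z s) * norm (\<sigma> - Z s) ^ 2"
            using dist[OF t(1), of s] dist[OF t(2), of s] d by (intro mult_mono power_mono) auto
          also have "\<dots> = norm ((\<tau> - Z s) * (\<sigma> - Z s)\<^sup>2)" by (simp add: norm_mult norm_power)
          finally have "norm (g s) / norm ((\<tau> - Z s) * (\<sigma> - Z s)\<^sup>2) \<le> norm (g s) / d ^ 3"
            using d by (intro divide_left_mono mult_pos_pos) (auto simp: nz elim: less_le_trans[rotated])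
          thus ?thesis unfolding norm_mult[of "\<tau> - \<sigma>"] norm_divide by (intro mult_left_mono) auto
        qed
        show "norm ((\<tau> - \<sigma>) * (g s / ((\<tau> - Z s) * (\<sigma> - Z s)\<^sup>2))) \<le> norm (\<tau> - \<sigma>) * (norm (g s) / d ^ 3)" for s
          by (rule le)
        show i: "integrable lborel (\<lambda>s. norm (\<tau> - \<sigma>) * (norm (g s) / d ^ 3))" using g by simp
        show "integrable lborel (\<lambda>s. (\<tau> - \<sigma>) * (g s / ((\<tau> - Z s) * (\<sigma> - Z s)\<^sup>2)))"
          by (rule Bochner_Integration.integrable_bound[OF i])
             (use le d in auto)
      qed
      also have "\<dots> = norm (\<tau> - \<sigma>) * ((LINT s|lborel. norm (g s)) / d ^ 3)" by simp
      finally show ?case .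
    qed
    show "((\<lambda>\<tau>. norm (\<tau> - \<sigma>) * ((LINT s|lborel. norm (g s)) / d ^ 3)) \<longlongrightarrow> 0) (at \<sigma>)"
      using d by (auto intro!: tendsto_eq_intros)
  qed
  hence "((\<lambda>\<tau>. (?h \<tau> - ?h \<sigma>) / (\<tau> - \<sigma>)) \<longlongrightarrow> ?D) (at \<sigma>)"
    by (rule LIM_zero_cancel)
  hence "(?h has_field_derivative ?D) (at \<sigma>)"
    by (simp add: has_field_derivative_iff)
  thus "?h field_differentiable at \<sigma> within {\<sigma>. Re \<sigma> < b}"
    unfolding field_differentiable_def using has_field_derivative_at_within by blast
qed

lemma norm_Cauchy_transform_le:
  fixes Z g :: "real \<Rightarrow> complex"
  assumes g: "integrable lborel g" and d: "d > 0" "\<And>s. norm (\<sigma> - Z s) \<ge> d"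
  shows "norm (LINT s|lborel. g s / (\<sigma> - Z s)) \<le> (LINT s|lborel. norm (g s)) / d"
proof (cases "integrable lborel (\<lambda>s. g s / (\<sigma> - Z s))")
  case True
  have "norm (LINT s|lborel. g s / (\<sigma> - Z s)) \<le> (LINT s|lborel. norm (g s) / d)"
  proof (rule Bochner_Integration.integral_norm_bound_integral[OF True])
    show "integrable lborel (\<lambda>s. norm (g s) / d)" using g by simp
    show "norm (g s / (\<sigma> - Z s)) \<le> norm (g s) / d" for s
    proof -
      have "norm (\<sigma> - Z s) > 0" using d(1) d(2)[of s] by linarith
      thus ?thesis using d by (auto simp: norm_divide intro!: divide_left_mono mult_pos_pos)
    qed
  qed
  thus ?thesis by simp
next
  case False
  thus ?thesis using d by (simp add: not_integrable_integral_eq)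
qed

lemma horizontal_FTC:
  assumes F: "\<And>z. z \<in> U \<Longrightarrow> (F has_field_derivative f z) (at z)" and f: "continuous_on U f"
    and "a \<le> b" and sub: "\<And>u. u \<in> {a..b} \<Longrightarrow> Complex u v \<in> U"
  shows "(LINT u:{a..b}|lborel. f (Complex u v)) = F (Complex b v) - F (Complex a v)"
  unfolding set_lebesgue_integral_def
proof (rule integral_FTC_atLeastAtMost)
  show "continuous_on {a..b} (\<lambda>u. f (Complex u v))"
    by (rule continuous_on_compose2[OF f]) (use sub in \<open>auto simp: Complex_eq intro!: continuous_intros\<close>)
  show "((\<lambda>u. F (Complex u v)) has_vector_derivative f (Complex u v)) (at u within {a..b})"
    if "a \<le> u" "u \<le> b" for u
  proof -
    have "((\<lambda>u. Complex u v) has_vector_derivative 1) (at u within {a..b})"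
      unfolding Complex_eq by (auto intro!: derivative_eq_intros)
    from field_vector_diff_chain_within[OF this, of F "f (Complex u v)"]
    show ?thesis using F[of "Complex u v"] sub[of u] that
      by (auto simp: o_def intro: has_field_derivative_at_within)
  qed
qed (use assms in auto)

text \<open>
  The factor \<open>e\<close> is \<open>1\<close> or \<open>-1\<close> in use; it allows one argument for the upper and the lower half-plane.
\<close>

lemma vertical_FTC:
  assumes F: "\<And>z. z \<in> U \<Longrightarrow> (F has_field_derivative f z) (at z)" and f: "continuous_on U f"
    and "a \<le> b" and sub: "\<And>v. v \<in> {a..b} \<Longrightarrow> Complex x (e * v) \<in> U"
  shows "\<i> * of_real e * (LINT v:{a..b}|lborel. f (Complex x (e * v))) =
           F (Complex x (e * b)) - F (Complex x (e * a))"
proof -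
  have "(LINT v:{a..b}|lborel. \<i> * of_real e * f (Complex x (e * v))) =
           F (Complex x (e * b)) - F (Complex x (e * a))"
    unfolding set_lebesgue_integral_def
  proof (rule integral_FTC_atLeastAtMost)
    show "continuous_on {a..b} (\<lambda>v. \<i> * of_real e * f (Complex x (e * v)))"
      by (intro continuous_intros continuous_on_compose2[OF f])
         (use sub in \<open>auto simp: Complex_eq intro!: continuous_intros\<close>)
    show "((\<lambda>v. F (Complex x (e * v))) has_vector_derivative \<i> * of_real e * f (Complex x (e * v)))
            (at v within {a..b})" if "a \<le> v" "v \<le> b" for v
    proof -
      have "((\<lambda>v. Complex x (e * v)) has_vector_derivative (\<i> * of_real e)) (at v within {a..b})"
        unfolding Complex_eq by (auto intro!: derivative_eq_intros)
      from field_vector_diff_chain_within[OF this, of F "f (Complex x (e * v))"]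
      show ?thesis using F[of "Complex x (e * v)"] sub[of v] that
        by (auto simp: o_def mult_ac intro: has_field_derivative_at_within)
    qed
  qed (use assms in auto)
  thus ?thesis by simp
qed

lemma set_integral_Icc_to_UNIV:
  fixes f :: "real \<Rightarrow> 'a::{banach, second_countable_topology}"
  assumes "integrable lborel f"
  shows "(\<lambda>N. LINT v:{-real N..real N}|lborel. f v) \<longlonglongrightarrow> (LINT v|lborel. f v)"
proof -
  have "(\<lambda>N. LINT v:{-real N..real N}|lborel. f v) \<longlonglongrightarrow> (LINT v:(\<Union>N. {-real N..real N})|lborel. f v)"
  proof (rule set_integral_cont_up)
    show "incseq (\<lambda>N. {- real N..real N})" by (auto simp: incseq_def)
    show "set_integrable lborel (\<Union>N. {- real N..real N}) f"
      unfolding set_integrable_def by (intro integrable_mult_indicator assms) auto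
  qed auto
  moreover have "(\<Union>N. {-real N..real N}) = UNIV"
  proof -
    have "\<exists>N. x \<in> {-real N..real N}" for x
    proof -
      obtain N :: nat where "\<bar>x\<bar> \<le> real N" using real_arch_simple by blast
      hence "x \<in> {-real N..real N}" by auto
      thus ?thesis ..
    qed
    thus ?thesis by auto
  qed
  ultimately show ?thesis by (simp add: set_lebesgue_integral_def)
qed

lemma set_integral_Icc_to_atLeast:
  fixes f :: "real \<Rightarrow> 'a::{banach, second_countable_topology}"
  assumes "set_integrable lborel {a..} f"
  shows "(\<lambda>N. LINT v:{a..real N}|lborel. f v) \<longlonglongrightarrow> (LINT v:{a..}|lborel. f v)"
proof -
  have U: "(\<Union>N. {a..real N}) = {a..}" using real_arch_simple by auto
  have "(\<lambda>N. LINT v:{a..real N}|lborel. f v) \<longlonglongrightarrow> (LINT v:(\<Union>N. {a..real N})|lborel. f v)"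
  proof (rule set_integral_cont_up)
    show "incseq (\<lambda>N. {a..real N})" by (auto simp: incseq_def)
    show "set_integrable lborel (\<Union>N. {a..real N}) f" unfolding U by (rule assms)
  qed auto
  thus ?thesis unfolding U .
qed

lemma set_integral_Icc_to_atMost:
  fixes f :: "real \<Rightarrow> 'a::{banach, second_countable_topology}"
  assumes "set_integrable lborel {..a} f"
  shows "(\<lambda>N. LINT v:{-real N..a}|lborel. f v) \<longlonglongrightarrow> (LINT v:{..a}|lborel. f v)"
proof -
  have U: "(\<Union>N. {-real N..a}) = {..a}"
  proof -
    have "\<exists>N. -real N \<le> x" for x
      using real_arch_simple[of "- x"] by (auto simp: minus_le_iff)
    thus ?thesis by auto
  qed
  have "(\<lambda>N. LINT v:{-real N..a}|lborel. f v) \<longlonglongrightarrow> (LINT v:(\<Union>N. {-real N..a})|lborel. f v)"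
  proof (rule set_integral_cont_up)
    show "incseq (\<lambda>N. {-real N..a})" by (auto simp: incseq_def)
    show "set_integrable lborel (\<Union>N. {-real N..a}) f" unfolding U by (rule assms)
  qed auto
  thus ?thesis unfolding U .
qed

text \<open>
  With a primitive \<open>F\<close> of \<open>f\<close>, the two integrals truncated at height \<open>N\<close> differ by increments of \<open>F\<close> along
  the two horizontal segments at heights \<open>\<plusminus>N\<close>, where \<open>f\<close> is at most \<open>C exp (-N)\<close>.
\<close>

lemma vline_integral_shift:
  assumes hol: "f holomorphic_on {z. Re z > l}" and x: "l < x" "x \<le> y"
    and bound: "\<And>u v. x \<le> u \<Longrightarrow> u \<le> y \<Longrightarrow> norm (f (Complex u v)) \<le> C * exp (- \<bar>v\<bar>)"
  shows "vline_integral x f = vline_integral y f"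
proof -
  let ?U = "{z. Re z > l}"
  have conv: "convex ?U" by (rule convex_halfspace_Re_gt)
  have op: "open ?U" by (rule open_halfspace_Re_gt)
  obtain F where F0: "\<And>z. z \<in> ?U \<Longrightarrow> (F has_field_derivative f z) (at z within ?U)"
    using holomorphic_convex_primitive'[OF conv op hol] by blast
  have F: "(F has_field_derivative f z) (at z)" if "z \<in> ?U" for z
    using F0[OF that] unfolding at_within_open[OF that op] .
  have cont: "continuous_on ?U f" using hol by (rule holomorphic_on_imp_continuous_on)
  have int: "integrable lborel (\<lambda>v. f (Complex u v))" if u: "x \<le> u" "u \<le> y" for u
  proof (rule integrable_if_exp_bounded)
    show "(\<lambda>v. f (Complex u v)) \<in> borel_measurable borel"
      by (intro borel_measurable_continuous_onI continuous_on_compose2[OF cont])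
         (use x u in \<open>auto simp: Complex_eq intro!: continuous_intros\<close>)
  qed (use bound u in auto)
  have vert: "\<i> * (LINT v:{-real N..real N}|lborel. f (Complex u v)) =
      F (Complex u N) - F (Complex u (- N))" if "x \<le> u" "u \<le> y" for u N
    using vertical_FTC[OF F cont, of "-real N" "real N" u 1] that x by simp
  have close: "norm (F (Complex x v) - F (Complex y v)) \<le> C * exp (- \<bar>v\<bar>) * (y - x)" for v
  proof -
    have "norm (F (Complex x v) - F (Complex y v)) \<le> C * exp (- \<bar>v\<bar>) * norm (Complex x v - Complex y v)"
    proof (rule field_differentiable_bound)
      show "convex (closed_segment (Complex x v) (Complex y v))" by simp
      fix z assume z: "z \<in> closed_segment (Complex x v) (Complex y v)"
      have "Re z \<in> closed_segment x y" "Im z = v"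
        using z by (simp_all add: closed_segment_same_Im)
      hence zz: "x \<le> Re z" "Re z \<le> y" "Im z = v"
        using x by (auto simp: closed_segment_eq_real_ivl)
      have "norm (f (Complex (Re z) (Im z))) \<le> C * exp (- \<bar>v\<bar>)"
        using bound[of "Re z" "Im z"] zz by simp
      thus "norm (f z) \<le> C * exp (- \<bar>v\<bar>)" by simp
      show "(F has_field_derivative f z) (at z within closed_segment (Complex x v) (Complex y v))"
        using F[of z] zz x by (auto intro: has_field_derivative_at_within)
    qed auto
    also have "Complex x v - Complex y v = of_real (x - y)" by (simp add: complex_eq_iff)
    also have "norm (of_real (x - y) :: complex) = y - x" using x by (subst norm_of_real) simp
    finally show ?thesis .
  qed
  have lim0: "(\<lambda>N. \<i> * (LINT v:{-real N..real N}|lborel. f (Complex x v)) -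
           \<i> * (LINT v:{-real N..real N}|lborel. f (Complex y v))) \<longlonglongrightarrow> 0"
  proof (rule Lim_null_comparison)
    show "\<forall>\<^sub>F N in sequentially. norm (\<i> * (LINT v:{-real N..real N}|lborel. f (Complex x v)) -
           \<i> * (LINT v:{-real N..real N}|lborel. f (Complex y v))) \<le> 2 * (C * exp (- real N) * (y - x))"
    proof (intro always_eventually allI)
      fix N
      have "norm (\<i> * (LINT v:{-real N..real N}|lborel. f (Complex x v)) -
           \<i> * (LINT v:{-real N..real N}|lborel. f (Complex y v))) =
        norm ((F (Complex x N) - F (Complex y N)) - (F (Complex x (- real N)) - F (Complex y (- real N))))"
        unfolding vert[OF order_refl x(2)] vert[OF x(2) order_refl] by (simp add: algebra_simps)
      also have "\<dots> \<le> norm (F (Complex x N) - F (Complex y N)) +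
          norm (F (Complex x (- real N)) - F (Complex y (- real N)))"
        by (rule norm_triangle_ineq4)
      also have "\<dots> \<le> 2 * (C * exp (- real N) * (y - x))"
        using close[of "real N"] close[of "-real N"] by simp
      finally show "norm (\<i> * (LINT v:{-real N..real N}|lborel. f (Complex x v)) -
           \<i> * (LINT v:{-real N..real N}|lborel. f (Complex y v))) \<le> 2 * (C * exp (- real N) * (y - x))" .
    qed
    have "(\<lambda>N. exp (- real N)) \<longlonglongrightarrow> 0" by real_asymp
    hence "(\<lambda>N. 2 * (C * exp (- real N) * (y - x))) \<longlonglongrightarrow> 2 * (C * 0 * (y - x))"
      by (intro tendsto_intros)
    thus "(\<lambda>N. 2 * (C * exp (- real N) * (y - x))) \<longlonglongrightarrow> 0" by simp
  qed
  moreover have "(\<lambda>N. \<i> * (LINT v:{-real N..real N}|lborel. f (Complex x v)) -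
           \<i> * (LINT v:{-real N..real N}|lborel. f (Complex y v))) \<longlonglongrightarrow>
        vline_integral x f - vline_integral y f"
    unfolding vline_integral_def using x
    by (intro tendsto_intros set_integral_Icc_to_UNIV int) auto
  ultimately have "vline_integral x f - vline_integral y f = 0"
    using LIMSEQ_unique by blast
  thus ?thesis by simp
qed

text \<open>
  Cauchy's theorem for the quadrant \<open>Re z \<le> b\<close>, \<open>e Im z \<ge> \<delta>\<close>. For a primitive \<open>F\<close>, the truncated boundary integral
  is \<open>F(b + ieN) - F(-N + ie\<delta>)\<close>. These points are joined through the far corner \<open>-N + ieN\<close> along segments of
  length \<open>O(N)\<close> on which \<open>f\<close> is \<open>O(exp (-N))\<close>.
\<close>

lemma quadrant_boundary_integral:
  assumes e: "e = 1 \<or> e = - 1" and \<delta>: "\<delta> > 0" and b: "b < b'"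
    and hol: "f holomorphic_on {z. Re z < b' \<and> 0 < e * Im z}"
    and bound: "\<And>u v. u \<le> b \<Longrightarrow> \<delta> \<le> v \<Longrightarrow> norm (f (Complex u (e * v))) \<le> C * exp u * exp (- v)"
  shows "set_integrable lborel {\<delta>..} (\<lambda>v. f (Complex b (e * v)))"
    and "(LINT u:{..b}|lborel. f (Complex u (e * \<delta>))) + \<i> * of_real e * (LINT v:{\<delta>..}|lborel. f (Complex b (e * v))) = 0"
proof -
  let ?U = "{z. Re z < b' \<and> 0 < e * Im z}"
  have Ueq: "?U = {z. Re z < b'} \<inter> {z. (\<i> * of_real e) \<bullet> z > 0}" by (auto simp: inner_complex_def)
  have conv: "convex ?U" unfolding Ueq
    by (intro convex_Int convex_halfspace_Re_lt convex_halfspace_gt)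
  have op: "open ?U" unfolding Ueq
    by (intro open_Int open_halfspace_Re_lt open_halfspace_gt)
  have ee: "e * (e * v) = v" for v using e by auto
  obtain F where F0: "\<And>z. z \<in> ?U \<Longrightarrow> (F has_field_derivative f z) (at z within ?U)"
    using holomorphic_convex_primitive'[OF conv op hol] by blast
  have F: "(F has_field_derivative f z) (at z)" if "z \<in> ?U" for z
    using F0[OF that] unfolding at_within_open[OF that op] .
  have cont: "continuous_on ?U f" using hol by (rule holomorphic_on_imp_continuous_on)
  have C0: "C \<ge> 0"
    using order_trans[OF norm_ge_zero bound[of b \<delta>]] by (simp add: zero_le_mult_iff)
  show intv: "set_integrable lborel {\<delta>..} (\<lambda>v. f (Complex b (e * v)))"
    unfolding set_integrable_def
  proof (rule integrable_if_exp_bounded)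
    have "set_borel_measurable borel {\<delta>..} (\<lambda>v. f (Complex b (e * v)))"
      by (intro set_measurable_continuous_on continuous_on_compose2[OF cont])
         (use \<delta> b in \<open>auto simp: Complex_eq ee intro!: continuous_intros\<close>)
    thus "(\<lambda>v. indicator {\<delta>..} v *\<^sub>R f (Complex b (e * v))) \<in> borel_measurable borel"
      by (simp add: set_borel_measurable_def)
    show "norm (indicator {\<delta>..} v *\<^sub>R f (Complex b (e * v))) \<le> (C * exp b) * exp (- \<bar>v\<bar>)" for v
      using bound[of b v] \<delta> C0 by (auto simp: indicator_def)
  qed
  have intu: "set_integrable lborel {..b} (\<lambda>u. f (Complex u (e * \<delta>)))"
    unfolding set_integrable_def
  proof (rule integrable_if_exp_bounded)
    have "set_borel_measurable borel {..b} (\<lambda>u. f (Complex u (e * \<delta>)))"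
      by (intro set_measurable_continuous_on continuous_on_compose2[OF cont])
         (use \<delta> b in \<open>auto simp: Complex_eq ee intro!: continuous_intros\<close>)
    thus "(\<lambda>u. indicator {..b} u *\<^sub>R f (Complex u (e * \<delta>))) \<in> borel_measurable borel"
      by (simp add: set_borel_measurable_def)
    show "norm (indicator {..b} u *\<^sub>R f (Complex u (e * \<delta>))) \<le> (C * exp (2 * \<bar>b\<bar>)) * exp (- \<bar>u\<bar>)" for u
    proof (cases "u \<le> b")
      case True
      have "norm (f (Complex u (e * \<delta>))) \<le> C * exp u * exp (- \<delta>)" using bound[OF True, of \<delta>] by simp
      also have "\<dots> \<le> C * exp u * 1" using \<delta> C0 by (intro mult_left_mono) auto
      also have "\<dots> \<le> C * exp (2 * \<bar>b\<bar> + - \<bar>u\<bar>)" using True C0 by (auto intro!: mult_left_mono)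
      finally show ?thesis using True unfolding exp_add by (simp add: mult_ac)
    qed (use C0 in auto)
  qed
  have mvt: "norm (F z - F w) \<le> B * norm (z - w)"
    if seg: "\<And>p. p \<in> closed_segment z w \<Longrightarrow> Re p \<le> b \<and> \<delta> \<le> e * Im p \<and> exp (Re p) * exp (- (e * Im p)) * C \<le> B" for z w B
  proof (rule field_differentiable_bound)
    show "convex (closed_segment z w)" by simp
    fix p assume p: "p \<in> closed_segment z w"
    have p': "Re p \<le> b" "\<delta> \<le> e * Im p" using seg[OF p] by auto
    show "(F has_field_derivative f p) (at p within closed_segment z w)"
      using F[of p] p' \<delta> b by (auto intro: has_field_derivative_at_within)
    have "norm (f (Complex (Re p) (e * (e * Im p)))) \<le> C * exp (Re p) * exp (- (e * Im p))"
      using bound[of "Re p" "e * Im p"] p' by simp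
    thus "norm (f p) \<le> B" using seg[OF p] by (simp add: ee mult_ac)
  qed auto
  define K where "K = nat \<lceil>max (\<bar>b\<bar>) \<delta>\<rceil>"
  have lim0: "(\<lambda>N. (LINT u:{-real N..b}|lborel. f (Complex u (e * \<delta>))) +
       \<i> * of_real e * (LINT v:{\<delta>..real N}|lborel. f (Complex b (e * v)))) \<longlonglongrightarrow> 0"
  proof (rule Lim_null_comparison)
    show "\<forall>\<^sub>F N in sequentially. norm ((LINT u:{-real N..b}|lborel. f (Complex u (e * \<delta>))) +
       \<i> * of_real e * (LINT v:{\<delta>..real N}|lborel. f (Complex b (e * v)))) \<le>
        C * exp \<bar>b\<bar> * (exp (- real N) * (2 * real N + \<bar>b\<bar>))"
      using eventually_ge_at_top[of K]
    proof eventually_elim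
      case (elim N)
      have N: "\<bar>b\<bar> \<le> real N" "\<delta> \<le> real N" "-real N \<le> b" using elim by (auto simp: K_def)
      have h: "(LINT u:{-real N..b}|lborel. f (Complex u (e * \<delta>))) =
           F (Complex b (e * \<delta>)) - F (Complex (- real N) (e * \<delta>))"
        by (rule horizontal_FTC[OF F cont]) (use N b \<delta> in \<open>auto simp: ee\<close>)
      have v: "\<i> * of_real e * (LINT v:{\<delta>..real N}|lborel. f (Complex b (e * v))) =
          F (Complex b (e * real N)) - F (Complex b (e * \<delta>))"
        by (rule vertical_FTC[OF F cont]) (use N b \<delta> in \<open>auto simp: ee\<close>)
      have 1: "norm (F (Complex b (e * real N)) - F (Complex (- real N) (e * real N)))
         \<le> C * exp \<bar>b\<bar> * exp (- real N) * norm (Complex b (e * real N) - Complex (- real N) (e * real N))"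
      proof (rule mvt)
        fix p assume p: "p \<in> closed_segment (Complex b (e * real N)) (Complex (- real N) (e * real N))"
        have "Re p \<in> closed_segment b (- real N)" "Im p = e * real N"
          using p by (simp_all add: closed_segment_same_Im)
        hence "Re p \<le> b" "Im p = e * real N" using N by (auto simp: closed_segment_eq_real_ivl split: if_splits)
        moreover from this have "exp (Re p) * exp (- real N) * C \<le> exp \<bar>b\<bar> * exp (- real N) * C"
          using C0 by (intro mult_right_mono) auto
        ultimately show "Re p \<le> b \<and> \<delta> \<le> e * Im p \<and> exp (Re p) * exp (- (e * Im p)) * C \<le> C * exp \<bar>b\<bar> * exp (- real N)"
          using N by (simp add: ee mult_ac)
      qed
      have 2: "norm (F (Complex (- real N) (e * real N)) - F (Complex (- real N) (e * \<delta>)))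
         \<le> C * exp \<bar>b\<bar> * exp (- real N) * norm (Complex (- real N) (e * real N) - Complex (- real N) (e * \<delta>))"
      proof (rule mvt)
        fix p assume p: "p \<in> closed_segment (Complex (- real N) (e * real N)) (Complex (- real N) (e * \<delta>))"
        have "Re p = - real N" "Im p \<in> closed_segment (e * real N) (e * \<delta>)"
          using p by (simp_all add: closed_segment_same_Re)
        hence "Re p = - real N" "\<delta> \<le> e * Im p"
          using N e by (auto simp: closed_segment_eq_real_ivl split: if_splits)
        moreover have "exp (- real N) * exp (- (e * Im p)) * C \<le> C * exp \<bar>b\<bar> * exp (- real N)"
        proof -
          have "exp (- (e * Im p)) \<le> exp \<bar>b\<bar>" using \<open>\<delta> \<le> e * Im p\<close> \<delta> by simp
          hence "exp (- real N) * exp (- (e * Im p)) * C \<le> exp (- real N) * exp \<bar>b\<bar> * C"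
            using C0 by (intro mult_right_mono mult_left_mono) auto
          thus ?thesis by (simp add: mult_ac)
        qed
        ultimately show "Re p \<le> b \<and> \<delta> \<le> e * Im p \<and> exp (Re p) * exp (- (e * Im p)) * C \<le> C * exp \<bar>b\<bar> * exp (- real N)"
          using N by simp
      qed
      have n1: "norm (Complex b (e * real N) - Complex (- real N) (e * real N)) \<le> real N + \<bar>b\<bar>"
        using N by (simp add: cmod_def)
      have n2: "norm (Complex (- real N) (e * real N) - Complex (- real N) (e * \<delta>)) \<le> real N"
        using N e \<delta> by (auto simp: cmod_def)
      have "norm ((LINT u:{-real N..b}|lborel. f (Complex u (e * \<delta>))) +
           \<i> * of_real e * (LINT v:{\<delta>..real N}|lborel. f (Complex b (e * v)))) =
         norm ((F (Complex b (e * real N)) - F (Complex (- real N) (e * real N))) +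
           (F (Complex (- real N) (e * real N)) - F (Complex (- real N) (e * \<delta>))))"
        unfolding h v by simp
      also have "\<dots> \<le> C * exp \<bar>b\<bar> * exp (- real N) * (real N + \<bar>b\<bar>) + C * exp \<bar>b\<bar> * exp (- real N) * real N"
        using C0 by (intro norm_triangle_mono order_trans[OF 1] order_trans[OF 2] mult_left_mono n1 n2) auto
      also have "\<dots> = C * exp \<bar>b\<bar> * (exp (- real N) * (2 * real N + \<bar>b\<bar>))"
        by (simp add: algebra_simps)
      finally show ?case .
    qed
    have "(\<lambda>N. exp (- real N) * (2 * real N + \<bar>b\<bar>)) \<longlonglongrightarrow> 0" by real_asymp
    hence "(\<lambda>N. C * exp \<bar>b\<bar> * (exp (- real N) * (2 * real N + \<bar>b\<bar>))) \<longlonglongrightarrow> C * exp \<bar>b\<bar> * 0"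
      by (intro tendsto_intros)
    thus "(\<lambda>N. C * exp \<bar>b\<bar> * (exp (- real N) * (2 * real N + \<bar>b\<bar>))) \<longlonglongrightarrow> 0" by simp
  qed
  moreover have "(\<lambda>N. (LINT u:{-real N..b}|lborel. f (Complex u (e * \<delta>))) +
       \<i> * of_real e * (LINT v:{\<delta>..real N}|lborel. f (Complex b (e * v)))) \<longlonglongrightarrow>
      (LINT u:{..b}|lborel. f (Complex u (e * \<delta>))) + \<i> * of_real e * (LINT v:{\<delta>..}|lborel. f (Complex b (e * v)))"
    by (intro tendsto_intros set_integral_Icc_to_atMost set_integral_Icc_to_atLeast intu intv)
  ultimately show "(LINT u:{..b}|lborel. f (Complex u (e * \<delta>))) + \<i> * of_real e * (LINT v:{\<delta>..}|lborel. f (Complex b (e * v))) = 0"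
    using LIMSEQ_unique by blast
qed

text \<open>
  Each of the two horizontal rays is exchanged for a vertical half-line by Cauchy's theorem in
  the upper and in the lower quadrant; the segment in between is common to both contours.
\<close>

lemma S'_sigma_integral_eq_S_sigma_integral:
  assumes \<delta>: "\<delta> > 0" and b: "- c < b'"
    and hol: "f holomorphic_on {z. Re z < b' \<and> Im z \<noteq> 0}"
    and cont: "continuous_on UNIV (\<lambda>v. f (Complex (- c) v))"
    and bound: "\<And>u v. u \<le> - c \<Longrightarrow> \<delta> \<le> \<bar>v\<bar> \<Longrightarrow> norm (f (Complex u v)) \<le> C * exp u * exp (- \<bar>v\<bar>)"
  shows "S'_sigma_integral \<delta> c f = S_sigma_integral c f"
proof -
  let ?g = "\<lambda>v. f (Complex (- c) v)"
  have "f holomorphic_on {z. Re z < b' \<and> 0 < 1 * Im z}" "f holomorphic_on {z. Re z < b' \<and> 0 < (- 1) * Im z}"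
    by (rule holomorphic_on_subset[OF hol]; auto)+
  note up = quadrant_boundary_integral[of 1 \<delta> "- c" b' f C, OF _ \<delta> b this(1)]
   and down = quadrant_boundary_integral[of "-1" \<delta> "- c" b' f C, OF _ \<delta> b this(2)]
  have bd: "norm (f (Complex u (e * v))) \<le> C * exp u * exp (- v)" if "u \<le> - c" "\<delta> \<le> v" "e = 1 \<or> e = - 1" for u v e
    using bound[of u "e * v"] that \<delta> by (auto simp: abs_mult)
  have up': "set_integrable lborel {\<delta>..} ?g"
    "(LINT u:{..- c}|lborel. f (Complex u \<delta>)) = - \<i> * (LINT v:{\<delta>..}|lborel. ?g v)"
    using up bd[of _ _ 1] by (simp_all add: eq_neg_iff_add_eq_0)
  have down0: "set_integrable lborel {\<delta>..} (\<lambda>v. ?g (- v))"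
    "(LINT u:{..- c}|lborel. f (Complex u (- \<delta>))) = \<i> * (LINT v:{\<delta>..}|lborel. ?g (- v))"
    using down bd[of _ _ "-1"] by (simp_all)
  have ind: "indicator {\<delta>..} (0 + (- 1) * v) *\<^sub>R ?g (- (0 + (-1) * v)) = indicator {..-\<delta>} v *\<^sub>R ?g v" for v
    by (auto simp: indicator_def)
  have down': "set_integrable lborel {..-\<delta>} ?g"
    using lborel_integrable_real_affine[OF down0(1)[unfolded set_integrable_def], of "-1" 0]
    unfolding ind by (simp add: set_integrable_def)
  have down'': "(LINT u:{..- c}|lborel. f (Complex u (- \<delta>))) = \<i> * (LINT v:{..-\<delta>}|lborel. ?g v)"
  proof -
    have "(LINT v:{\<delta>..}|lborel. ?g (- v)) = (LINT v:{..-\<delta>}|lborel. ?g v)"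
      using lborel_integral_real_affine[of "-1" "\<lambda>v. indicator {\<delta>..} v *\<^sub>R ?g (- v)" 0]
      unfolding ind set_lebesgue_integral_def by simp
    thus ?thesis unfolding down0(2) by simp
  qed
  have mid: "set_integrable lborel {-\<delta>..\<delta>} ?g"
    by (intro borel_integrable_atLeastAtMost' continuous_on_subset[OF cont]) auto
  have mid': "contour_integral (linepath (Complex (- c) (- \<delta>)) (Complex (- c) \<delta>)) f =
      \<i> * (LINT v:{-\<delta>..\<delta>}|lborel. ?g v)"
    using contour_integral_vertical_segment[of "-\<delta>" \<delta> f "-c"] mid \<delta>
    by (simp add: closed_segment_eq_real_ivl)
  have "(LINT v|lborel. ?g v) = (LINT v|lborel. indicator {..-\<delta>} v *\<^sub>R ?g v + indicator {-\<delta>..\<delta>} v *\<^sub>R ?g v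
             + indicator {\<delta>..} v *\<^sub>R ?g v)"
  proof (rule integral_cong_AE)
    have [measurable]: "?g \<in> borel_measurable borel"
      by (intro borel_measurable_continuous_onI cont)
    show "?g \<in> borel_measurable lborel" by simp
    show "(\<lambda>v. indicator {..-\<delta>} v *\<^sub>R ?g v + indicator {-\<delta>..\<delta>} v *\<^sub>R ?g v
             + indicator {\<delta>..} v *\<^sub>R ?g v) \<in> borel_measurable lborel" by measurable
    show "AE v in lborel. ?g v = indicator {..-\<delta>} v *\<^sub>R ?g v + indicator {-\<delta>..\<delta>} v *\<^sub>R ?g v
             + indicator {\<delta>..} v *\<^sub>R ?g v"
      using AE_lborel_singleton[of \<delta>] AE_lborel_singleton[of "-\<delta>"]
      by eventually_elim (use \<delta> in \<open>auto simp: indicator_def\<close>)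
  qed
  also have "\<dots> = (LINT v:{..-\<delta>}|lborel. ?g v) + (LINT v:{-\<delta>..\<delta>}|lborel. ?g v) + (LINT v:{\<delta>..}|lborel. ?g v)"
    using up'(1) down' mid unfolding set_lebesgue_integral_def set_integrable_def by simp
  finally show ?thesis
    unfolding S'_sigma_integral_def S_sigma_integral_def vline_integral_def mid' up'(2) down''
    by (simp add: algebra_simps)
qed

text \<open>
  The decay that allows the \<open>\<sigma>\<close>-contour to be opened. To the left, the functional equation moves
  \<open>\<sigma> + n\<close> back to a strip at the cost of a factor that is only exponential in \<open>- u\<close>, because every factor of the
  Pochhammer symbol has modulus at least \<open>\<delta>\<close>; this and the power of \<open>Y\<close> lose against \<open>1/\<Gamma>(-u)\<close>. Vertically, \<open>r\<close> factors with decay rate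
  \<open>1/8\<close> win against the rate \<open>\<pi>\<close> of \<open>1/\<Gamma>(-\<sigma>)\<close> when \<open>r \<ge> 8 (\<pi> + 1)\<close>.
\<close>

lemma Gamma_power_quotient_bound:
  fixes n r :: nat and Y \<delta> c :: real
  assumes n: "n \<ge> 1" and r: "r \<ge> 40" and Y: "Y > 0" and \<delta>: "\<delta> > 0" and c: "0 < c" "c < 1"
  obtains C where "\<And>u v. u \<le> - c \<Longrightarrow> \<delta> \<le> \<bar>v\<bar> \<Longrightarrow>
     norm (Gamma (Complex u v + of_nat n) ^ r / Gamma (- Complex u v) * of_real Y powr (- Complex u v - 1))
       \<le> C * exp u * exp (- \<bar>v\<bar>)"
proof -
  define d where "d = min \<delta> 1"
  have d: "0 < d" "d \<le> 1" "d \<le> \<delta>" using \<delta> by (auto simp: d_def)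
  define g where "g = (\<lambda>x::real. Gamma x * exp ((2 * x + 2) / 8))"
  have "continuous_on {real n..real n + 1} g"
    unfolding g_def using n by (intro continuous_intros) (auto elim!: nonpos_Ints_cases)
  hence "bounded (g ` {real n..real n + 1})"
    by (intro compact_imp_bounded compact_continuous_image) auto
  then obtain S where S: "\<And>x. x \<in> {real n..real n + 1} \<Longrightarrow> norm (g x) \<le> S" "S > 0"
    unfolding bounded_pos by blast
  have G1: "norm (Gamma (Complex u v + of_nat n)) \<le> (S / d) * (1 / d) powr (- u) * exp (- \<bar>v\<bar> / 8)"
    if uv: "u \<le> - c" "\<delta> \<le> \<bar>v\<bar>" for u v
  proof -
    define k where "k = nat \<lceil>- u\<rceil>"
    have k: "- u \<le> real k" "real k \<le> - u + 1" using uv c unfolding k_def by linarith+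
    define z where "z = Complex u v + of_nat n"
    have "Im z \<noteq> 0" using uv \<delta> by (auto simp: z_def)
    hence z: "z \<notin> \<int>\<^sub>\<le>\<^sub>0" by (auto elim!: nonpos_Ints_cases)
    have P: "pochhammer z k * Gamma z = Gamma (z + of_nat k)"
      using pochhammer_Gamma[OF z, of k] Gamma_nonzero[OF z] by simp
    have "(\<Prod>i\<in>{0..<k}. d) \<le> (\<Prod>i\<in>{0..<k}. norm (z + of_nat i))"
    proof (intro prod_mono conjI)
      fix i
      have "\<bar>v\<bar> \<le> norm (z + of_nat i)" using abs_Im_le_cmod[of "z + of_nat i"] by (simp add: z_def)
      thus "d \<le> norm (z + of_nat i)" using uv d by linarith
    qed (use d in auto)
    hence dk: "d ^ k \<le> norm (pochhammer z k)" by (simp add: pochhammer_prod prod_norm)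
    have zk: "z + of_nat k = Complex (u + real n + real k) v" by (simp add: z_def complex_eq_iff)
    have "norm (Gamma (z + of_nat k)) \<le> g (u + real n + real k) * exp (- \<bar>v\<bar> / 8)"
      unfolding zk g_def using k n by (intro norm_Gamma_vertical_decay') auto
    also have "\<dots> \<le> S * exp (- \<bar>v\<bar> / 8)"
      using S(1)[of "u + real n + real k"] k by (intro mult_right_mono) auto
    finally have "norm (pochhammer z k) * norm (Gamma z) \<le> S * exp (- \<bar>v\<bar> / 8)"
      unfolding P[symmetric] norm_mult .
    moreover have "d ^ k * norm (Gamma z) \<le> norm (pochhammer z k) * norm (Gamma z)"
      using dk by (intro mult_right_mono) auto
    ultimately have "d ^ k * norm (Gamma z) \<le> S * exp (- \<bar>v\<bar> / 8)" by linarith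
    hence "norm (Gamma z) \<le> (1 / d) ^ k * (S * exp (- \<bar>v\<bar> / 8))"
      using d by (simp add: field_simps)
    also have "(1 / d) ^ k = (1 / d) powr real k" using d by (simp add: powr_realpow)
    also have "(1 / d) powr real k \<le> (1 / d) powr (- u + 1)"
      using d k by (intro powr_mono) auto
    also have "(1 / d) powr (- u + 1) = (1 / d) powr (- u) * (1 / d)"
      using d by (simp add: powr_diff powr_minus_divide)
    finally show ?thesis using S(2) by (simp add: z_def mult_ac)
  qed
  define K where "K = exp 1 * (1 / d) ^ r * Y"
  have K: "K > 0" using d Y by (simp add: K_def)
  obtain C3 where C3: "C3 > 0" "\<And>u. u > 0 \<Longrightarrow> K powr u \<le> C3 * Gamma u"
    using powr_le_Gamma[OF K] by blast
  define C1 where "C1 = Gamma c * (Gamma (1 - c) / pi)"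
  have C1: "C1 \<ge> 0" using c by (auto simp: C1_def)
  show ?thesis
  proof (rule that[of "C1 * C3 * (S / d) ^ r / Y"])
    fix u v :: real assume uv: "u \<le> - c" "\<delta> \<le> \<bar>v\<bar>"
    define p where "p = - u"
    have p: "p \<ge> c" "p > 0" using uv c by (auto simp: p_def)
    have E: "exp p * ((1 / d) ^ r) powr p * Y powr p = K powr p"
      using d Y by (simp add: K_def powr_mult powr_def[of "exp 1"])
    have A: "norm (1 / Gamma (- Complex u v)) \<le> C1 * exp (pi * \<bar>v\<bar>) / Gamma p"
    proof -
      have nz: "norm (Gamma (Complex w (- v))) > 0" if "w > 0" for w
      proof -
        have "Complex w (- v) \<notin> \<int>\<^sub>\<le>\<^sub>0"
          using that by (auto elim!: nonpos_Ints_cases simp: complex_eq_iff)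
        thus ?thesis by (simp add: Gamma_eq_zero_iff)
      qed
      have Gp: "Gamma p > 0" using p by simp
      have "1 / norm (Gamma (Complex p (- v))) \<le> Gamma c * (1 / norm (Gamma (Complex c (- v)))) / Gamma p"
        using Gamma_quotient_antimono[OF c(1) p(1), of "- v"] nz[of p] nz[of c] p c Gp
        by (simp add: field_simps)
      also have "\<dots> \<le> Gamma c * (Gamma (1 - c) / pi * exp (pi * \<bar>- v\<bar>)) / Gamma p"
        using c p by (intro divide_right_mono mult_left_mono inverse_Gamma_vertical_bound) auto
      finally have "1 / norm (Gamma (Complex p (- v))) \<le> Gamma c * (Gamma (1 - c) / pi * exp (pi * \<bar>- v\<bar>)) / Gamma p" .
      moreover have "- Complex u v = Complex p (- v)" by (simp add: p_def complex_eq_iff)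
      ultimately show ?thesis by (simp add: norm_divide C1_def mult_ac)
    qed
    have Yp: "norm (of_real Y powr (- Complex u v - 1)) = Y powr p / Y"
    proof -
      have "norm (of_real Y powr z :: complex) = Y powr Re z" for z
        using Y by (simp add: norm_powr_real_powr)
      hence "norm (of_real Y powr (- Complex u v - 1)) = Y powr (p - 1)" by (simp add: p_def)
      also have "\<dots> = Y powr p / Y" using Y by (simp add: powr_diff)
      finally show ?thesis .
    qed
    have "norm (Gamma (Complex u v + of_nat n) ^ r / Gamma (- Complex u v) * of_real Y powr (- Complex u v - 1))
        = norm (Gamma (Complex u v + of_nat n)) ^ r * norm (1 / Gamma (- Complex u v)) * (Y powr p / Y)"
      unfolding Yp[symmetric] by (simp add: norm_mult norm_divide norm_power)
    also have "\<dots> \<le> ((S / d) * (1 / d) powr p * exp (- \<bar>v\<bar> / 8)) ^ r * (C1 * exp (pi * \<bar>v\<bar>) / Gamma p) * (Y powr p / Y)"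
      using G1[OF uv] A Y C1 p S d unfolding p_def[symmetric]
      by (intro mult_mono power_mono mult_nonneg_nonneg) auto
    also have "\<dots> = (C1 * (S / d) ^ r / Y) * (((1 / d) powr p) ^ r * Y powr p / Gamma p) * 
          (exp (- \<bar>v\<bar> / 8) ^ r * exp (pi * \<bar>v\<bar>))"
      by (simp add: power_mult_distrib field_simps)
    also have "((1 / d) powr p) ^ r = ((1 / d) ^ r) powr p"
      using d by (simp add: powr_realpow[symmetric] powr_powr mult_ac)
    also have "(C1 * (S / d) ^ r / Y) * (((1 / d) ^ r) powr p * Y powr p / Gamma p) * 
          (exp (- \<bar>v\<bar> / 8) ^ r * exp (pi * \<bar>v\<bar>)) \<le> (C1 * (S / d) ^ r / Y) * (C3 * exp (- p)) * exp (- \<bar>v\<bar>)"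
    proof (intro mult_mono)
      have "K powr p / exp p \<le> C3 * Gamma p / exp p" using C3(2)[OF p(2)] by (intro divide_right_mono) auto
      thus "((1 / d) ^ r) powr p * Y powr p / Gamma p \<le> C3 * exp (- p)"
        unfolding E[symmetric] using p(2) by (simp add: field_simps exp_minus)
      have "exp (- \<bar>v\<bar> / 8) ^ r * exp (pi * \<bar>v\<bar>) = exp (- (real r / 8 - pi) * \<bar>v\<bar>)"
        by (simp add: algebra_simps flip: exp_of_nat_mult exp_add)
      also have "\<dots> \<le> exp (- 1 * \<bar>v\<bar>)"
      proof -
        have "1 \<le> real r / 8 - pi" using r pi_less_4 by linarith
        hence "1 * \<bar>v\<bar> \<le> (real r / 8 - pi) * \<bar>v\<bar>" by (intro mult_right_mono) auto
        thus ?thesis by (simp only: exp_le_cancel_iff mult_minus_left neg_le_iff_le)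
      qed
      finally show "exp (- \<bar>v\<bar> / 8) ^ r * exp (pi * \<bar>v\<bar>) \<le> exp (- \<bar>v\<bar>)" by simp
    qed (use C1 C3 S d Y p in auto)
    finally show "norm (Gamma (Complex u v + of_nat n) ^ r / Gamma (- Complex u v) * of_real Y powr (- Complex u v - 1))
       \<le> C1 * C3 * (S / d) ^ r / Y * exp u * exp (- \<bar>v\<bar>)"
      by (simp add: p_def mult_ac)
  qed
qed

lemma Gamma_power_vline_shift:
  fixes b z :: real
  assumes p: "p \<ge> 8" and z: "z > 0" and a: "a > - b" "a' > - b"
  shows "vline_integral a (\<lambda>\<eta>. Gamma (of_real b + \<eta>) ^ p * of_real z powr (- \<eta>)) =
         vline_integral a' (\<lambda>\<eta>. Gamma (of_real b + \<eta>) ^ p * of_real z powr (- \<eta>))"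
proof -
  let ?f = "\<lambda>\<eta>. Gamma (of_real b + \<eta>) ^ p * of_real z powr (- \<eta>) :: complex"
  have main: "vline_integral x ?f = vline_integral y ?f" if xy: "- b < x" "x \<le> y" for x y
  proof -
    define g where "g = (\<lambda>u::real. (Gamma (b + u) * exp ((2 * (b + u) + 2) / 8)) ^ p * z powr (- u))"
    have "continuous_on {x..y} g"
      unfolding g_def using xy z
      by (intro continuous_intros continuous_on_compose2[OF continuous_on_Gamma[of "{0<..}"]])
         (auto elim!: nonpos_Ints_cases)
    hence "bounded (g ` {x..y})"
      by (intro compact_imp_bounded compact_continuous_image) auto
    then obtain S where S: "\<And>u. u \<in> {x..y} \<Longrightarrow> norm (g u) \<le> S" "S > 0"
      unfolding bounded_pos by blast
    show ?thesis
    proof (rule vline_integral_shift)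
      show "?f holomorphic_on {z. Re z > - b}"
        using z by (intro holomorphic_intros) (auto elim!: nonpos_Ints_cases simp: complex_eq_iff)
      fix u v assume u: "x \<le> u" "u \<le> y"
      have bu: "b + u > 0" using u xy by simp
      have "of_real b + Complex u v = Complex (b + u) v" by (simp add: complex_eq_iff)
      hence "norm (?f (Complex u v)) = norm (Gamma (Complex (b + u) v)) ^ p * z powr (- u)"
        using z by (simp add: norm_mult norm_power norm_powr_real_powr)
      also have "\<dots> \<le> (Gamma (b + u) * exp ((2 * (b + u) + 2) / 8) * exp (- \<bar>v\<bar> / 8)) ^ p * z powr (- u)"
        using bu by (intro mult_right_mono power_mono norm_Gamma_vertical_decay') auto
      also have "\<dots> = g u * exp (- \<bar>v\<bar> / 8) ^ p"
        by (simp add: g_def power_mult_distrib mult_ac)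
      also have "\<dots> \<le> S * exp (- \<bar>v\<bar>)"
      proof (intro mult_mono)
        show "g u \<le> S" using S(1)[of u] u by simp
        have "8 * \<bar>v\<bar> \<le> real p * \<bar>v\<bar>" using p by (intro mult_right_mono) auto
        thus "exp (- \<bar>v\<bar> / 8) ^ p \<le> exp (- \<bar>v\<bar>)" by (simp flip: exp_of_nat_mult)
      qed (use S in auto)
      finally show "norm (?f (Complex u v)) \<le> S * exp (- \<bar>v\<bar>)" .
    qed (use xy in auto)
  qed
  show ?thesis
  proof (cases "a \<le> a'")
    case True
    thus ?thesis using main[of a a'] a by blast
  next
    case False
    hence "a' \<le> a" by simp
    from main[OF a(2) this] show ?thesis by (rule sym)
  qed
qed

section \<open>Convergence of the factors along the contours\<close>

lemma L1_convergence_of_exp_bounded: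
  fixes f :: "nat \<Rightarrow> real \<Rightarrow> complex"
  assumes meas: "\<forall>\<^sub>F n in sequentially. f n \<in> borel_measurable borel"
    and g: "g \<in> borel_measurable borel"
    and bound: "\<forall>\<^sub>F n in sequentially. \<forall>s. norm (f n s) \<le> C * exp (- \<bar>s\<bar>)"
    and lim: "\<And>s. (\<lambda>n. f n s) \<longlonglongrightarrow> g s"
  shows "integrable lborel g" "\<forall>\<^sub>F n in sequentially. integrable lborel (f n)"
    "(\<lambda>n. LINT s|lborel. norm (f n s - g s)) \<longlonglongrightarrow> 0"
proof -
  have gb: "norm (g s) \<le> C * exp (- \<bar>s\<bar>)" for s
  proof (rule tendsto_upperbound[OF tendsto_norm[OF lim]])
    show "\<forall>\<^sub>F n in sequentially. norm (f n s) \<le> C * exp (- \<bar>s\<bar>)"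
      using bound by eventually_elim auto
  qed simp
  show intg: "integrable lborel g" by (rule integrable_if_exp_bounded[OF g gb])
  show intf: "\<forall>\<^sub>F n in sequentially. integrable lborel (f n)"
    using meas bound by eventually_elim (rule integrable_if_exp_bounded, auto)
  from meas bound have "\<forall>\<^sub>F n in sequentially. f n \<in> borel_measurable borel \<and> (\<forall>s. norm (f n s) \<le> C * exp (- \<bar>s\<bar>))"
    by eventually_elim auto
  then obtain N where N: "\<And>n. n \<ge> N \<Longrightarrow> f n \<in> borel_measurable borel"
     "\<And>n s. n \<ge> N \<Longrightarrow> norm (f n s) \<le> C * exp (- \<bar>s\<bar>)"
    unfolding eventually_sequentially by blast
  have "(\<lambda>n. LINT s|lborel. norm (f (n + N) s - g s)) \<longlonglongrightarrow> integral\<^sup>L lborel (\<lambda>_::real. 0::real)"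
  proof (rule Bochner_Integration.integral_dominated_convergence[where w = "\<lambda>s. 2 * (C * exp (- \<bar>s\<bar>))"
        and s = "\<lambda>n s. norm (f (n + N) s - g s)" and f = "\<lambda>_. 0" and M = lborel])
    show "(\<lambda>s. norm (f (n + N) s - g s)) \<in> borel_measurable lborel" for n
      using N(1)[of "n + N"] g by auto
    show "integrable lborel (\<lambda>s. 2 * (C * exp (- \<bar>s\<bar>)))"
      using integrable_exp_neg_abs by simp
    have "(\<lambda>n. norm (f (n + N) s - g s)) \<longlonglongrightarrow> norm (g s - g s)" for s
      by (intro tendsto_intros LIMSEQ_ignore_initial_segment lim)
    thus "AE s in lborel. (\<lambda>n. norm (f (n + N) s - g s)) \<longlonglongrightarrow> 0" by simp
    show "AE s in lborel. norm (norm (f (n + N) s - g s)) \<le> 2 * (C * exp (- \<bar>s\<bar>))" for n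
    proof (rule AE_I2)
      fix s
      have "norm (f (n + N) s - g s) \<le> norm (f (n + N) s) + norm (g s)" by (rule norm_triangle_ineq4)
      also have "\<dots> \<le> 2 * (C * exp (- \<bar>s\<bar>))" using N(2)[of "n + N" s] gb[of s] by simp
      finally show "norm (norm (f (n + N) s - g s)) \<le> 2 * (C * exp (- \<bar>s\<bar>))" by simp
    qed
  qed auto
  hence "(\<lambda>n. LINT s|lborel. norm (f (n + N) s - g s)) \<longlonglongrightarrow> 0" by simp
  thus "(\<lambda>n. LINT s|lborel. norm (f n s - g s)) \<longlonglongrightarrow> 0"
    by (rule LIMSEQ_offset)
qed

lemma normalized_Gamma_power_eq:
  assumes "n > 0"
  shows "Gamma (z + of_nat n) ^ k =
     normalized_Gamma n z ^ k * of_real (Gamma (real n)) ^ k * exp (of_nat k * (z * of_real (critical_exponent n)))"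
proof -
  have "Gamma (real n) > 0" using assms by simp
  hence "Gamma (z + of_nat n) =
     normalized_Gamma n z * of_real (Gamma (real n)) * exp (z * of_real (critical_exponent n))"
    by (simp add: normalized_Gamma_def exp_minus)
  thus ?thesis by (simp add: power_mult_distrib exp_of_nat_mult)
qed

lemma not_nonpos_Int_if_Re_pos: "Re z > 0 \<Longrightarrow> z \<notin> \<int>\<^sub>\<le>\<^sub>0"
  by (auto elim!: nonpos_Ints_cases)

lemma continuous_on_normalized_Gamma:
  assumes "n > 0" and f: "continuous_on A f" and "\<And>x. x \<in> A \<Longrightarrow> Re (f x) > - real n"
  shows "continuous_on A (\<lambda>x. normalized_Gamma n (f x))"
proof -
  have "Gamma (real n) > 0" using assms by simp
  have "continuous_on A (\<lambda>x. Gamma (f x + of_nat n))"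
    by (rule continuous_on_compose2[OF continuous_on_Gamma[of "{z. Re z > 0}"]])
       (use assms not_nonpos_Int_if_Re_pos in \<open>force intro!: continuous_intros\<close>)+
  thus ?thesis unfolding normalized_Gamma_def using f \<open>Gamma (real n) > 0\<close>
    by (intro continuous_intros) auto
qed

lemma normalized_Gamma_nonzero:
  assumes "n > 0" "Re z > - real n"
  shows "normalized_Gamma n z \<noteq> 0"
proof -
  have "Gamma (real n) > 0" using assms by simp
  moreover have "Gamma (z + of_nat n) \<noteq> 0"
    using assms not_nonpos_Int_if_Re_pos[of "z + of_nat n"] by (auto simp: Gamma_eq_zero_iff)
  ultimately show ?thesis by (simp add: normalized_Gamma_def)
qed

lemma minus_zeta_path_not_nonpos_Int:
  assumes "\<delta> > 0" "0 < c'" "c' < 1"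
  shows "- zeta_path \<delta> c' s \<notin> \<int>\<^sub>\<le>\<^sub>0"
proof
  assume "- zeta_path \<delta> c' s \<in> \<int>\<^sub>\<le>\<^sub>0"
  then obtain m where m: "- zeta_path \<delta> c' s = of_int m" "m \<le> 0" by (elim nonpos_Ints_cases)
  have "Im (zeta_path \<delta> c' s) = 0" using arg_cong[OF m(1), of Im] by simp
  hence "s = 0" using assms by (auto simp: Im_zeta_path max_def min_def split: if_splits)
  hence "c' = of_int m" using arg_cong[OF m(1), of Re] assms by (simp add: Re_zeta_path)
  thus False using assms m(2) by simp
qed

lemma continuous_on_Gamma_minus_zeta_path:
  assumes "\<delta> > 0" "0 < c'" "c' < 1"
  shows "continuous_on UNIV (\<lambda>s. Gamma (- zeta_path \<delta> c' s))"
  by (rule continuous_on_compose2[OF continuous_on_Gamma[of "- \<int>\<^sub>\<le>\<^sub>0"]])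
     (use minus_zeta_path_not_nonpos_Int[OF assms] in \<open>auto intro!: continuous_intros continuous_on_zeta_path\<close>)

text \<open>
  On the rays, reflection turns \<open>\<bar>\<Gamma>(-\<zeta>)\<bar>\<close> into \<open>\<pi> / (\<bar>sin (\<pi>\<zeta>)\<bar> \<bar>\<Gamma>(1 + \<zeta>)\<bar>)\<close>. The sine stays above \<open>sinh (\<pi>\<delta>)\<close>
  and \<open>1/\<Gamma>\<close> decays faster than any exponential, so the factor \<open>exp \<bar>Re \<zeta>\<bar>\<close>, needed to absorb
  the bound on the powers of the normalized Gamma function, is affordable.
\<close>

lemma Gamma_minus_zeta_path_decay:
  assumes \<delta>: "\<delta> > 0" and c': "0 < c'" "c' < 1"
  obtains C where "\<And>s. norm (Gamma (- zeta_path \<delta> c' s)) * exp \<bar>Re (zeta_path \<delta> c' s)\<bar> \<le> C * exp (- \<bar>s\<bar>)"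
proof -
  obtain C0 where C0: "C0 > 0" "\<And>u::real. u > 0 \<Longrightarrow> exp 2 powr u \<le> C0 * Gamma u"
    using powr_le_Gamma[of "exp 2"] by auto
  define N where "N = norm (Gamma (Complex (1 - c') \<delta>))"
  have N: "N > 0" using not_nonpos_Int_if_Re_pos[of "Complex (1 - c') \<delta>"] c'
    by (simp add: N_def Gamma_eq_zero_iff)
  define S where "S = sinh (pi * \<delta>)"
  have S: "S > 0" using \<delta> by (simp add: S_def)
  define C1 where "C1 = pi / S * (Gamma (1 - c') / N) * C0 * exp (\<delta> + 3 * c')"
  have G1: "Gamma (1 - c') > 0" using c' by simp
  have C1: "C1 \<ge> 0" using S N C0 G1 by (simp add: C1_def)
  define C2 where "C2 = Gamma c' * exp (c' + \<delta>)"
  show ?thesis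
  proof (rule that[of "C1 + C2"])
    fix s
    define \<zeta> where "\<zeta> = zeta_path \<delta> c' s"
    show "norm (Gamma (- \<zeta>)) * exp \<bar>Re \<zeta>\<bar> \<le> (C1 + C2) * exp (- \<bar>s\<bar>)"
    proof (cases "\<bar>s\<bar> \<le> \<delta>")
      case True
      hence \<zeta>: "- \<zeta> = Complex c' (- s)" "\<bar>Re \<zeta>\<bar> = c'" using c'
        by (auto simp: \<zeta>_def zeta_path_def complex_eq_iff)
      have "norm (Gamma (- \<zeta>)) * exp \<bar>Re \<zeta>\<bar> \<le> Gamma c' * exp c'"
        unfolding \<zeta> using c' by (intro mult_right_mono norm_Gamma_le_Gamma_Re) auto
      also have "\<dots> \<le> Gamma c' * exp (c' + \<delta> + - \<bar>s\<bar>)" using True c' by (intro mult_left_mono) auto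
      also have "\<dots> = C2 * exp (- \<bar>s\<bar>)" unfolding exp_add C2_def by simp
      also have "\<dots> \<le> (C1 + C2) * exp (- \<bar>s\<bar>)" using C1 by (intro mult_right_mono) auto
      finally show ?thesis .
    next
      case False
      define u where "u = \<bar>s\<bar> - \<delta> - c'"
      have Re: "Re \<zeta> = u" using False by (simp add: \<zeta>_def zeta_path_def u_def)
      have Im: "Im \<zeta> = \<delta> \<or> Im \<zeta> = - \<delta>" using False \<delta> by (auto simp: \<zeta>_def zeta_path_def)
      hence aIm: "\<bar>Im \<zeta>\<bar> = \<delta>" using \<delta> by auto
      have u: "u \<ge> - c'" using False by (simp add: u_def)
      have Gu: "Gamma (1 + u) > 0" using u c' by simp
      have pos: "norm (Gamma (1 + \<zeta>)) > 0"
        using not_nonpos_Int_if_Re_pos[of "1 + \<zeta>"] u c' Re by (simp add: Gamma_eq_zero_iff)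
      have "S \<le> norm (sin (of_real pi * (- \<zeta>)))"
        using norm_sin_ge_sinh[of "of_real pi * (- \<zeta>)"] aIm by (simp add: S_def abs_mult)
      have refl: "Gamma (- \<zeta>) * Gamma (1 + \<zeta>) = of_real pi / sin (of_real pi * (- \<zeta>))"
        using Gamma_reflection_complex[of "- \<zeta>"] by simp
      have "norm (Gamma (- \<zeta>)) * norm (Gamma (1 + \<zeta>)) = pi / norm (sin (of_real pi * (- \<zeta>)))"
        unfolding norm_mult[symmetric] refl by (simp add: norm_divide)
      also have "\<dots> \<le> pi / S"
        using \<open>S \<le> _\<close> S by (intro divide_left_mono mult_pos_pos) auto
      finally have "norm (Gamma (- \<zeta>)) \<le> pi / S / norm (Gamma (1 + \<zeta>))"
        unfolding pos_le_divide_eq[OF pos] .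
      hence 1: "norm (Gamma (- \<zeta>)) \<le> pi / S * (1 / norm (Gamma (1 + \<zeta>)))" by simp
      have "Gamma (1 + u) * N \<le> Gamma (1 - c') * norm (Gamma (Complex (1 + u) \<delta>))"
        unfolding N_def using u c' by (intro Gamma_quotient_antimono) auto
      also have "\<dots> \<le> Gamma (1 - c') * norm (Gamma (Complex (1 + u) (Im \<zeta>)))"
        using u c' G1 aIm by (intro mult_left_mono norm_Gamma_antimono_Im) auto
      also have "Complex (1 + u) (Im \<zeta>) = 1 + \<zeta>" using Re by (simp add: complex_eq_iff)
      finally have 2: "1 / norm (Gamma (1 + \<zeta>)) \<le> Gamma (1 - c') / N * (1 / Gamma (1 + u))"
        using pos N Gu by (simp add: field_simps)
      have "1 = exp (- 2 * (1 + u)) * exp 2 powr (1 + u)"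
        by (simp add: powr_def flip: exp_add)
      also have "\<dots> \<le> exp (- 2 * (1 + u)) * (C0 * Gamma (1 + u))"
        using u c' by (intro mult_left_mono C0) auto
      finally have "1 \<le> (C0 * exp (- 2 * (1 + u))) * Gamma (1 + u)"
        by (simp only: mult_ac)
      hence 3: "1 / Gamma (1 + u) \<le> C0 * exp (- 2 * (1 + u))"
        unfolding pos_divide_le_eq[OF Gu] .
      have "norm (Gamma (- \<zeta>)) * exp \<bar>Re \<zeta>\<bar> \<le> (pi / S * (Gamma (1 - c') / N * (C0 * exp (- 2 * (1 + u))))) * exp \<bar>u\<bar>"
        unfolding Re using S N G1 C0
        by (intro mult_right_mono order_trans[OF 1] mult_left_mono order_trans[OF 2] 3) auto
      also have "\<dots> = pi / S * (Gamma (1 - c') / N) * C0 * exp (- 2 * (1 + u) + \<bar>u\<bar>)"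
        by (simp add: exp_add)
      also have "\<dots> \<le> pi / S * (Gamma (1 - c') / N) * C0 * exp (\<delta> + 3 * c' + - \<bar>s\<bar>)"
      proof (intro mult_left_mono)
        have "- 2 * (1 + u) + \<bar>u\<bar> \<le> \<delta> + 3 * c' + - \<bar>s\<bar>" using u c' unfolding u_def by auto
        thus "exp (- 2 * (1 + u) + \<bar>u\<bar>) \<le> exp (\<delta> + 3 * c' + - \<bar>s\<bar>)" by simp
      qed (use S N G1 C0 in auto)
      also have "\<dots> = C1 * exp (- \<bar>s\<bar>)" unfolding C1_def exp_add by simp
      also have "\<dots> \<le> (C1 + C2) * exp (- \<bar>s\<bar>)" using c' by (intro mult_right_mono) (auto simp: C2_def)
      finally show ?thesis .
    qed
  qed
qed

lemma zeta_factor_L1_convergence: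
  fixes k :: "nat \<Rightarrow> nat"
  assumes k: "(\<lambda>n. real (k n) / real n) \<longlonglongrightarrow> T" and \<delta>: "\<delta> > 0" and c': "0 < c'" "c' < 1"
  defines "f \<equiv> (\<lambda>n s. Gamma (- zeta_path \<delta> c' s) / normalized_Gamma n (zeta_path \<delta> c' s) ^ k n)"
    and "g \<equiv> (\<lambda>s. Gamma (- zeta_path \<delta> c' s) / exp (of_real T * (zeta_path \<delta> c' s)\<^sup>2 / 2))"
  shows "integrable lborel g" "\<forall>\<^sub>F n in sequentially. integrable lborel (f n)"
    "(\<lambda>n. LINT s|lborel. norm (f n s - g s)) \<longlonglongrightarrow> 0"
proof -
  let ?Z = "zeta_path \<delta> c'"
  obtain C1 where C1: "\<And>s. norm (Gamma (- ?Z s)) * exp \<bar>Re (?Z s)\<bar> \<le> C1 * exp (- \<bar>s\<bar>)"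
    using Gamma_minus_zeta_path_decay[OF \<delta> c'] by blast
  obtain C2 where C2: "\<forall>\<^sub>F n in sequentially. \<forall>u v. - c' \<le> u \<and> \<bar>v\<bar> \<le> \<delta> \<longrightarrow>
     norm (1 / normalized_Gamma n (Complex u v) ^ k n) \<le> C2 * exp \<bar>u\<bar>"
    using inverse_normalized_Gamma_power_bound[OF k c'] by blast
  have bound: "\<forall>\<^sub>F n in sequentially. \<forall>s. norm (f n s) \<le> (max C2 0 * C1) * exp (- \<bar>s\<bar>)"
    using C2
  proof eventually_elim
    case (elim n)
    show ?case
    proof
      fix s
      have "norm (1 / normalized_Gamma n (Complex (Re (?Z s)) (Im (?Z s))) ^ k n) \<le> C2 * exp \<bar>Re (?Z s)\<bar>"
        by (rule elim[rule_format]) (use \<delta> in \<open>auto simp: Re_zeta_path Im_zeta_path\<close>)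
      also have "\<dots> \<le> max C2 0 * exp \<bar>Re (?Z s)\<bar>" by (intro mult_right_mono) auto
      finally have "norm (1 / normalized_Gamma n (?Z s) ^ k n) \<le> max C2 0 * exp \<bar>Re (?Z s)\<bar>" by simp
      hence "norm (Gamma (- ?Z s)) * norm (1 / normalized_Gamma n (?Z s) ^ k n) \<le>
             norm (Gamma (- ?Z s)) * (max C2 0 * exp \<bar>Re (?Z s)\<bar>)"
        by (rule mult_left_mono) auto
      also have "\<dots> = max C2 0 * (norm (Gamma (- ?Z s)) * exp \<bar>Re (?Z s)\<bar>)" by simp
      also have "\<dots> \<le> max C2 0 * (C1 * exp (- \<bar>s\<bar>))" by (intro mult_left_mono C1) auto
      finally show "norm (f n s) \<le> (max C2 0 * C1) * exp (- \<bar>s\<bar>)"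
        by (simp add: f_def norm_divide)
    qed
  qed
  have meas: "\<forall>\<^sub>F n in sequentially. f n \<in> borel_measurable borel"
    using eventually_gt_at_top[of 0]
  proof eventually_elim
    case (elim n)
    have Re: "Re (?Z s) > - real n" for s using c' elim by (auto simp: Re_zeta_path max_def)
    show ?case unfolding f_def
      using normalized_Gamma_nonzero[OF elim Re]
      by (intro borel_measurable_continuous_onI continuous_on_divide continuous_on_power
            continuous_on_normalized_Gamma continuous_on_Gamma_minus_zeta_path continuous_on_zeta_path elim Re assms) auto
  qed
  have g: "g \<in> borel_measurable borel"
    unfolding g_def
    by (intro borel_measurable_continuous_onI continuous_intros
            continuous_on_Gamma_minus_zeta_path continuous_on_zeta_path assms) auto
  have lim: "(\<lambda>n. f n s) \<longlonglongrightarrow> g s" for s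
    unfolding f_def g_def by (intro tendsto_intros tendsto_normalized_Gamma_power k) auto
  show "integrable lborel g" "\<forall>\<^sub>F n in sequentially. integrable lborel (f n)"
    "(\<lambda>n. LINT s|lborel. norm (f n s - g s)) \<longlonglongrightarrow> 0"
    using L1_convergence_of_exp_bounded[OF meas g bound lim] by auto
qed

lemma sigma_factor_L1_convergence:
  fixes k :: "nat \<Rightarrow> nat"
  assumes k: "(\<lambda>n. real (k n) / real n) \<longlonglongrightarrow> T" and T: "T > 0" and c: "0 < c" "c < 1"
  defines "f \<equiv> (\<lambda>n s. normalized_Gamma n (Complex (- c) s) ^ k n / Gamma (- Complex (- c) s))"
    and "g \<equiv> (\<lambda>s. exp (of_real T * (Complex (- c) s)\<^sup>2 / 2) / Gamma (- Complex (- c) s))"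
  shows "integrable lborel g" "\<forall>\<^sub>F n in sequentially. integrable lborel (f n)"
    "(\<lambda>n. LINT s|lborel. norm (f n s - g s)) \<longlonglongrightarrow> 0"
proof -
  have eq: "- Complex (- c) s = Complex c (- s)" for s by (simp add: complex_eq_iff)
  have nz: "Gamma (- Complex (- c) s) \<noteq> 0" for s
    using not_nonpos_Int_if_Re_pos[of "- Complex (- c) s"] c by (simp add: Gamma_eq_zero_iff)
  obtain C where C: "\<forall>\<^sub>F n in sequentially. \<forall>v. norm (normalized_Gamma n (Complex (- c) v) ^ k n) \<le> C * exp (- 5 * \<bar>v\<bar>)"
    using normalized_Gamma_power_decay[OF k T] by blast
  have bound: "\<forall>\<^sub>F n in sequentially. \<forall>s. norm (f n s) \<le> (max C 0 * (Gamma (1 - c) / pi)) * exp (- \<bar>s\<bar>)"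
    using C
  proof eventually_elim
    case (elim n)
    show ?case
    proof
      fix s
      have "norm (normalized_Gamma n (Complex (- c) s) ^ k n) \<le> C * exp (- 5 * \<bar>s\<bar>)" using elim by blast
      also have "\<dots> \<le> max C 0 * exp (- 5 * \<bar>s\<bar>)" by (intro mult_right_mono) auto
      finally have 1: "norm (normalized_Gamma n (Complex (- c) s) ^ k n) \<le> max C 0 * exp (- 5 * \<bar>s\<bar>)" .
      have 2: "1 / norm (Gamma (Complex c (- s))) \<le> Gamma (1 - c) / pi * exp (pi * \<bar>s\<bar>)"
        using inverse_Gamma_vertical_bound[OF c, of "- s"] by simp
      have "norm (f n s) = norm (normalized_Gamma n (Complex (- c) s) ^ k n) * (1 / norm (Gamma (Complex c (- s))))"
        unfolding f_def eq by (simp add: norm_divide)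
      also have "\<dots> \<le> (max C 0 * exp (- 5 * \<bar>s\<bar>)) * (Gamma (1 - c) / pi * exp (pi * \<bar>s\<bar>))"
        by (intro mult_mono 1 2) auto
      also have "\<dots> = (max C 0 * (Gamma (1 - c) / pi)) * exp (- 5 * \<bar>s\<bar> + pi * \<bar>s\<bar>)"
        unfolding exp_add by simp
      also have "\<dots> \<le> (max C 0 * (Gamma (1 - c) / pi)) * exp (- \<bar>s\<bar>)"
      proof (intro mult_left_mono)
        have "pi * \<bar>s\<bar> \<le> 4 * \<bar>s\<bar>" using pi_less_4 by (intro mult_right_mono) auto
        thus "exp (- 5 * \<bar>s\<bar> + pi * \<bar>s\<bar>) \<le> exp (- \<bar>s\<bar>)" by simp
      qed (use c in auto)
      finally show "norm (f n s) \<le> (max C 0 * (Gamma (1 - c) / pi)) * exp (- \<bar>s\<bar>)" .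
    qed
  qed
  have line: "continuous_on UNIV (Complex (- c))"
    unfolding Complex_eq by (intro continuous_intros)
  have cG: "continuous_on UNIV (\<lambda>s. Gamma (- Complex (- c) s))"
    by (rule continuous_on_compose2[OF continuous_on_Gamma[of "{z. Re z > 0}"]])
       (use c not_nonpos_Int_if_Re_pos in \<open>force intro!: continuous_intros line\<close>)+
  have meas: "\<forall>\<^sub>F n in sequentially. f n \<in> borel_measurable borel"
    using eventually_gt_at_top[of 0]
  proof eventually_elim
    case (elim n)
    show ?case unfolding f_def using nz c elim
      by (intro borel_measurable_continuous_onI continuous_on_divide continuous_on_power
            continuous_on_normalized_Gamma cG line) auto
  qed
  have g: "g \<in> borel_measurable borel"
    unfolding g_def using nz
    by (intro borel_measurable_continuous_onI continuous_intros cG line) auto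
  have lim: "(\<lambda>n. f n s) \<longlonglongrightarrow> g s" for s
    unfolding f_def g_def by (intro tendsto_intros tendsto_normalized_Gamma_power k nz)
  show "integrable lborel g" "\<forall>\<^sub>F n in sequentially. integrable lborel (f n)"
    "(\<lambda>n. LINT s|lborel. norm (f n s - g s)) \<longlonglongrightarrow> 0"
    using L1_convergence_of_exp_bounded[OF meas g bound lim] by auto
qed

lemma imaginary_axis_L1_convergence:
  fixes k :: "nat \<Rightarrow> nat"
  assumes k: "(\<lambda>n. real (k n) / real n) \<longlonglongrightarrow> T" and T: "T > 0"
  defines "f \<equiv> (\<lambda>n v. normalized_Gamma n (Complex 0 v) ^ k n)"
    and "g \<equiv> (\<lambda>v. exp (of_real T * (Complex 0 v)\<^sup>2 / 2))"
  shows "integrable lborel g" "\<forall>\<^sub>F n in sequentially. integrable lborel (f n)"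
    "(\<lambda>n. LINT s|lborel. norm (f n s - g s)) \<longlonglongrightarrow> 0"
proof -
  obtain C where C: "\<forall>\<^sub>F n in sequentially. \<forall>v. norm (normalized_Gamma n (Complex 0 v) ^ k n) \<le> C * exp (- 5 * \<bar>v\<bar>)"
    using normalized_Gamma_power_decay[OF k T] by blast
  have bound: "\<forall>\<^sub>F n in sequentially. \<forall>s. norm (f n s) \<le> max C 0 * exp (- \<bar>s\<bar>)"
    using C
  proof eventually_elim
    case (elim n)
    show ?case
    proof
      fix s
      have "norm (f n s) \<le> C * exp (- 5 * \<bar>s\<bar>)" using elim by (simp add: f_def)
      also have "\<dots> \<le> max C 0 * exp (- \<bar>s\<bar>)" by (intro mult_mono) auto
      finally show "norm (f n s) \<le> max C 0 * exp (- \<bar>s\<bar>)" .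
    qed
  qed
  have line: "continuous_on UNIV (Complex 0)"
    unfolding Complex_eq by (intro continuous_intros)
  have meas: "\<forall>\<^sub>F n in sequentially. f n \<in> borel_measurable borel"
    using eventually_gt_at_top[of 0]
  proof eventually_elim
    case (elim n)
    show ?case unfolding f_def using elim
      by (intro borel_measurable_continuous_onI continuous_on_power
            continuous_on_normalized_Gamma line) auto
  qed
  have g: "g \<in> borel_measurable borel"
    unfolding g_def by (intro borel_measurable_continuous_onI continuous_intros line) auto
  have lim: "(\<lambda>n. f n s) \<longlonglongrightarrow> g s" for s
    unfolding f_def g_def by (intro tendsto_normalized_Gamma_power k)
  show "integrable lborel g" "\<forall>\<^sub>F n in sequentially. integrable lborel (f n)"
    "(\<lambda>n. LINT s|lborel. norm (f n s - g s)) \<longlonglongrightarrow> 0"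
    using L1_convergence_of_exp_bounded[OF meas g bound lim] by auto
qed

section \<open>The double contour integral\<close>

text \<open>
  The inner integral with weight \<open>\<beta>\<close> on the \<open>\<zeta>\<close>-contour, as a function of \<open>\<sigma>\<close>. The weight is what distinguishes
  the rescaled hard-edge kernel from the critical one here; the exponential and the Cauchy factor are common to both.
\<close>

definition zeta_integral :: "real \<Rightarrow> real \<Rightarrow> (real \<Rightarrow> complex) \<Rightarrow> real \<Rightarrow> complex \<Rightarrow> complex" where
  "zeta_integral \<delta> c' \<beta> x \<sigma> =
     (LINT s|lborel. zeta_weight \<delta> s * (\<beta> s * exp (- of_real x * zeta_path \<delta> c' s)) / (\<sigma> - zeta_path \<delta> c' s))"

definition double_contour_integral ::
  "real \<Rightarrow> real \<Rightarrow> real \<Rightarrow> (real \<Rightarrow> complex) \<Rightarrow> (real \<Rightarrow> complex) \<Rightarrow> real \<Rightarrow> real \<Rightarrow> complex" where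
  "double_contour_integral \<delta> c' c \<alpha> \<beta> x y =
     \<i> * (LINT s|lborel. (1 / (2 * of_real pi * \<i>)) ^ 2 *
       (\<alpha> s * exp (of_real y * Complex (- c) s) * zeta_integral \<delta> c' \<beta> x (Complex (- c) s)))"

context
  fixes \<delta> c' x :: real
  assumes \<delta>: "\<delta> > 0" and c': "c' > 0" and x: "x \<ge> 0"
begin

lemma norm_exp_zeta_path_le: "norm (exp (- of_real x * zeta_path \<delta> c' s)) \<le> exp (x * c')"
proof -
  have "x * - c' \<le> x * Re (zeta_path \<delta> c' s)"
    using x by (intro mult_left_mono) (auto simp: Re_zeta_path)
  thus ?thesis by simp
qed

lemma zeta_path_dist:
  assumes "c' < c" "Re \<sigma> \<le> - c"
  shows "c - c' \<le> norm (\<sigma> - zeta_path \<delta> c' s)"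
proof -
  have "Re (zeta_path \<delta> c' s) \<ge> - c'" by (simp add: Re_zeta_path)
  thus ?thesis using assms abs_Re_le_cmod[of "\<sigma> - zeta_path \<delta> c' s"] by simp
qed

lemma integrable_times_exp_zeta_path:
  assumes \<beta>: "integrable lborel \<beta>"
  shows "integrable lborel (\<lambda>s. \<beta> s * exp (- of_real x * zeta_path \<delta> c' s))"
proof (rule Bochner_Integration.integrable_bound)
  show "integrable lborel (\<lambda>s. of_real (exp (x * c')) * \<beta> s)" using \<beta> by simp
  have [measurable]: "\<beta> \<in> borel_measurable borel" using borel_measurable_integrable[OF \<beta>] by simp
  show "(\<lambda>s. \<beta> s * exp (- of_real x * zeta_path \<delta> c' s)) \<in> borel_measurable lborel" by measurable
  show "AE s in lborel. norm (\<beta> s * exp (- of_real x * zeta_path \<delta> c' s)) \<le> norm (of_real (exp (x * c')) * \<beta> s)"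
  proof (rule AE_I2)
    fix s
    have "norm (\<beta> s) * norm (exp (- of_real x * zeta_path \<delta> c' s)) \<le> norm (\<beta> s) * exp (x * c')"
      by (intro mult_left_mono norm_exp_zeta_path_le) auto
    thus "norm (\<beta> s * exp (- of_real x * zeta_path \<delta> c' s)) \<le> norm (of_real (exp (x * c')) * \<beta> s)"
      by (simp add: norm_mult mult_ac del: norm_exp_eq_Re)
  qed
qed

lemma integrable_zeta_weighted:
  assumes \<beta>: "integrable lborel \<beta>"
  shows "integrable lborel (\<lambda>s. zeta_weight \<delta> s * (\<beta> s * exp (- of_real x * zeta_path \<delta> c' s)))"
proof (rule Bochner_Integration.integrable_bound)
  note int = integrable_times_exp_zeta_path[OF \<beta>]
  show "integrable lborel (\<lambda>s. \<beta> s * exp (- of_real x * zeta_path \<delta> c' s))" by (rule int)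
  have [measurable]: "\<beta> \<in> borel_measurable borel" using borel_measurable_integrable[OF \<beta>] by simp
  show "(\<lambda>s. zeta_weight \<delta> s * (\<beta> s * exp (- of_real x * zeta_path \<delta> c' s))) \<in> borel_measurable lborel"
    by measurable
qed (auto simp: norm_mult)

lemma integral_norm_zeta_weighted_le:
  assumes \<beta>: "integrable lborel \<beta>"
  shows "(LINT s|lborel. norm (zeta_weight \<delta> s * (\<beta> s * exp (- of_real x * zeta_path \<delta> c' s))))
     \<le> exp (x * c') * (LINT s|lborel. norm (\<beta> s))"
proof -
  have "(LINT s|lborel. norm (zeta_weight \<delta> s * (\<beta> s * exp (- of_real x * zeta_path \<delta> c' s))))
     \<le> (LINT s|lborel. exp (x * c') * norm (\<beta> s))"
  proof (rule integral_mono)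
    show "integrable lborel (\<lambda>s. norm (zeta_weight \<delta> s * (\<beta> s * exp (- of_real x * zeta_path \<delta> c' s))))"
      using integrable_zeta_weighted[OF \<beta>] by (rule integrable_norm)
    show "integrable lborel (\<lambda>s. exp (x * c') * norm (\<beta> s))" using \<beta> by simp
    fix s
    have "norm (\<beta> s) * norm (exp (- of_real x * zeta_path \<delta> c' s)) \<le> norm (\<beta> s) * exp (x * c')"
      by (intro mult_left_mono norm_exp_zeta_path_le) auto
    thus "norm (zeta_weight \<delta> s * (\<beta> s * exp (- of_real x * zeta_path \<delta> c' s))) \<le> exp (x * c') * norm (\<beta> s)"
      by (simp add: norm_mult mult_ac del: norm_exp_eq_Re)
  qed
  thus ?thesis by simp
qed

lemma zeta_integral_holomorphic:
  assumes \<beta>: "integrable lborel \<beta>"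
  shows "zeta_integral \<delta> c' \<beta> x holomorphic_on {\<sigma>. Re \<sigma> < - c'}"
proof -
  have "(\<lambda>\<sigma>. LINT s|lborel. zeta_weight \<delta> s * (\<beta> s * exp (- of_real x * zeta_path \<delta> c' s)) / (\<sigma> - zeta_path \<delta> c' s))
     holomorphic_on {\<sigma>. Re \<sigma> < - c'}"
    by (intro Cauchy_transform_holomorphic integrable_zeta_weighted \<beta>) (auto simp: Re_zeta_path)
  thus ?thesis by (simp add: zeta_integral_def[abs_def])
qed

lemma norm_zeta_integral_le:
  assumes \<beta>: "integrable lborel \<beta>" and c: "c' < c" "Re \<sigma> \<le> - c"
  shows "norm (zeta_integral \<delta> c' \<beta> x \<sigma>) \<le> exp (x * c') * (LINT s|lborel. norm (\<beta> s)) / (c - c')"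
proof -
  have "norm (zeta_integral \<delta> c' \<beta> x \<sigma>) \<le>
     (LINT s|lborel. norm (zeta_weight \<delta> s * (\<beta> s * exp (- of_real x * zeta_path \<delta> c' s)))) / (c - c')"
    unfolding zeta_integral_def using c zeta_path_dist[OF c]
    by (intro norm_Cauchy_transform_le integrable_zeta_weighted \<beta>) auto
  also have "\<dots> \<le> exp (x * c') * (LINT s|lborel. norm (\<beta> s)) / (c - c')"
    using c by (intro divide_right_mono integral_norm_zeta_weighted_le \<beta>) auto
  finally show ?thesis .
qed

lemma integrable_zeta_integrand:
  assumes \<beta>: "integrable lborel \<beta>" and c: "Re \<sigma> < - c'"
  shows "integrable lborel (\<lambda>s. \<beta> s * exp (- of_real x * zeta_path \<delta> c' s) / (\<sigma> - zeta_path \<delta> c' s))"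
proof -
  define d where "d = - c' - Re \<sigma>"
  have d: "d > 0" using c by (simp add: d_def)
  have dist: "d \<le> norm (\<sigma> - zeta_path \<delta> c' s)" for s
    using zeta_path_dist[of "- Re \<sigma>" \<sigma> s] c by (simp add: d_def)
  note int = integrable_times_exp_zeta_path[OF \<beta>]
  show ?thesis
  proof (rule Bochner_Integration.integrable_bound)
    show "integrable lborel (\<lambda>s. \<beta> s * exp (- of_real x * zeta_path \<delta> c' s) / of_real d)" using int by simp
    have [measurable]: "\<beta> \<in> borel_measurable borel" using borel_measurable_integrable[OF \<beta>] by simp
    show "(\<lambda>s. \<beta> s * exp (- of_real x * zeta_path \<delta> c' s) / (\<sigma> - zeta_path \<delta> c' s)) \<in> borel_measurable lborel"
      by measurable
    show "AE s in lborel. norm (\<beta> s * exp (- of_real x * zeta_path \<delta> c' s) / (\<sigma> - zeta_path \<delta> c' s))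
        \<le> norm (\<beta> s * exp (- of_real x * zeta_path \<delta> c' s) / of_real d)"
    proof (rule AE_I2)
      fix s
      have "norm (\<sigma> - zeta_path \<delta> c' s) > 0" using dist[of s] d by linarith
      thus "norm (\<beta> s * exp (- of_real x * zeta_path \<delta> c' s) / (\<sigma> - zeta_path \<delta> c' s))
        \<le> norm (\<beta> s * exp (- of_real x * zeta_path \<delta> c' s) / of_real d)"
        unfolding norm_divide using dist[of s] d by (intro divide_left_mono mult_pos_pos) auto
    qed
  qed
qed

lemma S_zeta_integral_eq_zeta_integral:
  assumes \<beta>: "integrable lborel \<beta>" and c: "Re \<sigma> < - c'"
    and \<phi>: "\<And>s. \<phi> (zeta_path \<delta> c' s) =
              a * (\<beta> s * exp (- of_real x * zeta_path \<delta> c' s) / (\<sigma> - zeta_path \<delta> c' s))"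
  shows "S_zeta_integral \<delta> c' \<phi> = a * zeta_integral \<delta> c' \<beta> x \<sigma>"
proof -
  have "S_zeta_integral \<delta> c' \<phi> = (LINT s|lborel. zeta_weight \<delta> s * \<phi> (zeta_path \<delta> c' s))"
    unfolding \<phi>[symmetric]
    by (intro S_zeta_integral_eq_LINT \<delta>) 
       (unfold \<phi>, intro integrable_mult_right integrable_zeta_integrand \<beta> c)
  also have "\<dots> = (LINT s|lborel. a * (zeta_weight \<delta> s * (\<beta> s * exp (- of_real x * zeta_path \<delta> c' s)) / (\<sigma> - zeta_path \<delta> c' s)))"
    by (simp add: \<phi> mult_ac)
  also have "\<dots> = a * zeta_integral \<delta> c' \<beta> x \<sigma>"
    unfolding zeta_integral_def by (rule integral_mult_right_zero)
  finally show ?thesis .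
qed

lemma zeta_integral_diff:
  assumes \<beta>: "integrable lborel \<beta>1" "integrable lborel \<beta>2" and c: "Re \<sigma> < - c'"
  shows "zeta_integral \<delta> c' \<beta>1 x \<sigma> - zeta_integral \<delta> c' \<beta>2 x \<sigma> = zeta_integral \<delta> c' (\<lambda>s. \<beta>1 s - \<beta>2 s) x \<sigma>"
proof -
  have "integrable lborel (\<lambda>s. zeta_weight \<delta> s * (\<beta> s * exp (- of_real x * zeta_path \<delta> c' s)) / (\<sigma> - zeta_path \<delta> c' s))"
    if \<beta>: "integrable lborel \<beta>" for \<beta>
  proof (rule Bochner_Integration.integrable_bound[OF integrable_zeta_integrand[OF \<beta> c]])
    have [measurable]: "\<beta> \<in> borel_measurable borel" using borel_measurable_integrable[OF \<beta>] by simp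
    show "(\<lambda>s. zeta_weight \<delta> s * (\<beta> s * exp (- of_real x * zeta_path \<delta> c' s)) / (\<sigma> - zeta_path \<delta> c' s))
       \<in> borel_measurable lborel" by measurable
  qed (auto simp: norm_mult norm_divide)
  from this[OF \<beta>(1)] this[OF \<beta>(2)] show ?thesis
    unfolding zeta_integral_def
    by (simp flip: Bochner_Integration.integral_diff add: left_diff_distrib right_diff_distrib diff_divide_distrib)
qed

lemma continuous_on_zeta_integral_line:
  assumes \<beta>: "integrable lborel \<beta>" and c: "c' < c"
  shows "continuous_on UNIV (\<lambda>s. zeta_integral \<delta> c' \<beta> x (Complex (- c) s))"
  by (rule continuous_on_compose2[OF holomorphic_on_imp_continuous_on[OF zeta_integral_holomorphic[OF \<beta>]]])
     (use c in \<open>auto simp: Complex_eq intro!: continuous_intros\<close>)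

text \<open>
  Stability of the double integral in its two weights: replace \<open>\<alpha>1\<close> by \<open>\<alpha>2\<close> first and then \<open>\<beta>1\<close> by \<open>\<beta>2\<close>, and
  bound the inner integral uniformly in \<open>\<sigma>\<close>. The variable \<open>y\<close> drops out because
  \<open>\<bar>exp (y \<sigma>)\<bar> \<le> 1\<close> on \<open>Re \<sigma> = -c\<close>.
\<close>

lemma double_contour_integral_diff_le:
  assumes \<alpha>: "integrable lborel \<alpha>1" "integrable lborel \<alpha>2" and \<beta>: "integrable lborel \<beta>1" "integrable lborel \<beta>2"
    and c: "c' < c" and y: "y \<ge> 0"
  shows "norm (double_contour_integral \<delta> c' c \<alpha>1 \<beta>1 x y - double_contour_integral \<delta> c' c \<alpha>2 \<beta>2 x y) \<le>
     exp (x * c') / (c - c') * ((LINT s|lborel. norm (\<alpha>1 s - \<alpha>2 s)) * (LINT s|lborel. norm (\<beta>1 s)) +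
        (LINT s|lborel. norm (\<alpha>2 s)) * (LINT s|lborel. norm (\<beta>1 s - \<beta>2 s)))"
proof -
  define H where "H = (\<lambda>\<beta> s. zeta_integral \<delta> c' \<beta> x (Complex (- c) s))"
  define E where "E = (\<lambda>s. exp (of_real y * Complex (- c) s))"
  define K where "K = (\<lambda>\<beta> :: real \<Rightarrow> complex. exp (x * c') * (LINT s|lborel. norm (\<beta> s)) / (c - c'))"
  have H: "norm (H \<beta> s) \<le> K \<beta>" if "integrable lborel \<beta>" for \<beta> s
    unfolding H_def K_def using norm_zeta_integral_le[OF that c] by simp
  have E: "norm (E s) \<le> 1" for s
    using y c c' by (simp add: E_def)
  have int: "integrable lborel (\<lambda>s. \<alpha> s * E s * H \<beta> s)"
    if \<alpha>: "integrable lborel \<alpha>" and \<beta>: "integrable lborel \<beta>" for \<alpha> \<beta>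
  proof (rule Bochner_Integration.integrable_bound)
    show "integrable lborel (\<lambda>s. \<alpha> s * of_real (K \<beta>))" using \<alpha> by simp
    have [measurable]: "\<alpha> \<in> borel_measurable borel" using borel_measurable_integrable[OF \<alpha>] by simp
    have [measurable]: "H \<beta> \<in> borel_measurable borel"
      unfolding H_def by (intro borel_measurable_continuous_onI continuous_on_zeta_integral_line \<beta> c)
    have [measurable]: "E \<in> borel_measurable borel"
      unfolding E_def Complex_eq by (intro borel_measurable_continuous_onI continuous_intros)
    show "(\<lambda>s. \<alpha> s * E s * H \<beta> s) \<in> borel_measurable lborel" by measurable
    show "AE s in lborel. norm (\<alpha> s * E s * H \<beta> s) \<le> norm (\<alpha> s * of_real (K \<beta>))"
    proof (rule AE_I2)
      fix s
      have "norm (\<alpha> s * E s * H \<beta> s) \<le> norm (\<alpha> s) * 1 * K \<beta>"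
        unfolding norm_mult by (intro mult_mono E H \<beta>) auto
      also have "\<dots> \<le> norm (\<alpha> s) * \<bar>K \<beta>\<bar>" by (simp add: mult_left_mono)
      finally show "norm (\<alpha> s * E s * H \<beta> s) \<le> norm (\<alpha> s * of_real (K \<beta>))" by (simp add: norm_mult)
    qed
  qed
  have pi2: "norm ((1 / (2 * of_real pi * \<i>)) ^ 2 :: complex) \<le> 1"
  proof -
    have "norm (1 / (2 * of_real pi * \<i>) :: complex) \<le> 1"
      using pi_ge_two by (simp add: norm_divide norm_mult field_simps)
    thus ?thesis unfolding norm_power by (intro power_le_one) auto
  qed
  have D: "double_contour_integral \<delta> c' c \<alpha> \<beta> x y = \<i> * ((1 / (2 * of_real pi * \<i>)) ^ 2 * (LINT s|lborel. \<alpha> s * E s * H \<beta> s))"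
    for \<alpha> \<beta>
    unfolding double_contour_integral_def E_def H_def integral_mult_right_zero ..
  have "double_contour_integral \<delta> c' c \<alpha>1 \<beta>1 x y - double_contour_integral \<delta> c' c \<alpha>2 \<beta>2 x y =
     \<i> * ((1 / (2 * of_real pi * \<i>)) ^ 2 * (LINT s|lborel. \<alpha>1 s * E s * H \<beta>1 s - \<alpha>2 s * E s * H \<beta>2 s))"
    using int[OF \<alpha>(1) \<beta>(1)] int[OF \<alpha>(2) \<beta>(2)]
    unfolding D by (simp add: right_diff_distrib)
  hence "norm (double_contour_integral \<delta> c' c \<alpha>1 \<beta>1 x y - double_contour_integral \<delta> c' c \<alpha>2 \<beta>2 x y) =
      norm ((1 / (2 * of_real pi * \<i>)) ^ 2 :: complex) * norm (LINT s|lborel. \<alpha>1 s * E s * H \<beta>1 s - \<alpha>2 s * E s * H \<beta>2 s)"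
    by (simp only: norm_mult norm_ii mult_1)
  also have "\<dots> \<le> norm (LINT s|lborel. \<alpha>1 s * E s * H \<beta>1 s - \<alpha>2 s * E s * H \<beta>2 s)"
    using mult_right_mono[OF pi2] by fastforce
  also have "\<dots> \<le> (LINT s|lborel. norm (\<alpha>1 s - \<alpha>2 s) * K \<beta>1 + norm (\<alpha>2 s) * K (\<lambda>s. \<beta>1 s - \<beta>2 s))"
  proof (rule Bochner_Integration.integral_norm_bound_integral)
    show "integrable lborel (\<lambda>s. \<alpha>1 s * E s * H \<beta>1 s - \<alpha>2 s * E s * H \<beta>2 s)"
      using int[OF \<alpha>(1) \<beta>(1)] int[OF \<alpha>(2) \<beta>(2)] by simp
    show "integrable lborel (\<lambda>s. norm (\<alpha>1 s - \<alpha>2 s) * K \<beta>1 + norm (\<alpha>2 s) * K (\<lambda>s. \<beta>1 s - \<beta>2 s))"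
      using \<alpha> by simp
    fix s
    have Hd: "H \<beta>1 s - H \<beta>2 s = H (\<lambda>s. \<beta>1 s - \<beta>2 s) s"
      unfolding H_def using c by (intro zeta_integral_diff \<beta>) auto
    have "\<alpha>1 s * E s * H \<beta>1 s - \<alpha>2 s * E s * H \<beta>2 s =
        (\<alpha>1 s - \<alpha>2 s) * E s * H \<beta>1 s + \<alpha>2 s * E s * (H \<beta>1 s - H \<beta>2 s)"
      by (simp add: algebra_simps)
    also have "norm \<dots> \<le> norm (\<alpha>1 s - \<alpha>2 s) * 1 * K \<beta>1 + norm (\<alpha>2 s) * 1 * K (\<lambda>s. \<beta>1 s - \<beta>2 s)"
      unfolding Hd
    proof (intro norm_triangle_mono)
      show "norm ((\<alpha>1 s - \<alpha>2 s) * E s * H \<beta>1 s) \<le> norm (\<alpha>1 s - \<alpha>2 s) * 1 * K \<beta>1"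
        unfolding norm_mult by (intro mult_mono E H \<beta>) auto
      show "norm (\<alpha>2 s * E s * H (\<lambda>s. \<beta>1 s - \<beta>2 s) s) \<le> norm (\<alpha>2 s) * 1 * K (\<lambda>s. \<beta>1 s - \<beta>2 s)"
        unfolding norm_mult by (intro mult_mono E H Bochner_Integration.integrable_diff \<beta>) auto
    qed
    finally show "norm (\<alpha>1 s * E s * H \<beta>1 s - \<alpha>2 s * E s * H \<beta>2 s) \<le>
        norm (\<alpha>1 s - \<alpha>2 s) * K \<beta>1 + norm (\<alpha>2 s) * K (\<lambda>s. \<beta>1 s - \<beta>2 s)" by simp
  qed
  also have "\<dots> = (LINT s|lborel. norm (\<alpha>1 s - \<alpha>2 s)) * K \<beta>1 + (LINT s|lborel. norm (\<alpha>2 s)) * K (\<lambda>s. \<beta>1 s - \<beta>2 s)"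
    using \<alpha> by simp
  also have "\<dots> = exp (x * c') / (c - c') * ((LINT s|lborel. norm (\<alpha>1 s - \<alpha>2 s)) * (LINT s|lborel. norm (\<beta>1 s)) +
        (LINT s|lborel. norm (\<alpha>2 s)) * (LINT s|lborel. norm (\<beta>1 s - \<beta>2 s)))"
    by (simp add: K_def distrib_left mult_ac)
  finally show ?thesis .
qed

end

lemma critical_kernel_eq:
  fixes \<tau> t \<delta> c' c x y :: real
  assumes \<delta>: "\<delta> > 0" and c: "0 < c'" "c' < c" "c < 1" and x: "x \<ge> 0"
  defines "\<alpha> \<equiv> (\<lambda>s. exp (of_real t * (Complex (- c) s)\<^sup>2 / 2) / Gamma (- Complex (- c) s))"
    and "\<beta> \<equiv> (\<lambda>s. Gamma (- zeta_path \<delta> c' s) / exp (of_real \<tau> * (zeta_path \<delta> c' s)\<^sup>2 / 2))"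
  assumes \<beta>: "integrable lborel \<beta>"
  shows "critical_kernel \<delta> c' c \<tau> x t y =
     - (if t > \<tau>
        then of_real (1 / sqrt (2 * pi * (t - \<tau>)) * exp (- ((x - y)\<^sup>2 / (2 * (t - \<tau>)))))
        else 0) + double_contour_integral \<delta> c' c \<alpha> \<beta> x y"
proof -
  define \<Phi> where "\<Phi> = (\<lambda>\<sigma>. 1 / (2 * of_real pi * \<i>) *
         S_zeta_integral \<delta> c' (\<lambda>\<zeta>. 1 / (2 * of_real pi * \<i>) *
           (exp (of_real t * \<sigma>\<^sup>2 / 2) * Gamma (- \<zeta>)
             / (exp (of_real \<tau> * \<zeta>\<^sup>2 / 2) * Gamma (- \<sigma>))
            * (exp (- of_real x * \<zeta> + of_real y * \<sigma>) / (\<sigma> - \<zeta>)))))"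
  have "\<Phi> (Complex (- c) s) = (1 / (2 * of_real pi * \<i>)) ^ 2 *
       (\<alpha> s * exp (of_real y * Complex (- c) s) * zeta_integral \<delta> c' \<beta> x (Complex (- c) s))" for s
  proof -
    have "S_zeta_integral \<delta> c' (\<lambda>\<zeta>. 1 / (2 * of_real pi * \<i>) *
           (exp (of_real t * (Complex (- c) s)\<^sup>2 / 2) * Gamma (- \<zeta>)
             / (exp (of_real \<tau> * \<zeta>\<^sup>2 / 2) * Gamma (- Complex (- c) s))
            * (exp (- of_real x * \<zeta> + of_real y * Complex (- c) s) / (Complex (- c) s - \<zeta>)))) =
       (1 / (2 * of_real pi * \<i>) * (\<alpha> s * exp (of_real y * Complex (- c) s))) *
          zeta_integral \<delta> c' \<beta> x (Complex (- c) s)"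
    proof (rule S_zeta_integral_eq_zeta_integral)
      fix u
      show "1 / (2 * of_real pi * \<i>) *
           (exp (of_real t * (Complex (- c) s)\<^sup>2 / 2) * Gamma (- zeta_path \<delta> c' u)
             / (exp (of_real \<tau> * (zeta_path \<delta> c' u)\<^sup>2 / 2) * Gamma (- Complex (- c) s))
            * (exp (- of_real x * zeta_path \<delta> c' u + of_real y * Complex (- c) s) / (Complex (- c) s - zeta_path \<delta> c' u))) =
          1 / (2 * of_real pi * \<i>) * (\<alpha> s * exp (of_real y * Complex (- c) s)) *
            (\<beta> u * exp (- of_real x * zeta_path \<delta> c' u) / (Complex (- c) s - zeta_path \<delta> c' u))"
        unfolding \<alpha>_def \<beta>_def exp_add by (simp add: mult_ac)
    qed (use \<delta> c x \<beta> in auto)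
    thus ?thesis unfolding \<Phi>_def by (simp add: power2_eq_square)
  qed
  hence "S_sigma_integral c \<Phi> = double_contour_integral \<delta> c' c \<alpha> \<beta> x y"
    unfolding S_sigma_integral_def vline_integral_def double_contour_integral_def by simp
  thus ?thesis unfolding critical_kernel_def \<Phi>_def by simp
qed

text \<open>
  As a function of \<open>\<sigma>\<close> the inner integral is a product \<open>k M(\<sigma>) H(\<sigma>)\<close>, where \<open>M\<close> collects the Gamma factors and the
  power of \<open>Y\<close>, and \<open>H\<close> is a bounded Cauchy transform. The loop is opened into the line, and there
  \<open>Y\<close>, \<open>X\<close> and the powers of \<open>\<Gamma>(n)\<close> combine with the Gamma factors into powers of the
  normalized Gamma function.
\<close>

lemma hard_edge_double_integral_eq:
  fixes \<delta> c' c x y :: real and n q r :: nat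
  assumes \<delta>: "\<delta> > 0" and c: "0 < c'" "c' < c" "c < 1" and x: "x \<ge> 0" and n: "n \<ge> 1" and r: "r \<ge> 40"
  defines "X \<equiv> exp (real q * critical_exponent n - x)" and "Y \<equiv> exp (real r * critical_exponent n - y)"
    and "\<alpha> \<equiv> (\<lambda>s. normalized_Gamma n (Complex (- c) s) ^ r / Gamma (- Complex (- c) s))"
    and "\<beta> \<equiv> (\<lambda>s. Gamma (- zeta_path \<delta> c' s) / normalized_Gamma n (zeta_path \<delta> c' s) ^ q)"
  assumes \<beta>: "integrable lborel \<beta>"
  shows "of_real (Y * Gamma (real n) ^ q / Gamma (real n) ^ r) *
     S'_sigma_integral \<delta> c (\<lambda>\<sigma>. 1 / (2 * of_real pi * \<i>) *
         S_zeta_integral \<delta> c' (\<lambda>\<zeta>. 1 / (2 * of_real pi * \<i>) *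
           (Gamma (\<sigma> + of_nat n) ^ r / Gamma (\<zeta> + of_nat n) ^ q
            * (Gamma (- \<zeta>) / Gamma (- \<sigma>))
            * (of_real X powr \<zeta> * of_real Y powr (- \<sigma> - 1) / (\<sigma> - \<zeta>)))))
     = double_contour_integral \<delta> c' c \<alpha> \<beta> x y"
proof -
  let ?Z = "zeta_path \<delta> c'" and ?\<kappa> = "critical_exponent n"
  define G where "G = complex_of_real (Gamma (real n))"
  have Gpos: "Gamma (real n) > 0" using n by simp
  hence G0: "G \<noteq> 0" by (simp add: G_def)
  have XY: "X > 0" "Y > 0" by (auto simp: X_def Y_def)
  have Xp: "of_real X powr \<zeta> = exp (\<zeta> * of_real (real q * ?\<kappa> - x))" for \<zeta> :: complex
    by (simp add: X_def powr_def Ln_of_real)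
  have Yp: "of_real Y powr \<zeta> = exp (\<zeta> * of_real (real r * ?\<kappa> - y))" for \<zeta> :: complex
    by (simp add: Y_def powr_def Ln_of_real)
  define \<Phi> where "\<Phi> = (\<lambda>\<sigma>. 1 / (2 * of_real pi * \<i>) *
         S_zeta_integral \<delta> c' (\<lambda>\<zeta>. 1 / (2 * of_real pi * \<i>) *
           (Gamma (\<sigma> + of_nat n) ^ r / Gamma (\<zeta> + of_nat n) ^ q
            * (Gamma (- \<zeta>) / Gamma (- \<sigma>))
            * (of_real X powr \<zeta> * of_real Y powr (- \<sigma> - 1) / (\<sigma> - \<zeta>)))))"
  define M where "M = (\<lambda>\<sigma> :: complex. Gamma (\<sigma> + of_nat n) ^ r / Gamma (- \<sigma>) * of_real Y powr (- \<sigma> - 1))"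
  define H where "H = zeta_integral \<delta> c' \<beta> x"
  define k where "k = (1 / (2 * of_real pi * \<i>)) ^ 2 / G ^ q"
  have \<Phi>: "\<Phi> \<sigma> = k * (M \<sigma> * H \<sigma>)" if \<sigma>: "Re \<sigma> < - c'" for \<sigma>
  proof -
    have fac: "of_real X powr ?Z s / Gamma (?Z s + of_nat n) ^ q =
        exp (- of_real x * ?Z s) / (normalized_Gamma n (?Z s) ^ q * G ^ q)" for s
    proof -
      have "of_real X powr ?Z s = exp (- of_real x * ?Z s) * exp (of_nat q * (?Z s * of_real ?\<kappa>))"
        unfolding Xp by (simp add: algebra_simps flip: exp_add)
      thus ?thesis
        using n by (subst normalized_Gamma_power_eq) (auto simp: G_def)
    qed
    have "S_zeta_integral \<delta> c' (\<lambda>\<zeta>. 1 / (2 * of_real pi * \<i>) *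
           (Gamma (\<sigma> + of_nat n) ^ r / Gamma (\<zeta> + of_nat n) ^ q
            * (Gamma (- \<zeta>) / Gamma (- \<sigma>))
            * (of_real X powr \<zeta> * of_real Y powr (- \<sigma> - 1) / (\<sigma> - \<zeta>)))) =
       (1 / (2 * of_real pi * \<i>) / G ^ q * M \<sigma>) * zeta_integral \<delta> c' \<beta> x \<sigma>"
    proof (rule S_zeta_integral_eq_zeta_integral)
      fix s
      have "1 / (2 * of_real pi * \<i>) * (Gamma (\<sigma> + of_nat n) ^ r / Gamma (?Z s + of_nat n) ^ q
            * (Gamma (- ?Z s) / Gamma (- \<sigma>))
            * (of_real X powr ?Z s * of_real Y powr (- \<sigma> - 1) / (\<sigma> - ?Z s))) =
          1 / (2 * of_real pi * \<i>) * M \<sigma> * (Gamma (- ?Z s) * (of_real X powr ?Z s / Gamma (?Z s + of_nat n) ^ q)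
            / (\<sigma> - ?Z s))"
        by (simp add: M_def mult_ac)
      also have "\<dots> = 1 / (2 * of_real pi * \<i>) / G ^ q * M \<sigma> * (\<beta> s * exp (- of_real x * ?Z s) / (\<sigma> - ?Z s))"
        unfolding fac by (simp add: \<beta>_def)
      finally show "1 / (2 * of_real pi * \<i>) * (Gamma (\<sigma> + of_nat n) ^ r / Gamma (?Z s + of_nat n) ^ q
            * (Gamma (- ?Z s) / Gamma (- \<sigma>))
            * (of_real X powr ?Z s * of_real Y powr (- \<sigma> - 1) / (\<sigma> - ?Z s))) =
          1 / (2 * of_real pi * \<i>) / G ^ q * M \<sigma> * (\<beta> s * exp (- of_real x * ?Z s) / (\<sigma> - ?Z s))" .
    qed (use \<delta> c x \<beta> \<sigma> in auto)
    thus ?thesis unfolding \<Phi>_def by (simp add: k_def H_def power2_eq_square)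
  qed
  have Gnz: "Gamma (- \<sigma>) \<noteq> 0" if "Re \<sigma> < - c'" for \<sigma>
    using not_nonpos_Int_if_Re_pos[of "- \<sigma>"] that c by (simp add: Gamma_eq_zero_iff)
  have Hhol: "H holomorphic_on {\<sigma>. Re \<sigma> < - c'}"
    unfolding H_def by (intro zeta_integral_holomorphic \<delta> c x \<beta>)
  have Mhol: "M holomorphic_on {\<sigma>. Re \<sigma> < - c' \<and> (Im \<sigma> \<noteq> 0 \<or> Re \<sigma> > - real n)}"
  proof -
    have "\<sigma> + of_nat n \<notin> \<int>\<^sub>\<le>\<^sub>0" if "Im \<sigma> \<noteq> 0 \<or> Re \<sigma> > - real n" for \<sigma>
      using that by (auto elim!: nonpos_Ints_cases simp: complex_eq_iff)
    moreover have "- \<sigma> \<notin> \<int>\<^sub>\<le>\<^sub>0" if "Re \<sigma> < - c'" for \<sigma>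
      using that c not_nonpos_Int_if_Re_pos[of "- \<sigma>"] by simp
    ultimately show ?thesis unfolding M_def using Gnz XY
      by (intro holomorphic_intros) auto
  qed
  have \<Phi>hol: "\<Phi> holomorphic_on {\<sigma>. Re \<sigma> < - c' \<and> (Im \<sigma> \<noteq> 0 \<or> Re \<sigma> > - real n)}"
  proof (rule holomorphic_transform)
    show "(\<lambda>\<sigma>. k * (M \<sigma> * H \<sigma>)) holomorphic_on {\<sigma>. Re \<sigma> < - c' \<and> (Im \<sigma> \<noteq> 0 \<or> Re \<sigma> > - real n)}"
      by (intro holomorphic_intros Mhol holomorphic_on_subset[OF Hhol]) auto
  qed (use \<Phi> in auto)
  obtain C where C: "\<And>u v. u \<le> - c \<Longrightarrow> \<delta> \<le> \<bar>v\<bar> \<Longrightarrow> norm (M (Complex u v)) \<le> C * exp u * exp (- \<bar>v\<bar>)"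
    using Gamma_power_quotient_bound[OF n r XY(2) \<delta>, of c] c unfolding M_def by (metis less_trans)
  define L where "L = exp (x * c') * (LINT s|lborel. norm (\<beta> s)) / (c - c')"
  have "S'_sigma_integral \<delta> c \<Phi> = S_sigma_integral c \<Phi>"
  proof (rule S'_sigma_integral_eq_S_sigma_integral)
    show "\<delta> > 0" by (rule \<delta>)
    show "- c < - c'" using c by simp
    show "\<Phi> holomorphic_on {z. Re z < - c' \<and> Im z \<noteq> 0}"
      by (rule holomorphic_on_subset[OF \<Phi>hol]) auto
    show "continuous_on UNIV (\<lambda>v. \<Phi> (Complex (- c) v))"
      by (rule continuous_on_compose2[OF holomorphic_on_imp_continuous_on[OF \<Phi>hol]])
         (use c n in \<open>auto simp: Complex_eq intro!: continuous_intros\<close>)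
    fix u v :: real assume uv: "u \<le> - c" "\<delta> \<le> \<bar>v\<bar>"
    have "norm (\<Phi> (Complex u v)) = norm k * (norm (M (Complex u v)) * norm (H (Complex u v)))"
      using uv c by (subst \<Phi>) (auto simp: norm_mult)
    also have "\<dots> \<le> norm k * ((C * exp u * exp (- \<bar>v\<bar>)) * L)"
    proof (intro mult_left_mono mult_mono)
      show "norm (M (Complex u v)) \<le> C * exp u * exp (- \<bar>v\<bar>)" by (rule C[OF uv])
      thus "0 \<le> C * exp u * exp (- \<bar>v\<bar>)" by (rule order_trans[OF norm_ge_zero])
      show "norm (H (Complex u v)) \<le> L"
        unfolding H_def L_def by (intro norm_zeta_integral_le \<delta> c x \<beta>) (use uv in auto)
    qed auto
    finally show "norm (\<Phi> (Complex u v)) \<le> (norm k * C * L) * exp u * exp (- \<bar>v\<bar>)" by (simp add: mult_ac)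
  qed
  moreover have "of_real (Y * Gamma (real n) ^ q / Gamma (real n) ^ r) * S_sigma_integral c \<Phi> =
      double_contour_integral \<delta> c' c \<alpha> \<beta> x y"
  proof -
    have "of_real (Y * Gamma (real n) ^ q / Gamma (real n) ^ r) * \<Phi> (Complex (- c) s) =
        (1 / (2 * of_real pi * \<i>)) ^ 2 *
          (\<alpha> s * exp (of_real y * Complex (- c) s) * H (Complex (- c) s))" for s
    proof -
      define \<sigma> where "\<sigma> = Complex (- c) s"
      have YY: "of_real Y * of_real Y powr (- \<sigma> - 1) =
          exp (of_real y * \<sigma>) / exp (of_nat r * (\<sigma> * of_real ?\<kappa>))"
      proof -
        have "of_real Y = exp (complex_of_real (real r * ?\<kappa> - y))"
          unfolding Y_def by (rule exp_of_real[symmetric])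
        thus ?thesis unfolding Yp by (simp add: algebra_simps flip: exp_add exp_diff)
      qed
      have "of_real (Y * Gamma (real n) ^ q / Gamma (real n) ^ r) * \<Phi> \<sigma> =
         (1 / (2 * of_real pi * \<i>)) ^ 2 * ((Gamma (\<sigma> + of_nat n) ^ r / G ^ r) / Gamma (- \<sigma>) *
            (of_real Y * of_real Y powr (- \<sigma> - 1)) * H \<sigma>)"
        using c G0 by (subst \<Phi>) (auto simp: \<sigma>_def k_def M_def G_def)
      also have "\<dots> = (1 / (2 * of_real pi * \<i>)) ^ 2 *
          (normalized_Gamma n \<sigma> ^ r / Gamma (- \<sigma>) * exp (of_real y * \<sigma>) * H \<sigma>)"
        unfolding YY using n G0 by (subst normalized_Gamma_power_eq) (auto simp: G_def)
      finally show ?thesis by (simp add: \<alpha>_def \<sigma>_def)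
    qed
    hence "\<i> * (LINT s|lborel. of_real (Y * Gamma (real n) ^ q / Gamma (real n) ^ r) * \<Phi> (Complex (- c) s)) =
       double_contour_integral \<delta> c' c \<alpha> \<beta> x y"
      unfolding double_contour_integral_def H_def by simp
    thus ?thesis unfolding S_sigma_integral_def vline_integral_def by (simp add: mult_ac)
  qed
  ultimately show ?thesis unfolding \<Phi>_def by simp
qed

section \<open>The single-integral term\<close>

text \<open>
  On the line \<open>Re \<eta> = 1\<close> the argument of \<open>\<Gamma>\<close> is \<open>n + iv\<close>, and one factor \<open>Y/X\<close> cancels against the prefactor. The
  condition on \<open>r - q\<close> gives the decay needed to move the line there.
\<close>

lemma meijer_term_eq:
  fixes n q r :: nat and a x y :: real
  assumes n: "n \<ge> 1" and qr: "q + 8 \<le> r" and a: "a > - (real n - 1)"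
  defines "X \<equiv> exp (real q * critical_exponent n - x)" and "Y \<equiv> exp (real r * critical_exponent n - y)"
  shows "of_real (Y * Gamma (real n) ^ q / Gamma (real n) ^ r) *
      (1 / of_real X * meijer_G_p0 a (map (\<lambda>j. real n - 1) [q+1..<r+1]) (Y / X)) =
     1 / (2 * of_real pi) *
       (LINT v|lborel. normalized_Gamma n (Complex 0 v) ^ (r - q) * exp (\<i> * of_real v * of_real (y - x)))"
proof -
  define p where "p = r - q"
  define G where "G = complex_of_real (Gamma (real n))"
  define \<kappa> where "\<kappa> = critical_exponent n"
  define D where "D = real p * \<kappa> - y + x"
  have Gpos: "Gamma (real n) > 0" using n by simp
  hence G0: "G \<noteq> 0" by (simp add: G_def)
  have p: "p \<ge> 8" "r = q + p" using qr by (simp_all add: p_def)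
  have YX: "Y / X = exp D"
    unfolding X_def Y_def D_def p(2) \<kappa>_def by (simp add: algebra_simps flip: exp_diff)
  have X0: "X > 0" by (simp add: X_def)
  define g where "g = (\<lambda>\<eta>::complex. Gamma (of_real (real n - 1) + \<eta>) ^ p * of_real (Y / X) powr (- \<eta>))"
  have Gq: "Gamma (real n) ^ q / Gamma (real n) ^ r = 1 / Gamma (real n) ^ p"
    using Gpos unfolding p(2) power_add by simp
  have "meijer_G_p0 a (map (\<lambda>j. real n - 1) [q+1..<r+1]) (Y / X) = 1 / (2 * of_real pi * \<i>) * vline_integral a g"
  proof -
    have "map (\<lambda>j. real n - 1) [q+1..<r+1] = replicate p (real n - 1)"
      by (simp add: map_replicate_const p_def del: upt_Suc)
    thus ?thesis unfolding meijer_G_p0_def g_def by (simp only: map_replicate prod_list_replicate)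
  qed
  also have "vline_integral a g = vline_integral 1 g"
    unfolding g_def using n a p YX by (intro Gamma_power_vline_shift) auto
  also have "1 / (2 * of_real pi * \<i>) * vline_integral 1 g = 1 / (2 * of_real pi) * (LINT v|lborel. g (Complex 1 v))"
    by (simp add: vline_integral_def)
  finally have "of_real (Y * Gamma (real n) ^ q / Gamma (real n) ^ r) *
      (1 / of_real X * meijer_G_p0 a (map (\<lambda>j. real n - 1) [q+1..<r+1]) (Y / X)) =
     1 / (2 * of_real pi) * (of_real (Y / X) * (1 / G ^ p) * (LINT v|lborel. g (Complex 1 v)))"
    unfolding times_divide_eq_right[symmetric] Gq by (simp add: G_def)
  also have "of_real (Y / X) * (1 / G ^ p) * (LINT v|lborel. g (Complex 1 v)) =
     (LINT v|lborel. of_real (Y / X) * (1 / G ^ p) * g (Complex 1 v))"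
    by (rule integral_mult_right_zero[symmetric])
  also have "\<dots> = (LINT v|lborel. normalized_Gamma n (Complex 0 v) ^ p * exp (\<i> * of_real v * of_real (y - x)))"
  proof (intro Bochner_Integration.integral_cong refl)
    fix v
    have z: "of_real (real n - 1) + Complex 1 v = Complex 0 v + of_nat n" by (simp add: complex_eq_iff)
    have iv: "Complex 0 v = \<i> * of_real v" "Complex 1 v = 1 + \<i> * of_real v" by (simp_all add: complex_eq_iff)
    have "of_real (Y / X) powr (- Complex 1 v) = exp (- Complex 1 v * of_real D)"
      unfolding YX by (simp add: powr_def Ln_of_real)
    hence 1: "of_real (Y / X) * of_real (Y / X) powr (- Complex 1 v) = exp (- (\<i> * of_real v) * of_real D)"
      unfolding YX iv by (simp add: exp_of_real[symmetric] algebra_simps flip: exp_add)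
    have "of_real (Y / X) * (1 / G ^ p) * g (Complex 1 v) =
        Gamma (Complex 0 v + of_nat n) ^ p / G ^ p * (of_real (Y / X) * of_real (Y / X) powr (- Complex 1 v))"
      unfolding g_def z by (simp add: mult_ac)
    also have "\<dots> = normalized_Gamma n (Complex 0 v) ^ p *
         (exp (of_nat p * (Complex 0 v * of_real \<kappa>)) * exp (- (\<i> * of_real v) * of_real D))"
      unfolding 1 using n G0 by (subst normalized_Gamma_power_eq) (auto simp: G_def \<kappa>_def)
    also have "exp (of_nat p * (Complex 0 v * of_real \<kappa>)) * exp (- (\<i> * of_real v) * of_real D) =
        exp (\<i> * of_real v * of_real (y - x))"
      unfolding iv exp_add[symmetric] D_def by (simp add: algebra_simps)
    finally show "of_real (Y / X) * (1 / G ^ p) * g (Complex 1 v) =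
        normalized_Gamma n (Complex 0 v) ^ p * exp (\<i> * of_real v * of_real (y - x))" .
  qed
  finally show ?thesis by (simp only: p_def)
qed

text \<open>
  The characteristic function of the standard normal distribution after the substitution \<open>v = x / sqrt T\<close>.
\<close>

lemma Gaussian_Fourier_integral:
  fixes T \<xi> :: real
  assumes T: "T > 0"
  shows "(LINT v|lborel. exp (of_real T * (\<i> * of_real v)\<^sup>2 / 2) * exp (\<i> * of_real v * of_real \<xi>)) =
           complex_of_real (sqrt (2 * pi / T) * exp (- (\<xi>\<^sup>2 / (2 * T))))"
proof -
  define f where "f = (\<lambda>v::real. exp (of_real T * (\<i> * of_real v)\<^sup>2 / 2) * exp (\<i> * of_real v * of_real \<xi>) :: complex)"
  define h where "h = \<xi> / sqrt T"
  have sT: "sqrt T > 0" using T by simp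
  have "complex_of_real (exp (- (h\<^sup>2) / 2)) = char std_normal_distribution h"
    by (simp add: char_std_normal_distribution)
  also have "\<dots> = (LINT x|lborel. std_normal_density x *\<^sub>R iexp (h * x))"
    unfolding char_def by (subst integral_density) auto
  also have "\<dots> = (LINT x|lborel. of_real (1 / sqrt (2 * pi)) * f (0 + (1 / sqrt T) * x))"
  proof (intro Bochner_Integration.integral_cong refl)
    fix x :: real
    have Tx: "T * (x / sqrt T)\<^sup>2 = x\<^sup>2" using T by (simp add: power_divide)
    have "of_real T * (\<i> * of_real y)\<^sup>2 = complex_of_real (- (T * y\<^sup>2))" for y
      by (simp add: power_mult_distrib)
    from this[of "x / sqrt T"]
    have 1: "of_real T * (\<i> * of_real (x / sqrt T))\<^sup>2 / 2 = complex_of_real (- (x\<^sup>2) / 2)"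
      unfolding Tx by simp
    have 2: "\<i> * of_real (x / sqrt T) * of_real \<xi> = \<i> * complex_of_real (h * x)"
      by (simp add: h_def)
    have "0 + (1 / sqrt T) * x = x / sqrt T" by simp
    hence "f (0 + (1 / sqrt T) * x) = complex_of_real (exp (- (x\<^sup>2) / 2)) * iexp (h * x)"
      unfolding f_def 1 2 exp_of_real by (simp only: 1 2 exp_of_real)
    thus "std_normal_density x *\<^sub>R iexp (h * x) = of_real (1 / sqrt (2 * pi)) * f (0 + (1 / sqrt T) * x)"
      by (simp only: std_normal_density_def scaleR_conv_of_real of_real_mult mult.assoc)
  qed
  also have "\<dots> = of_real (1 / sqrt (2 * pi)) * (LINT x|lborel. f (0 + (1 / sqrt T) * x))" by simp
  also have "(LINT x|lborel. f (0 + (1 / sqrt T) * x)) = of_real (sqrt T) * (LINT v|lborel. f v)"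
    using lborel_integral_real_affine[of "1 / sqrt T" f 0] sT
    by (simp add: scaleR_conv_of_real field_simps)
  finally have "(LINT v|lborel. f v) = complex_of_real (sqrt (2 * pi) / sqrt T * exp (- (h\<^sup>2) / 2))"
    using sT by (simp add: field_simps)
  moreover have "h\<^sup>2 = \<xi>\<^sup>2 / T" using T by (simp add: h_def power_divide)
  ultimately show ?thesis by (simp add: f_def real_sqrt_divide)
qed

lemma Gaussian_eq_integral:
  fixes T x y :: real
  assumes T: "T > 0"
  shows "of_real (1 / sqrt (2 * pi * T) * exp (- ((x - y)\<^sup>2 / (2 * T)))) =
    1 / (2 * of_real pi) *
     (LINT v|lborel. exp (of_real T * (Complex 0 v)\<^sup>2 / 2) * exp (\<i> * of_real v * of_real (y - x)))"
proof -
  have "Complex 0 v = \<i> * of_real v" for v by (simp add: complex_eq_iff)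
  hence "1 / (2 * of_real pi) *
     (LINT v|lborel. exp (of_real T * (Complex 0 v)\<^sup>2 / 2) * exp (\<i> * of_real v * of_real (y - x))) =
    1 / (2 * of_real pi) * complex_of_real (sqrt (2 * pi / T) * exp (- ((y - x)\<^sup>2 / (2 * T))))"
    using Gaussian_Fourier_integral[OF T, of "y - x"] by simp
  also have "\<dots> = of_real ((sqrt (2 * pi / T) / (2 * pi)) * exp (- ((y - x)\<^sup>2 / (2 * T))))" by simp
  also have "sqrt (2 * pi / T) / (2 * pi) = 1 / sqrt (2 * pi * T)"
  proof -
    have "sqrt (2 * pi) * sqrt (2 * pi) = 2 * pi" by simp
    thus ?thesis using T by (simp add: real_sqrt_divide real_sqrt_mult field_simps)
  qed
  also have "(y - x)\<^sup>2 = (x - y)\<^sup>2" by (rule power2_commute)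
  finally show ?thesis ..
qed

section \<open>Convergence of the kernels\<close>

lemma rescaled_hard_edge_kernel_eq:
  fixes \<tau> t \<delta> c' c a x y :: real and n :: nat
  assumes "\<tau> > 0" "t > 0" and \<delta>: "\<delta> > 0" and c: "0 < c'" "c' < c" "c < 1" and x: "x \<ge> 0"
    and n: "n \<ge> 1" and a: "a > - (real n - 1)"
  defines "q \<equiv> nat \<lfloor>\<tau> * real n\<rfloor>" and "r \<equiv> nat \<lfloor>t * real n\<rfloor>"
  defines "\<alpha> \<equiv> (\<lambda>s. normalized_Gamma n (Complex (- c) s) ^ r / Gamma (- Complex (- c) s))"
    and "\<beta> \<equiv> (\<lambda>s. Gamma (- zeta_path \<delta> c' s) / normalized_Gamma n (zeta_path \<delta> c' s) ^ q)"
  assumes r: "r \<ge> 40" and qr: "r > q \<Longrightarrow> q + 8 \<le> r" and \<beta>: "integrable lborel \<beta>"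
  shows "rescaled_hard_edge_kernel \<delta> c' c a n \<tau> x t y =
     - (if r > q then 1 / (2 * of_real pi) *
       (LINT v|lborel. normalized_Gamma n (Complex 0 v) ^ (r - q) * exp (\<i> * of_real v * of_real (y - x))) else 0)
     + double_contour_integral \<delta> c' c \<alpha> \<beta> x y"
proof -
  define X Y where "X = exp (real q * critical_exponent n - x)" and "Y = exp (real r * critical_exponent n - y)"
  define P where "P = complex_of_real (Y * Gamma (real n) ^ q / Gamma (real n) ^ r)"
  have fl: "of_int \<lfloor>\<tau> * real n\<rfloor> = real q" "of_int \<lfloor>t * real n\<rfloor> = real r"
    "\<lfloor>\<tau> * real n\<rfloor> = int q" "\<lfloor>t * real n\<rfloor> = int r"
    using assms(1,2) by (simp_all add: q_def r_def)
  have X: "hard_edge_scaling n \<tau> x = X" and Y: "hard_edge_scaling n t y = Y"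
    unfolding hard_edge_scaling_def X_def Y_def critical_exponent_def fl by simp_all
  have Gpos: "Gamma (real n) > 0" using n by simp
  have powi: "Gamma (real n) powi (int r - int q) = Gamma (real n) ^ r / Gamma (real n) ^ q"
    using Gpos by (subst power_int_diff) auto
  have "rescaled_hard_edge_kernel \<delta> c' c a n \<tau> x t y =
      P * hard_edge_kernel \<delta> c' c a (\<lambda>_. n) q X r Y"
    unfolding rescaled_hard_edge_kernel_def X Y fl(3,4) powi by (simp add: P_def)
  also have "\<dots> = - (if r > q then P * (1 / of_real X * meijer_G_p0 a (map (\<lambda>j. real n - 1) [q+1..<r+1]) (Y / X)) else 0)
      + P * S'_sigma_integral \<delta> c (\<lambda>\<sigma>. 1 / (2 * of_real pi * \<i>) *
         S_zeta_integral \<delta> c' (\<lambda>\<zeta>. 1 / (2 * of_real pi * \<i>) *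
           (Gamma (\<sigma> + of_nat n) ^ r / Gamma (\<zeta> + of_nat n) ^ q
            * (Gamma (- \<zeta>) / Gamma (- \<sigma>))
            * (of_real X powr \<zeta> * of_real Y powr (- \<sigma> - 1) / (\<sigma> - \<zeta>)))))"
    unfolding hard_edge_kernel_def by (simp add: distrib_left right_diff_distrib)
  also have "P * S'_sigma_integral \<delta> c (\<lambda>\<sigma>. 1 / (2 * of_real pi * \<i>) *
         S_zeta_integral \<delta> c' (\<lambda>\<zeta>. 1 / (2 * of_real pi * \<i>) *
           (Gamma (\<sigma> + of_nat n) ^ r / Gamma (\<zeta> + of_nat n) ^ q
            * (Gamma (- \<zeta>) / Gamma (- \<sigma>))
            * (of_real X powr \<zeta> * of_real Y powr (- \<sigma> - 1) / (\<sigma> - \<zeta>))))) =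
      double_contour_integral \<delta> c' c \<alpha> \<beta> x y"
    unfolding P_def X_def Y_def \<alpha>_def \<beta>_def
    by (rule hard_edge_double_integral_eq) (use \<delta> c x n r \<beta> in \<open>simp_all add: \<beta>_def\<close>)
  also have "(if r > q then P * (1 / of_real X * meijer_G_p0 a (map (\<lambda>j. real n - 1) [q+1..<r+1]) (Y / X)) else 0) =
     (if r > q then 1 / (2 * of_real pi) *
       (LINT v|lborel. normalized_Gamma n (Complex 0 v) ^ (r - q) * exp (\<i> * of_real v * of_real (y - x))) else 0)"
    unfolding P_def X_def Y_def using meijer_term_eq[OF n qr a, where x = x and y = y]
    by (auto simp del: upt_Suc)
  finally show ?thesis .
qed

lemma tendsto_nat_floor_ratio:
  assumes "\<tau> > 0"
  shows "(\<lambda>n. real (nat \<lfloor>\<tau> * real n\<rfloor>) / real n) \<longlonglongrightarrow> \<tau>"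
proof (rule tendsto_sandwich)
  show "\<forall>\<^sub>F n in sequentially. \<tau> - 1 / real n \<le> real (nat \<lfloor>\<tau> * real n\<rfloor>) / real n"
    using eventually_gt_at_top[of 0]
  proof eventually_elim
    case (elim n)
    have "\<tau> - 1 / real n = (\<tau> * real n - 1) / real n" using elim by (simp add: diff_divide_distrib)
    also have "\<dots> \<le> real (nat \<lfloor>\<tau> * real n\<rfloor>) / real n"
      using assms by (intro divide_right_mono) linarith+
    finally show ?case .
  qed
  show "\<forall>\<^sub>F n in sequentially. real (nat \<lfloor>\<tau> * real n\<rfloor>) / real n \<le> \<tau>"
    using eventually_gt_at_top[of 0]
  proof eventually_elim
    case (elim n)
    have "real (nat \<lfloor>\<tau> * real n\<rfloor>) \<le> \<tau> * real n" using assms by simp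
    thus ?case using elim by (simp add: field_simps)
  qed
  show "(\<lambda>n. \<tau> - 1 / real n) \<longlonglongrightarrow> \<tau>" by real_asymp
qed simp

lemma eventually_ge_if_ratio_tendsto_pos:
  assumes k: "(\<lambda>n. real (k n) / real n) \<longlonglongrightarrow> T" and T: "T > 0"
  shows "\<forall>\<^sub>F n in sequentially. m \<le> k n"
proof -
  have "filterlim (\<lambda>n. real (k n) / real n * real n) at_top sequentially"
    using k T filterlim_real_sequentially by (rule filterlim_tendsto_pos_mult_at_top)
  hence "\<forall>\<^sub>F n in sequentially. real m \<le> real (k n) / real n * real n"
    by (simp add: filterlim_at_top)
  thus ?thesis using eventually_gt_at_top[of 0] by eventually_elim simp
qed

theorem theorem2p5:
  fixes \<tau> t \<delta> c' c :: real and a :: "nat \<Rightarrow> real" and A B :: "real set"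
  assumes "\<tau> > 0" and "t > 0"
    and "\<delta> > 0" and "0 < c'" and "c' < c" and "c < 1"
    and "\<And>n. n \<ge> 1 \<Longrightarrow> a n > - (real n - 1)"
    and "compact A" and "A \<subseteq> {0<..}" and "compact B" and "B \<subseteq> {0<..}"
  shows "uniform_limit (A \<times> B)
           (\<lambda>n (x, y). rescaled_hard_edge_kernel \<delta> c' c (a n) n \<tau> x t y)
           (\<lambda>(x, y). critical_kernel \<delta> c' c \<tau> x t y) sequentially"
proof -
  have c1: "c' < 1" "0 < c" using assms by auto
  define q r where "q = (\<lambda>n. nat \<lfloor>\<tau> * real n\<rfloor>)" and "r = (\<lambda>n. nat \<lfloor>t * real n\<rfloor>)"
  have q: "(\<lambda>n. real (q n) / real n) \<longlonglongrightarrow> \<tau>" and r: "(\<lambda>n. real (r n) / real n) \<longlonglongrightarrow> t"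
    unfolding q_def r_def using assms tendsto_nat_floor_ratio by auto
  obtain M where M: "\<And>x. x \<in> A \<Longrightarrow> x \<le> M"
    using compact_imp_bounded[OF \<open>compact A\<close>] unfolding bounded_iff by (metis abs_le_D1 real_norm_def)

  define \<alpha>n where "\<alpha>n = (\<lambda>n s. normalized_Gamma n (Complex (- c) s) ^ r n / Gamma (- Complex (- c) s))"
  define \<alpha> where "\<alpha> = (\<lambda>s. exp (of_real t * (Complex (- c) s)\<^sup>2 / 2) / Gamma (- Complex (- c) s))"
  define \<beta>n where "\<beta>n = (\<lambda>n s. Gamma (- zeta_path \<delta> c' s) / normalized_Gamma n (zeta_path \<delta> c' s) ^ q n)"
  define \<beta> where "\<beta> = (\<lambda>s. Gamma (- zeta_path \<delta> c' s) / exp (of_real \<tau> * (zeta_path \<delta> c' s)\<^sup>2 / 2))"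
  define gn where "gn = (\<lambda>n v. normalized_Gamma n (Complex 0 v) ^ (r n - q n))"
  define g where "g = (\<lambda>v. exp (of_real (t - \<tau>) * (Complex 0 v)\<^sup>2 / 2))"
  have \<alpha>': "integrable lborel \<alpha>" "\<forall>\<^sub>F n in sequentially. integrable lborel (\<alpha>n n)"
    "(\<lambda>n. LINT s|lborel. norm (\<alpha>n n s - \<alpha> s)) \<longlonglongrightarrow> 0"
    unfolding \<alpha>n_def \<alpha>_def
    by (rule sigma_factor_L1_convergence[OF r \<open>t > 0\<close> c1(2) \<open>c < 1\<close>])+
  have \<beta>': "integrable lborel \<beta>" "\<forall>\<^sub>F n in sequentially. integrable lborel (\<beta>n n)"
    "(\<lambda>n. LINT s|lborel. norm (\<beta>n n s - \<beta> s)) \<longlonglongrightarrow> 0"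
    unfolding \<beta>n_def \<beta>_def
    by (rule zeta_factor_L1_convergence[OF q \<open>\<delta> > 0\<close> \<open>0 < c'\<close> c1(1)])+

  \<comment> \<open>\<open>E1\<close> and \<open>E2\<close> bound the errors of the double integral and of the single integral for all \<open>(x, y)\<close> at once.\<close>
  define E1 where "E1 = (\<lambda>n. exp (M * c') / (c - c') *
     ((LINT s|lborel. norm (\<alpha>n n s - \<alpha> s)) * ((LINT s|lborel. norm (\<beta> s)) + (LINT s|lborel. norm (\<beta>n n s - \<beta> s))) +
        (LINT s|lborel. norm (\<alpha> s)) * (LINT s|lborel. norm (\<beta>n n s - \<beta> s))))"
  define E2 where "E2 = (\<lambda>n. if t > \<tau> then LINT s|lborel. norm (gn n s - g s) else 0)"

  have "E1 \<longlonglongrightarrow> exp (M * c') / (c - c') * (0 * ((LINT s|lborel. norm (\<beta> s)) + 0) + (LINT s|lborel. norm (\<alpha> s)) * 0)"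
    unfolding E1_def by (intro tendsto_intros \<alpha>'(3) \<beta>'(3))
  hence E1: "E1 \<longlonglongrightarrow> 0" by simp

  have p: "(\<lambda>n. real (r n - q n) / real n) \<longlonglongrightarrow> t - \<tau>" "\<forall>\<^sub>F n in sequentially. q n + 8 \<le> r n" if "t > \<tau>"
  proof -
    have le: "q n \<le> r n" for n
      unfolding q_def r_def using that by (intro nat_mono floor_mono mult_right_mono) auto
    have "(\<lambda>n. real (r n) / real n - real (q n) / real n) \<longlonglongrightarrow> t - \<tau>" by (intro tendsto_intros q r)
    thus lim: "(\<lambda>n. real (r n - q n) / real n) \<longlonglongrightarrow> t - \<tau>" using le by (simp add: diff_divide_distrib of_nat_diff)
    show "\<forall>\<^sub>F n in sequentially. q n + 8 \<le> r n"
    proof -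
      have "t - \<tau> > 0" using that by simp
      from eventually_ge_if_ratio_tendsto_pos[OF lim this, of 8]
      show ?thesis by eventually_elim auto
    qed
  qed
  have g': "integrable lborel g" "\<forall>\<^sub>F n in sequentially. integrable lborel (gn n)"
    "(\<lambda>n. LINT s|lborel. norm (gn n s - g s)) \<longlonglongrightarrow> 0" if "t > \<tau>"
  proof -
    have "t - \<tau> > 0" using that by simp
    note * = imaginary_axis_L1_convergence[OF p(1)[OF that] this]
    show "integrable lborel g" "\<forall>\<^sub>F n in sequentially. integrable lborel (gn n)"
      "(\<lambda>n. LINT s|lborel. norm (gn n s - g s)) \<longlonglongrightarrow> 0"
      unfolding gn_def g_def by (rule *)+
  qed
  have E2: "E2 \<longlonglongrightarrow> 0"
    unfolding E2_def using g'(3) by (cases "t > \<tau>") auto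
  have ev_p: "\<forall>\<^sub>F n in sequentially. (q n < r n \<longleftrightarrow> t > \<tau>) \<and> (q n < r n \<longrightarrow> q n + 8 \<le> r n)
      \<and> (t > \<tau> \<longrightarrow> integrable lborel (gn n))"
  proof (cases "t > \<tau>")
    case True
    have "\<forall>\<^sub>F n in sequentially. integrable lborel (gn n)" using g'(2) True by simp
    with p(2)[OF True] show ?thesis by eventually_elim (use True in auto)
  next
    case False
    have "\<not> q n < r n" for n
      unfolding q_def r_def not_less using False by (intro nat_mono floor_mono mult_right_mono) auto
    thus ?thesis using False by simp
  qed
  have ev_r: "\<forall>\<^sub>F n in sequentially. 40 \<le> r n"
    using r \<open>t > 0\<close> by (rule eventually_ge_if_ratio_tendsto_pos)

  have main: "\<forall>\<^sub>F n in sequentially. \<forall>(x, y)\<in>A \<times> B.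
      dist (rescaled_hard_edge_kernel \<delta> c' c (a n) n \<tau> x t y) (critical_kernel \<delta> c' c \<tau> x t y) \<le> E1 n + E2 n"
    using \<alpha>'(2) \<beta>'(2) ev_p ev_r eventually_ge_at_top[of 1]
  proof eventually_elim
    case (elim n)
    show ?case
    proof (intro ballI case_prodI2, clarify)
      fix x y assume xy: "x \<in> A" "y \<in> B"
      have x: "x \<ge> 0" "x \<le> M" and y: "y \<ge> 0" using xy assms(9,11) M by (auto simp: less_imp_le subset_iff)
      define W where "W = (\<lambda>f. 1 / (2 * complex_of_real pi) *
         (LINT v|lborel. f v * exp (\<i> * of_real v * of_real (y - x))))"
      have 1: "rescaled_hard_edge_kernel \<delta> c' c (a n) n \<tau> x t y =
          - (if t > \<tau> then W (gn n) else 0) + double_contour_integral \<delta> c' c (\<alpha>n n) (\<beta>n n) x y"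
        using rescaled_hard_edge_kernel_eq[OF \<open>\<tau> > 0\<close> \<open>t > 0\<close> \<open>\<delta> > 0\<close> \<open>0 < c'\<close> \<open>c' < c\<close> \<open>c < 1\<close> x(1) elim(5)
           assms(7)[OF elim(5)], folded q_def r_def, folded \<alpha>n_def \<beta>n_def] elim
        by (simp add: W_def gn_def q_def r_def \<alpha>n_def \<beta>n_def)
      have 2: "critical_kernel \<delta> c' c \<tau> x t y =
          - (if t > \<tau> then W g else 0) + double_contour_integral \<delta> c' c \<alpha> \<beta> x y"
      proof -
        have "critical_kernel \<delta> c' c \<tau> x t y =
          - (if t > \<tau>
        then of_real (1 / sqrt (2 * pi * (t - \<tau>)) * exp (- ((x - y)\<^sup>2 / (2 * (t - \<tau>)))))
        else 0) + double_contour_integral \<delta> c' c \<alpha> \<beta> x y"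
          unfolding \<alpha>_def \<beta>_def
          by (rule critical_kernel_eq) (use assms x \<beta>'(1) in \<open>simp_all add: \<beta>_def\<close>)
        moreover have "of_real (1 / sqrt (2 * pi * (t - \<tau>)) * exp (- ((x - y)\<^sup>2 / (2 * (t - \<tau>))))) = W g"
          if "t > \<tau>"
          unfolding W_def g_def using that by (intro Gaussian_eq_integral) simp
        ultimately show ?thesis by simp
      qed
      have Wdiff: "norm (W (gn n) - W g) \<le> E2 n" if t: "t > \<tau>"
      proof -
        have int: "integrable lborel (\<lambda>v. f v * exp (\<i> * of_real v * of_real (y - x)))"
          if f: "integrable lborel f" for f :: "real \<Rightarrow> complex"
        proof (rule Bochner_Integration.integrable_bound[OF f])
          have [measurable]: "f \<in> borel_measurable borel" using borel_measurable_integrable[OF f] by simp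
          show "(\<lambda>v. f v * exp (\<i> * of_real v * of_real (y - x))) \<in> borel_measurable lborel" by measurable
        qed (auto simp: norm_mult)
        have ig: "integrable lborel (gn n)" "integrable lborel g" using elim(3) t g'(1) by auto
        have "norm (W (gn n) - W g) = 1 / (2 * pi) *
            norm (LINT v|lborel. (gn n v - g v) * exp (\<i> * of_real v * of_real (y - x)))"
        proof -
          have "W (gn n) - W g = 1 / (2 * complex_of_real pi) *
             (LINT v|lborel. (gn n v - g v) * exp (\<i> * of_real v * of_real (y - x)))"
            unfolding W_def using int[OF ig(1)] int[OF ig(2)]
            by (simp add: left_diff_distrib right_diff_distrib diff_divide_distrib)
          thus ?thesis by (simp add: norm_mult norm_divide)
        qed
        also have "\<dots> \<le> 1 * norm (LINT v|lborel. (gn n v - g v) * exp (\<i> * of_real v * of_real (y - x)))"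
          using pi_ge_two by (intro mult_right_mono) auto
        also have "\<dots> \<le> (LINT v|lborel. norm ((gn n v - g v) * exp (\<i> * of_real v * of_real (y - x))))"
          by simp
        also have "\<dots> = E2 n" using t by (simp add: E2_def norm_mult)
        finally show ?thesis .
      qed
      have Ddiff: "norm (double_contour_integral \<delta> c' c (\<alpha>n n) (\<beta>n n) x y - double_contour_integral \<delta> c' c \<alpha> \<beta> x y) \<le> E1 n"
      proof -
        have "norm (double_contour_integral \<delta> c' c (\<alpha>n n) (\<beta>n n) x y - double_contour_integral \<delta> c' c \<alpha> \<beta> x y) \<le>
           exp (x * c') / (c - c') * ((LINT s|lborel. norm (\<alpha>n n s - \<alpha> s)) * (LINT s|lborel. norm (\<beta>n n s)) +
              (LINT s|lborel. norm (\<alpha> s)) * (LINT s|lborel. norm (\<beta>n n s - \<beta> s)))"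
          by (rule double_contour_integral_diff_le) (use assms elim \<alpha>'(1) \<beta>'(1) x y in auto)
        also have "\<dots> \<le> E1 n"
          unfolding E1_def
        proof (intro mult_mono add_mono order_refl)
          show "exp (x * c') / (c - c') \<le> exp (M * c') / (c - c')"
            using x assms by (intro divide_right_mono) auto
          have "(LINT s|lborel. norm (\<beta>n n s)) \<le> (LINT s|lborel. norm (\<beta> s) + norm (\<beta>n n s - \<beta> s))"
          proof (rule integral_mono)
            show "norm (\<beta>n n s) \<le> norm (\<beta> s) + norm (\<beta>n n s - \<beta> s)" for s
              using norm_triangle_ineq[of "\<beta> s" "\<beta>n n s - \<beta> s"] by simp
          qed (use elim \<beta>'(1) in auto)
          also have "\<dots> = (LINT s|lborel. norm (\<beta> s)) + (LINT s|lborel. norm (\<beta>n n s - \<beta> s))"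
            using elim \<beta>'(1) by simp
          finally show "(LINT s|lborel. norm (\<beta>n n s)) \<le> (LINT s|lborel. norm (\<beta> s)) + (LINT s|lborel. norm (\<beta>n n s - \<beta> s))" .
        qed (use assms in \<open>auto intro!: add_nonneg_nonneg mult_nonneg_nonneg\<close>)
        finally show ?thesis .
      qed
      have "rescaled_hard_edge_kernel \<delta> c' c (a n) n \<tau> x t y - critical_kernel \<delta> c' c \<tau> x t y =
         (double_contour_integral \<delta> c' c (\<alpha>n n) (\<beta>n n) x y - double_contour_integral \<delta> c' c \<alpha> \<beta> x y)
           - (if t > \<tau> then W (gn n) - W g else 0)"
        unfolding 1 2 by simp
      also have "norm \<dots> \<le> E1 n + E2 n"
        by (rule order_trans[OF norm_triangle_ineq4 add_mono[OF Ddiff]])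
           (use Wdiff in \<open>auto simp: E2_def\<close>)
      finally show "dist (rescaled_hard_edge_kernel \<delta> c' c (a n) n \<tau> x t y) (critical_kernel \<delta> c' c \<tau> x t y) \<le> E1 n + E2 n"
        by (simp add: dist_norm)
    qed
  qed
  have E: "(\<lambda>n. E1 n + E2 n) \<longlonglongrightarrow> 0" using tendsto_add[OF E1 E2] by simp
  show ?thesis
  proof (rule uniform_limitI)
    fix e :: real assume "e > 0"
    have "\<forall>\<^sub>F n in sequentially. E1 n + E2 n < e" using E \<open>e > 0\<close> by (rule order_tendstoD)
    with main show "\<forall>\<^sub>F n in sequentially. \<forall>z\<in>A \<times> B.
        dist (case z of (x, y) \<Rightarrow> rescaled_hard_edge_kernel \<delta> c' c (a n) n \<tau> x t y)
             (case z of (x, y) \<Rightarrow> critical_kernel \<delta> c' c \<tau> x t y) < e"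
      by eventually_elim fastforce
  qed
qed

end
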